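(* Let $(S,g)$ be a compact, orientable Riemannian surface of class $C^2$ without boundary, and let $p\ge1$. Let $P$ be an open polygonal in $S$ made of $k$ geodesic arcs, with interior vertices $q_1,\dots,q_{k-1}$ and turning angles $\theta_1,\dots,\theta_{k-1}\in(0,\pi)$. If the mesh of $P$ is small, the corresponding curve $\gamma(P)$ satisfies $$\int_{\gamma(P)}|k_S(\gamma(P))|_g^p\,ds=\sum_{i=1}^{k-1}\int_{\gamma_{q_i}(P)}e^{(1-p)\lambda_{q_i}(\gamma_{q_i}(P)(s))}\Bigl|k_{\mathbb R^2}(\gamma_{q_i}(P)(s))+\partial_{\hat{\mathbf u}}\lambda_{q_i}(\gamma_{q_i}(P)(s))\Bigr|^p\,ds,$$ where for $i=1,\dots,k-1$, writing $\delta$ for the edge length at $q_i$ (that is $\delta=\ell_i$, the smaller of the lengths of the two arcs of $P$ meeting at $q_i$), $$\int_{\gamma_{q_i}(P)}|k_{\mathbb R^2}(\gamma_{q_i}(P))|^p\,ds=R_i^{1-p}\theta_i(1+o(\delta)),\qquad R_i=\frac{\delta+o(\delta)}{2\tan(\theta_i/2)+o(\delta)},$$ $$R_i\theta_i(1+o(\delta))\le\delta+o(\delta),\qquad \bigl|\partial_{\hat{\mathbf u}}\lambda_{q_i}(\gamma_{q_i}(P)(s))\bigr|\le C\delta,$$ with $o(\delta)$ the Landau symbol as $\delta\to0$ and $C>0$ a constant. The curves $\gamma(P)$, $\gamma_{q_i}(P)$, the radii $R_i$, the functions $\lambda_{q_i}$ and the conormal $\hat{\mathbf u}$ are defined in the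 context.
   Context: **Normalized isothermal charts.** For every $\epsilon>0$ there are $\delta_1=\delta_1(\epsilon,S)>0$ and $C_0>0$ such that each $q\in S$ has a neighborhood $U_q$ of positive diameter $d<\delta_1$ and a conformal map $\varphi_q:U_q\to\mathbb R^2$ with $\varphi_q(q)=(0,0)$ in which $g=e^{2\lambda_q}\mathrm{Id}$, where $\lambda_q:\varphi_q(U_q)\to\mathbb R$ satisfies $\lambda_q(0,0)=0$, $\nabla\lambda_q(0,0)=(0,0)$, $\partial^2_{xy}\lambda_q(0,0)=0$, and $|e^{\lambda_q}-1|\le\epsilon$, $\|\nabla\lambda_q\|\le C_0d$ on $\varphi_q(U_q)$. Such charts (for a small $\epsilon$) are fixed. **Polygonals.** A polygonal $P$ is the junction of $k$ consecutive oriented geodesic arcs $\gamma_1,\dots,\gamma_k$ with vertices $q_0,\dots,q_k$. The turning angle $\theta_i$ at $q_i$ ($1\le i\le k-1$) is the angle between the incoming and outgoing tangent directions; the mesh is the maximal arc length. **The curve $\gamma(P)$.** Let $1\le i\le k-1$, $q=q_i$, $\ell_i=\min\{\mathcal L(\gamma_i),\mathcal L(\gamma_{i+1})\}$, $a=\ell_i/2$. Let $\sigma_1,\sigma_2:[0,a]\to S$ be the pieces of $\gamma_i,\gamma_{i+1}$ of length $a$ starting at $q$, parameterized by arc length from $q$, and $\sigma_{j,q}=\varphi_q\circ\sigma_j$, $A_j=\sigma_{j,q}(a)$. Let $\alpha(a)$ be the angle between $\dot\sigma_{1,q}(a)$ and $\dot\sigma_{2,q}(a)$ and $\theta(a)=\pi-\alpha(a)$.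 If $\alpha(a)=\pi$, let $\gamma_q(P)$ be the straight segment between $A_1$ and $A_2$. Otherwise let $Q$ be the intersection point of the two lines through $A_j$ with direction $\dot\sigma_{j,q}(a)$ ($j=1,2$); the mesh is taken so small that $Q$ lies, on each line, on the side of $A_j$ in direction $-\dot\sigma_{j,q}(a)$. Put $\bar\ell_j=\|Q-A_j\|$. Then $\gamma_q(P)$ is the $C^1$ curve joining $A_1$ and $A_2$ consisting of a segment of length $|\bar\ell_1-\bar\ell_2|$ starting at the endpoint $A_j$ farther from $Q$ and pointing towards $Q$, followed by the arc of a circle of angle $\theta(a)$ which is tangent to the two lines at the two points at distance $\min\{\bar\ell_1,\bar\ell_2\}$ from $Q$; its radius is $R_i=\min\{\bar\ell_1,\bar\ell_2\}/\tan(\theta(a)/2)$ (the statements about $R_i$ refer to this nondegenerate case). The curve $\gamma(P)$ is obtained from $P$ by replacing, at each vertex $q_i$, $1\le i\le k-1$, the two geodesic pieces $\sigma_1,\sigma_2$ by $\varphi_{q_i}^{-1}\circ\gamma_{q_i}(P)$; elsewhere it coincides with $P$. **Curvatures.** $k_S$ is the geodesic curvature vector in $(S,g)$ and $|\cdot|_g$ its norm. In $\mathbb R^2$, $\gamma_{q_i}(P)$ is parameterized by Euclidean arc length $s$, $k_{\mathbb R^2}$ is its signed curvature with respect to the left unit normal $N$, and $\hat{\mathbf u}=-N$ is the conormal, so that for a curve in $S$ with image under $\varphi_q$ the signed geodesic curvature is $e^{-\lambda_q}(k_{\mathbb R^2}+\partial_{\hat{\mathbf u}}\lambda_q)$. 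*)

theory Defs
  imports "HOL-Analysis.Analysis" "HOL-Library.Landau_Symbols"
begin

section \<open>Surfaces of class C2\<close>

definition C1_on :: "'a::real_normed_vector set \<Rightarrow> ('a \<Rightarrow> 'b::real_normed_vector) \<Rightarrow> bool" where
  "C1_on V f \<longleftrightarrow> (\<exists>f'. (\<forall>x\<in>V. (f has_derivative blinfun_apply (f' x)) (at x)) \<and> continuous_on V f')"

definition C2_on :: "'a::real_normed_vector set \<Rightarrow> ('a \<Rightarrow> 'b::real_normed_vector) \<Rightarrow> bool" where
  "C2_on V f \<longleftrightarrow> (\<exists>f'. (\<forall>x\<in>V. (f has_derivative blinfun_apply (f' x)) (at x)) \<and> C1_on V f')"

text \<open>A chart is a pair of its domain and its coordinate map; the values of the coordinate map
  off the domain are irrelevant.\<close>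

type_synonym 'a chart = "'a set \<times> ('a \<Rightarrow> real^2)"

definition is_chart :: "'a::t2_space set \<Rightarrow> 'a chart \<Rightarrow> bool" where
  "is_chart S c \<longleftrightarrow> (case c of (U, \<psi>) \<Rightarrow>
     openin (top_of_set S) U \<and> open (\<psi> ` U) \<and> (\<exists>\<psi>'. homeomorphism U (\<psi> ` U) \<psi> \<psi>'))"

definition overlap :: "'a chart \<Rightarrow> 'a chart \<Rightarrow> (real^2) set" where
  "overlap c c' = snd c ` (fst c \<inter> fst c')"

definition transition :: "'a chart \<Rightarrow> 'a chart \<Rightarrow> real^2 \<Rightarrow> real^2" where
  "transition c c' = snd c' \<circ> inv_into (fst c) (snd c)"

definition jacobian :: "'a chart \<Rightarrow> 'a chart \<Rightarrow> real^2 \<Rightarrow> real^2^2" where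
  "jacobian c c' z = matrix (frechet_derivative (transition c c') (at z))"

definition C2_compatible :: "'a chart \<Rightarrow> 'a chart \<Rightarrow> bool" where
  "C2_compatible c c' \<longleftrightarrow>
     C2_on (overlap c c') (transition c c') \<and> C2_on (overlap c' c) (transition c' c)"

text \<open>The set \<open>A\<close> is a maximal atlas, i.e. it contains every chart compatible with it.
  Charts have open images in the plane, so there is no boundary. Second countability is not
  listed because \<open>S\<close> will be compact.\<close>

definition C2_surface :: "'a::t2_space set \<Rightarrow> 'a chart set \<Rightarrow> bool" where
  "C2_surface S A \<longleftrightarrow>
     (\<forall>c\<in>A. is_chart S c) \<and> (\<Union>c\<in>A. fst c) = S \<and>
     (\<forall>c\<in>A. \<forall>c'\<in>A. C2_compatible c c') \<and>
     (\<forall>c. is_chart S c \<and> (\<forall>c'\<in>A. C2_compatible c c') \<longrightarrow> c \<in> A)"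

definition orientable_surface :: "'a::t2_space set \<Rightarrow> 'a chart set \<Rightarrow> bool" where
  "orientable_surface S A \<longleftrightarrow>
     (\<exists>B\<subseteq>A. (\<Union>c\<in>B. fst c) = S \<and>
       (\<forall>c\<in>B. \<forall>c'\<in>B. \<forall>z\<in>overlap c c'. det (jacobian c c' z) > 0))"

text \<open>\<open>G c z\<close> is the Gram matrix of the metric in the chart \<open>c\<close> at the coordinate point \<open>z\<close>.
  On a surface whose transition maps are of class C2 the transformation law involves first
  derivatives of these maps, so C1 is the regularity of the coefficients that is meaningful in
  every chart. A C2 metric on a C3 surface is a special case (pass to the generated C2 atlas).\<close>

definition riemannian_metric :: "'a chart set \<Rightarrow> ('a chart \<Rightarrow> real^2 \<Rightarrow> real^2^2) \<Rightarrow> bool" where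
  "riemannian_metric A G \<longleftrightarrow>
     (\<forall>c\<in>A. C1_on (snd c ` fst c) (G c) \<and>
        (\<forall>z\<in>snd c ` fst c. transpose (G c z) = G c z \<and> (\<forall>v. v \<noteq> 0 \<longrightarrow> v \<bullet> (G c z *v v) > 0))) \<and>
     (\<forall>c\<in>A. \<forall>c'\<in>A. \<forall>z\<in>overlap c c'.
        G c z = transpose (jacobian c c' z) ** G c' (transition c c' z) ** jacobian c c' z)"

definition riemannian_surface ::
    "'a::t2_space set \<Rightarrow> 'a chart set \<Rightarrow> ('a chart \<Rightarrow> real^2 \<Rightarrow> real^2^2) \<Rightarrow> bool" where
  "riemannian_surface S A G \<longleftrightarrow> C2_surface S A \<and> riemannian_metric A G"

section \<open>Length, curvature and geodesics\<close>

definition partial_deriv :: "2 \<Rightarrow> (real^2 \<Rightarrow> real) \<Rightarrow> real^2 \<Rightarrow> real" where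
  "partial_deriv i f z = frechet_derivative f (at z) (axis i 1)"

definition grad :: "(real^2 \<Rightarrow> real) \<Rightarrow> real^2 \<Rightarrow> real^2" where
  "grad f z = (\<chi> i. partial_deriv i f z)"

definition christoffel :: "(real^2 \<Rightarrow> real^2^2) \<Rightarrow> real^2 \<Rightarrow> 2 \<Rightarrow> 2 \<Rightarrow> 2 \<Rightarrow> real" where
  "christoffel h z m i j = 1/2 * (\<Sum>l\<in>UNIV. matrix_inv (h z) $ m $ l *
     (partial_deriv i (\<lambda>y. h y $ j $ l) z + partial_deriv j (\<lambda>y. h y $ i $ l) z
      - partial_deriv l (\<lambda>y. h y $ i $ j) z))"

definition christoffel_form :: "(real^2 \<Rightarrow> real^2^2) \<Rightarrow> real^2 \<Rightarrow> real^2 \<Rightarrow> real^2 \<Rightarrow> real^2" where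
  "christoffel_form h z v w = (\<chi> m. \<Sum>i\<in>UNIV. \<Sum>j\<in>UNIV. christoffel h z m i j * v $ i * w $ j)"

definition gram_norm :: "real^2^2 \<Rightarrow> real^2 \<Rightarrow> real" where
  "gram_norm M v = sqrt (v \<bullet> (M *v v))"

definition gram_angle :: "real^2^2 \<Rightarrow> real^2 \<Rightarrow> real^2 \<Rightarrow> real" where
  "gram_angle M v w = arccos ((v \<bullet> (M *v w)) / (gram_norm M v * gram_norm M w))"

text \<open>Speed, geodesic curvature and angles do not depend on the chart in which they are computed;
  they are evaluated in an arbitrary chart of the atlas around the point in question.\<close>

definition chart_at :: "'a chart set \<Rightarrow> 'a \<Rightarrow> 'a chart" where
  "chart_at A x = (SOME c. c \<in> A \<and> x \<in> fst c)"

definition speed ::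
    "'a chart set \<Rightarrow> ('a chart \<Rightarrow> real^2 \<Rightarrow> real^2^2) \<Rightarrow> (real \<Rightarrow> 'a) \<Rightarrow> real \<Rightarrow> real" where
  "speed A G c t = (let ch = chart_at A (c t); x = snd ch \<circ> c in
     gram_norm (G ch (x t)) (vector_derivative x (at t within {0..1})))"

text \<open>The geodesic curvature vector of a path on \<open>{0..1}\<close> is the covariant derivative of the unit
  tangent \<open>T\<close> with respect to arc length.\<close>

definition curvature_vector_in ::
    "'a chart \<Rightarrow> ('a chart \<Rightarrow> real^2 \<Rightarrow> real^2^2) \<Rightarrow> (real \<Rightarrow> 'a) \<Rightarrow> real \<Rightarrow> real^2" where
  "curvature_vector_in ch G c t = (let
     x = snd ch \<circ> c;
     v = (\<lambda>r. vector_derivative x (at r within {0..1}));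
     T = (\<lambda>r. v r /\<^sub>R gram_norm (G ch (x r)) (v r)) in
     (vector_derivative T (at t within {0..1}) + christoffel_form (G ch) (x t) (v t) (T t))
       /\<^sub>R gram_norm (G ch (x t)) (v t))"

definition geodesic_curvature_norm ::
    "'a chart set \<Rightarrow> ('a chart \<Rightarrow> real^2 \<Rightarrow> real^2^2) \<Rightarrow> (real \<Rightarrow> 'a) \<Rightarrow> real \<Rightarrow> real" where
  "geodesic_curvature_norm A G c t = (let ch = chart_at A (c t) in
     gram_norm (G ch (snd ch (c t))) (curvature_vector_in ch G c t))"

definition unit_speed_geodesic :: "'a::t2_space set \<Rightarrow> 'a chart set \<Rightarrow>
    ('a chart \<Rightarrow> real^2 \<Rightarrow> real^2^2) \<Rightarrow> real \<Rightarrow> (real \<Rightarrow> 'a) \<Rightarrow> bool" where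
  "unit_speed_geodesic S A G l \<sigma> \<longleftrightarrow> continuous_on {0..l} \<sigma> \<and> \<sigma> ` {0..l} \<subseteq> S \<and>
     (\<forall>ch\<in>A. \<exists>v. \<forall>t\<in>{0..l}. \<sigma> t \<in> fst ch \<longrightarrow>
        ((snd ch \<circ> \<sigma>) has_vector_derivative v t) (at t within {0..l}) \<and>
        (v has_vector_derivative - christoffel_form (G ch) (snd ch (\<sigma> t)) (v t) (v t))
           (at t within {0..l}) \<and>
        gram_norm (G ch (snd ch (\<sigma> t))) (v t) = 1)"

definition piecewise_C1_path :: "'a::t2_space set \<Rightarrow> 'a chart set \<Rightarrow> (real \<Rightarrow> 'a) \<Rightarrow> bool" where
  "piecewise_C1_path S A c \<longleftrightarrow> path c \<and> path_image c \<subseteq> S \<and>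
     (\<exists>F. finite F \<and> (\<forall>ch\<in>A. (snd ch \<circ> c) C1_differentiable_on {t \<in> {0..1} - F. c t \<in> fst ch}))"

text \<open>The open metric disk of radius \<open>r\<close> about \<open>q\<close> for the Riemannian distance (the infimum of the
  lengths of piecewise C1 paths).\<close>

definition metric_disk :: "'a::t2_space set \<Rightarrow> 'a chart set \<Rightarrow>
    ('a chart \<Rightarrow> real^2 \<Rightarrow> real^2^2) \<Rightarrow> 'a \<Rightarrow> real \<Rightarrow> 'a set" where
  "metric_disk S A G q r = {x. \<exists>c. piecewise_C1_path S A c \<and> pathstart c = q \<and> pathfinish c = x \<and>
     speed A G c integrable_on {0..1} \<and> integral {0..1} (speed A G c) < r}"

section \<open>Normalized isothermal charts\<close>

text \<open>The charts come with constants \<open>\<delta>1\<close>, \<open>C0\<close> that serve every diameter \<open>d < \<delta>1\<close>: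
  the neighbourhood of \<open>q\<close> of diameter \<open>d\<close> is the metric disk of radius \<open>d / 2\<close>, on all of
  which one coordinate map \<open>\<phi> q\<close> is used, with conformal factor \<open>exp (lam q)\<close>.\<close>

definition normalized_isothermal_charts :: "'a::t2_space set \<Rightarrow> 'a chart set \<Rightarrow>
    ('a chart \<Rightarrow> real^2 \<Rightarrow> real^2^2) \<Rightarrow> real \<Rightarrow> real \<Rightarrow> real \<Rightarrow>
    ('a \<Rightarrow> 'a \<Rightarrow> real^2) \<Rightarrow> ('a \<Rightarrow> real^2 \<Rightarrow> real) \<Rightarrow> bool" where
  "normalized_isothermal_charts S A G \<epsilon> \<delta>1 C0 \<phi> lam \<longleftrightarrow> (\<forall>q\<in>S.
     \<phi> q q = 0 \<and> lam q 0 = 0 \<and> grad (lam q) 0 = 0 \<and>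
     (\<exists>H. (grad (lam q) has_derivative H) (at 0) \<and> H (axis 1 1) $ 2 = 0) \<and>
     (\<forall>d\<in>{0<..<\<delta>1}. let U = metric_disk S A G q (d / 2) in
        (U, \<phi> q) \<in> A \<and>
        (\<forall>z\<in>\<phi> q ` U. G (U, \<phi> q) z = mat (exp (2 * lam q z)) \<and>
           \<bar>exp (lam q z) - 1\<bar> \<le> \<epsilon> \<and> norm (grad (lam q) z) \<le> C0 * d)))"

section \<open>Polygonals\<close>

text \<open>The arcs are \<open>\<gamma> 1, \<dots>, \<gamma> k\<close>, with \<open>\<gamma> j\<close> parameterized by arc length on \<open>{0..L j}\<close>, so that
  \<open>L j\<close> is its length; the vertices are \<open>\<gamma> 1 0\<close> and \<open>\<gamma> i (L i)\<close> for \<open>1 \<le> i \<le> k\<close>.\<close>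

definition polygonal :: "'a::t2_space set \<Rightarrow> 'a chart set \<Rightarrow>
    ('a chart \<Rightarrow> real^2 \<Rightarrow> real^2^2) \<Rightarrow> nat \<Rightarrow> (nat \<Rightarrow> real) \<Rightarrow> (nat \<Rightarrow> real \<Rightarrow> 'a) \<Rightarrow> bool" where
  "polygonal S A G k L \<gamma> \<longleftrightarrow> 1 \<le> k \<and>
     (\<forall>j\<in>{1..k}. 0 < L j \<and> unit_speed_geodesic S A G (L j) (\<gamma> j)) \<and>
     (\<forall>i\<in>{1..<k}. \<gamma> i (L i) = \<gamma> (Suc i) 0)"

definition mesh :: "nat \<Rightarrow> (nat \<Rightarrow> real) \<Rightarrow> real" where
  "mesh k L = Max (L ` {1..k})"

definition vertex :: "(nat \<Rightarrow> real) \<Rightarrow> (nat \<Rightarrow> real \<Rightarrow> 'a) \<Rightarrow> nat \<Rightarrow> 'a" where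
  "vertex L \<gamma> i = \<gamma> i (L i)"

definition turning_angle :: "'a chart set \<Rightarrow> ('a chart \<Rightarrow> real^2 \<Rightarrow> real^2^2) \<Rightarrow>
    (nat \<Rightarrow> real) \<Rightarrow> (nat \<Rightarrow> real \<Rightarrow> 'a) \<Rightarrow> nat \<Rightarrow> real" where
  "turning_angle A G L \<gamma> i = (let q = vertex L \<gamma> i; ch = chart_at A q in
     gram_angle (G ch (snd ch q))
       (vector_derivative (snd ch \<circ> \<gamma> i) (at (L i) within {0..L i}))
       (vector_derivative (snd ch \<circ> \<gamma> (Suc i)) (at 0 within {0..L (Suc i)})))"

definition edge_length :: "(nat \<Rightarrow> real) \<Rightarrow> nat \<Rightarrow> real" where
  "edge_length L i = min (L i) (L (Suc i))"

section \<open>Rounding a corner in the plane\<close>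

text \<open>A ray \<open>(B, u)\<close> consists of a point \<open>B\<close> (one of \<open>A1\<close>, \<open>A2\<close>) and of the velocity \<open>u\<close> there of the
  arc coming from the vertex; the lines through \<open>B\<close> with direction \<open>u\<close> meet at \<open>Q\<close>, on the side
  of \<open>- u\<close>.\<close>

type_synonym ray = "(real^2) \<times> (real^2)"

definition rot :: "real^2 \<Rightarrow> real^2" where
  "rot v = vector [- v $ 2, v $ 1]"

definition ray_angle :: "ray \<Rightarrow> ray \<Rightarrow> real" where
  "ray_angle r1 r2 = gram_angle (mat 1) (snd r1) (snd r2)"

definition rounding_angle :: "ray \<Rightarrow> ray \<Rightarrow> real" where
  "rounding_angle r1 r2 = pi - ray_angle r1 r2"

definition corner_point :: "ray \<Rightarrow> ray \<Rightarrow> real^2" where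
  "corner_point r1 r2 = (THE Q. (\<exists>s. Q = fst r1 + s *\<^sub>R snd r1) \<and> (\<exists>t. Q = fst r2 + t *\<^sub>R snd r2))"

definition tangent_length :: "ray \<Rightarrow> ray \<Rightarrow> real" where
  "tangent_length r1 r2 =
     min (dist (corner_point r1 r2) (fst r1)) (dist (corner_point r1 r2) (fst r2))"

definition rounding_radius :: "ray \<Rightarrow> ray \<Rightarrow> real" where
  "rounding_radius r1 r2 = tangent_length r1 r2 / tan (rounding_angle r1 r2 / 2)"

text \<open>The rounded corner, parameterized by Euclidean arc length from \<open>A1\<close> to \<open>A2\<close>: a segment of
  length \<open>l1\<close>, a circular arc of length \<open>R * \<theta>\<close>, a segment of length \<open>l2\<close>. Here
  \<open>l1 = 0\<close> or \<open>l2 = 0\<close>, so that the only nontrivial segment is the one at the point farther from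
  \<open>Q\<close>. The sign \<open>\<tau>\<close> tells whether the arc turns left or right.\<close>

definition rounding_length :: "ray \<Rightarrow> ray \<Rightarrow> real" where
  "rounding_length r1 r2 =
     (if ray_angle r1 r2 = pi then dist (fst r1) (fst r2)
      else \<bar>dist (corner_point r1 r2) (fst r1) - dist (corner_point r1 r2) (fst r2)\<bar>
           + rounding_radius r1 r2 * rounding_angle r1 r2)"

definition rounding :: "ray \<Rightarrow> ray \<Rightarrow> real \<Rightarrow> real^2" where
  "rounding r1 r2 s =
     (if ray_angle r1 r2 = pi then fst r1 + s *\<^sub>R sgn (fst r2 - fst r1)
      else let
        Q = corner_point r1 r2; m = tangent_length r1 r2;
        R = rounding_radius r1 r2; \<theta> = rounding_angle r1 r2;
        w1 = - sgn (snd r1); w2 = - sgn (snd r2);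
        l1 = dist Q (fst r1) - m;
        \<tau> = sgn (rot w1 \<bullet> (- w2)) in
        if s \<le> l1 then fst r1 + s *\<^sub>R w1
        else if s \<le> l1 + R * \<theta> then
          (Q - m *\<^sub>R w1) + (R * sin ((s - l1) / R)) *\<^sub>R w1
            + (\<tau> * R * (1 - cos ((s - l1) / R))) *\<^sub>R rot w1
        else (Q - m *\<^sub>R w2) + (s - l1 - R * \<theta>) *\<^sub>R (- w2))"

text \<open>These notions are meant for curves on \<open>{0..l}\<close> that are parameterized by arc length; the
  conormal is the opposite of the left unit normal.\<close>

definition plane_tangent :: "real \<Rightarrow> (real \<Rightarrow> real^2) \<Rightarrow> real \<Rightarrow> real^2" where
  "plane_tangent l c s = vector_derivative c (at s within {0..l})"

definition plane_normal :: "real \<Rightarrow> (real \<Rightarrow> real^2) \<Rightarrow> real \<Rightarrow> real^2" where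
  "plane_normal l c s = rot (plane_tangent l c s)"

definition plane_curvature :: "real \<Rightarrow> (real \<Rightarrow> real^2) \<Rightarrow> real \<Rightarrow> real" where
  "plane_curvature l c s =
     vector_derivative (plane_tangent l c) (at s within {0..l}) \<bullet> plane_normal l c s"

definition conormal_deriv :: "real \<Rightarrow> (real \<Rightarrow> real^2) \<Rightarrow> (real^2 \<Rightarrow> real) \<Rightarrow> real \<Rightarrow> real" where
  "conormal_deriv l c f s = grad f (c s) \<bullet> (- plane_normal l c s)"

section \<open>The rounded polygonal\<close>

definition incoming_ray ::
    "('a \<Rightarrow> 'a \<Rightarrow> real^2) \<Rightarrow> (nat \<Rightarrow> real) \<Rightarrow> (nat \<Rightarrow> real \<Rightarrow> 'a) \<Rightarrow> nat \<Rightarrow> ray" where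
  "incoming_ray \<phi> L \<gamma> i = (let a = edge_length L i / 2;
     \<sigma> = (\<lambda>t. \<phi> (vertex L \<gamma> i) (\<gamma> i (L i - t))) in
     (\<sigma> a, vector_derivative \<sigma> (at a within {0..a})))"

definition outgoing_ray ::
    "('a \<Rightarrow> 'a \<Rightarrow> real^2) \<Rightarrow> (nat \<Rightarrow> real) \<Rightarrow> (nat \<Rightarrow> real \<Rightarrow> 'a) \<Rightarrow> nat \<Rightarrow> ray" where
  "outgoing_ray \<phi> L \<gamma> i = (let a = edge_length L i / 2;
     \<sigma> = (\<lambda>t. \<phi> (vertex L \<gamma> i) (\<gamma> (Suc i) t)) in
     (\<sigma> a, vector_derivative \<sigma> (at a within {0..a})))"

definition corner_curve ::
    "('a \<Rightarrow> 'a \<Rightarrow> real^2) \<Rightarrow> (nat \<Rightarrow> real) \<Rightarrow> (nat \<Rightarrow> real \<Rightarrow> 'a) \<Rightarrow> nat \<Rightarrow> real \<Rightarrow> real^2" where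
  "corner_curve \<phi> L \<gamma> i = rounding (incoming_ray \<phi> L \<gamma> i) (outgoing_ray \<phi> L \<gamma> i)"

definition corner_length ::
    "('a \<Rightarrow> 'a \<Rightarrow> real^2) \<Rightarrow> (nat \<Rightarrow> real) \<Rightarrow> (nat \<Rightarrow> real \<Rightarrow> 'a) \<Rightarrow> nat \<Rightarrow> real" where
  "corner_length \<phi> L \<gamma> i = rounding_length (incoming_ray \<phi> L \<gamma> i) (outgoing_ray \<phi> L \<gamma> i)"

definition corner_radius ::
    "('a \<Rightarrow> 'a \<Rightarrow> real^2) \<Rightarrow> (nat \<Rightarrow> real) \<Rightarrow> (nat \<Rightarrow> real \<Rightarrow> 'a) \<Rightarrow> nat \<Rightarrow> real" where
  "corner_radius \<phi> L \<gamma> i = rounding_radius (incoming_ray \<phi> L \<gamma> i) (outgoing_ray \<phi> L \<gamma> i)"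

text \<open>The rounded corner in the surface, rescaled to \<open>{0..1}\<close>; \<open>U q\<close> is the domain on which
  \<open>\<phi> q\<close> is inverted.\<close>

definition corner_path :: "('a \<Rightarrow> 'a set) \<Rightarrow> ('a \<Rightarrow> 'a \<Rightarrow> real^2) \<Rightarrow>
    (nat \<Rightarrow> real) \<Rightarrow> (nat \<Rightarrow> real \<Rightarrow> 'a) \<Rightarrow> nat \<Rightarrow> real \<Rightarrow> 'a" where
  "corner_path U \<phi> L \<gamma> i t = (let q = vertex L \<gamma> i in
     inv_into (U q) (\<phi> q) (corner_curve \<phi> L \<gamma> i (corner_length \<phi> L \<gamma> i * t)))"

definition trim :: "nat \<Rightarrow> (nat \<Rightarrow> real) \<Rightarrow> nat \<Rightarrow> real" where
  "trim k L i = (if i \<in> {1..<k} then edge_length L i / 2 else 0)"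

text \<open>The part of \<open>\<gamma> j\<close> that is kept, rescaled to \<open>{0..1}\<close> (possibly a single point).\<close>

definition kept_arc ::
    "nat \<Rightarrow> (nat \<Rightarrow> real) \<Rightarrow> (nat \<Rightarrow> real \<Rightarrow> 'a) \<Rightarrow> nat \<Rightarrow> real \<Rightarrow> 'a" where
  "kept_arc k L \<gamma> j t = \<gamma> j (trim k L (j - 1) + t * (L j - trim k L j - trim k L (j - 1)))"

primrec rounded_upto :: "('a::topological_space \<Rightarrow> 'a set) \<Rightarrow> ('a \<Rightarrow> 'a \<Rightarrow> real^2) \<Rightarrow>
    nat \<Rightarrow> (nat \<Rightarrow> real) \<Rightarrow> (nat \<Rightarrow> real \<Rightarrow> 'a) \<Rightarrow> nat \<Rightarrow> real \<Rightarrow> 'a" where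
  "rounded_upto U \<phi> k L \<gamma> 0 = kept_arc k L \<gamma> 1"
| "rounded_upto U \<phi> k L \<gamma> (Suc i) = rounded_upto U \<phi> k L \<gamma> i +++
     (corner_path U \<phi> L \<gamma> (Suc i) +++ kept_arc k L \<gamma> (Suc (Suc i)))"

definition rounded_polygonal :: "('a::topological_space \<Rightarrow> 'a set) \<Rightarrow> ('a \<Rightarrow> 'a \<Rightarrow> real^2) \<Rightarrow>
    nat \<Rightarrow> (nat \<Rightarrow> real) \<Rightarrow> (nat \<Rightarrow> real \<Rightarrow> 'a) \<Rightarrow> real \<Rightarrow> 'a" where
  "rounded_polygonal U \<phi> k L \<gamma> = rounded_upto U \<phi> k L \<gamma> (k - 1)"

end

theory Submission
  imports Defs
begin

text \<open>
  Both sides of the integral formula are compared pointwise. The integrand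
  \<open>\<bar>k\<^sub>S\<bar>\<^sup>p ds\<close> does not depend on the chart, because the Christoffel symbols
  pick up exactly the second derivative of the transition map; it vanishes on geodesic arcs, and in an
  isothermal chart it is \<open>exp ((1 - p) \<lambda>) \<bar>k + \<partial>\<^sub>u \<lambda>\<bar>\<^sup>p ds\<close>.

  For the expansions, let \<open>a = \<delta> / 2\<close>. In the isothermal chart of diameter \<open>3 a\<close> about a vertex the
  gradient of \<open>\<lambda>\<close> is \<open>O(a)\<close>, so a unit speed geodesic from the vertex with initial velocity \<open>u\<close> has
  velocity \<open>u + O(a\<^sup>2)\<close> and position \<open>a u + O(a\<^sup>3)\<close> at time \<open>a\<close>. Turning angles are bounded away from
  \<open>0\<close> and \<open>\<pi>\<close>, hence the corner that is rounded is a perturbation of the corner formed by two rays from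
  the origin: its angle changes by \<open>O(a\<^sup>2)\<close> and its tangent lengths by \<open>O(a\<^sup>3)\<close>. All errors are thus
  \<open>O(\<delta>\<^sup>2)\<close>. Finally the rounded corner lies in a disk of radius \<open>4 \<delta>\<close> about the origin, and such a disk
  is covered by the isothermal chart whose diameter is a fixed multiple of \<open>\<delta>\<close>; this bounds the
  conormal derivative.\<close>

section \<open>Transformation of the geodesic curvature\<close>

text \<open>The constants may depend on \<open>\<eta>\<close>, \<open>C0\<close>,
  \<open>\<epsilon>\<close> and \<open>\<delta>1\<close>, but not on the polygonal. Hence each
  vertex is studied in a chart whose diameter is a fixed multiple of the edge length: only there is
  the gradient bound \<open>C0 * d\<close> of first order in it. Two obstacles shape the argument.
  The coordinate image of a metric disk is known only to be open, while the rounded corner is built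
  in the plane; that the corner lies in the image has to be proved, from the upper bound
  \<open>1 + \<epsilon>\<close> on the conformal factor, since \<open>\<epsilon>\<close> may be
  large. Moreover, the curvature integrand uses a chart picked by choice at every parameter, so the
  density is carried as a predicate that holds in all charts at once, off a finite set absorbing
  endpoints and joints. The dependence on \<open>\<eta>\<close> is the conditioning of the corner:
  as the two lines become parallel, their intersection, the arccosine and the relative error of the
  angle degenerate. The errors in the expansions are defined as exact differences or quotients, so
  that the equations are identities and only the sizes of the errors are estimated.\<close>

text \<open>Only differentiability of \<open>f'\<close> at the single point \<open>z\<close> is
  available. The mean value inequality is therefore applied once, to the increment of
  \<open>f\<close> in direction \<open>u\<close> along the path in direction \<open>v\<close>; its
  derivative is a difference of two values of \<open>f'\<close>, both expanded about
  \<open>z\<close>.\<close>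

lemma second_difference_bound:
  fixes f :: "'a::real_normed_vector \<Rightarrow> 'b::real_normed_vector"
  assumes f': "\<And>x. x \<in> ball z r \<Longrightarrow> (f has_derivative blinfun_apply (f' x)) (at x)" and r: "0 < r"
    and D: "(f' has_derivative D) (at z)" and e: "0 < e"
  shows "\<exists>d>0. \<forall>t. 0 < t \<and> t < d \<longrightarrow>
    norm (f (z + t *\<^sub>R u + t *\<^sub>R v) - f (z + t *\<^sub>R u) - f (z + t *\<^sub>R v) + f z - t\<^sup>2 *\<^sub>R D u v) \<le> e * t\<^sup>2"
proof -
  define M where "M = norm u + norm v + 1"
  have M: "M > 0" "norm v \<le> M" "norm u \<le> M" by (auto simp: M_def add_nonneg_pos)
  \<comment> \<open>Two expansions with error \<open>e1 * (t * M)\<close> each, applied to a vector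
    of norm at most \<open>M\<close>, give the slope \<open>e * t\<close>, hence
    \<open>e * t\<^sup>2\<close> over an interval of length \<open>t\<close>.\<close>
  define e1 where "e1 = e / (2 * M * M)"
  have e1: "e1 > 0" using e M by (simp add: e1_def)
  have lin: "bounded_linear D" by (rule has_derivative_bounded_linear[OF D])
  interpret D: bounded_linear D by fact
  obtain d0 where d0: "d0 > 0"
    "\<And>y. norm (y - z) < d0 \<Longrightarrow> norm (f' y - f' z - D (y - z)) \<le> e1 * norm (y - z)"
    using D[unfolded has_derivative_at_alt] e1 by blast
  define d where "d = min r d0 / M"
  have d: "d > 0" using r d0 M by (simp add: d_def)
  show ?thesis
  proof (intro exI[of _ d] conjI d allI impI, elim conjE)
    fix t :: real assume t: "0 < t" "t < d"
    have tM: "t * M < min r d0" using t M by (simp add: d_def pos_less_divide_eq)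
    have near: "norm (a *\<^sub>R u + s *\<^sub>R v) \<le> t * M" if "\<bar>a\<bar> \<le> t" "\<bar>s\<bar> \<le> t" for a s
    proof -
      have "norm (a *\<^sub>R u + s *\<^sub>R v) \<le> \<bar>a\<bar> * norm u + \<bar>s\<bar> * norm v"
        using norm_triangle_ineq[of "a *\<^sub>R u" "s *\<^sub>R v"] by simp
      also have "\<dots> \<le> t * norm u + t * norm v" using that by (intro add_mono mult_right_mono) auto
      also have "\<dots> \<le> t * M" using t by (simp add: M_def algebra_simps)
      finally show ?thesis .
    qed
    have inb: "z + a *\<^sub>R u + s *\<^sub>R v \<in> ball z r" if "\<bar>a\<bar> \<le> t" "\<bar>s\<bar> \<le> t" for a s
    proof -
      have "dist z (z + X) = norm X" for X by (simp add: dist_norm)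
      from this[of "a *\<^sub>R u + s *\<^sub>R v"] show ?thesis using near[OF that] tM by (simp add: add.assoc)
    qed
    have est: "norm (f' (z + a *\<^sub>R u + s *\<^sub>R v) - f' z - (a *\<^sub>R D u + s *\<^sub>R D v)) \<le> e1 * (t * M)"
      if "\<bar>a\<bar> \<le> t" "\<bar>s\<bar> \<le> t" for a s
    proof -
      have "norm (f' (z + (a *\<^sub>R u + s *\<^sub>R v)) - f' z - D (z + (a *\<^sub>R u + s *\<^sub>R v) - z))
          \<le> e1 * norm (z + (a *\<^sub>R u + s *\<^sub>R v) - z)"
        using near[OF that] tM by (intro d0) simp
      also have "\<dots> \<le> e1 * (t * M)" using near[OF that] e1 by (intro mult_left_mono) auto
      finally show ?thesis by (simp add: D.add D.scaleR add.assoc)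
    qed
    define g where "g s = f (z + t *\<^sub>R u + s *\<^sub>R v) - f (z + s *\<^sub>R v) - (s * t) *\<^sub>R D u v" for s
    define g' where "g' s h = h *\<^sub>R (f' (z + t *\<^sub>R u + s *\<^sub>R v) v - f' (z + s *\<^sub>R v) v - t *\<^sub>R D u v)" for s h
    have "norm (g t - g 0) \<le> (e1 * (t * M) * 2 * M) * norm (t - 0)"
    proof (rule differentiable_bound[where S = "{0..t}" and f' = g'])
      fix s assume s: "s \<in> {0..t}"
      have 1: "(f has_derivative blinfun_apply (f' (z + t *\<^sub>R u + s *\<^sub>R v))) (at (z + t *\<^sub>R u + s *\<^sub>R v))"
        using s t by (intro f' inb) auto
      have 2: "(f has_derivative blinfun_apply (f' (z + s *\<^sub>R v))) (at (z + s *\<^sub>R v))"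
        using s t inb[of 0 s] by (intro f') auto
      have A1: "((\<lambda>s. z + t *\<^sub>R u + s *\<^sub>R v) has_derivative (\<lambda>h. h *\<^sub>R v)) (at s within {0..t})"
        by (auto intro!: derivative_eq_intros)
      have A2: "((\<lambda>s. z + s *\<^sub>R v) has_derivative (\<lambda>h. h *\<^sub>R v)) (at s within {0..t})"
        by (auto intro!: derivative_eq_intros)
      have A3: "((\<lambda>s. (s * t) *\<^sub>R D u v) has_derivative (\<lambda>h. (h * t) *\<^sub>R D u v)) (at s within {0..t})"
        by (auto intro!: derivative_eq_intros)
      have "(g has_derivative (\<lambda>h. f' (z + t *\<^sub>R u + s *\<^sub>R v) (h *\<^sub>R v) - f' (z + s *\<^sub>R v) (h *\<^sub>R v) - (h * t) *\<^sub>R D u v)) (at s within {0..t})"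
        unfolding g_def
        by (intro has_derivative_diff has_derivative_compose[OF A1 1] has_derivative_compose[OF A2 2] A3)
      then show "(g has_derivative g' s) (at s within {0..t})"
        by (simp add: g'_def[abs_def] blinfun.scaleR_right algebra_simps)
      show "onorm (g' s) \<le> e1 * (t * M) * 2 * M"
      proof (rule onorm_le)
        fix h
        have e1': "norm (f' (z + t *\<^sub>R u + s *\<^sub>R v) - f' z - (t *\<^sub>R D u + s *\<^sub>R D v)) \<le> e1 * (t * M)"
          using s t by (intro est) auto
        have e2': "norm (f' (z + s *\<^sub>R v) - f' z - (s *\<^sub>R D v)) \<le> e1 * (t * M)"
          using s t est[of 0 s] by auto
        let ?B = "(f' (z + t *\<^sub>R u + s *\<^sub>R v) - f' z - (t *\<^sub>R D u + s *\<^sub>R D v)) - (f' (z + s *\<^sub>R v) - f' z - (s *\<^sub>R D v))"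
        have "norm ?B \<le> e1 * (t * M) * 2" using norm_triangle_ineq4 e1' e2' by (smt (verit))
        then have "norm ?B * norm v \<le> (e1 * (t * M) * 2) * M" using M e1 t by (intro mult_mono) auto
        moreover have "norm (?B v) \<le> norm ?B * norm v" by (rule norm_blinfun)
        moreover have "?B v = f' (z + t *\<^sub>R u + s *\<^sub>R v) v - f' (z + s *\<^sub>R v) v - t *\<^sub>R D u v"
          by (simp add: blinfun.diff_left blinfun.add_left blinfun.scaleR_left)
        ultimately have "norm (f' (z + t *\<^sub>R u + s *\<^sub>R v) v - f' (z + s *\<^sub>R v) v - t *\<^sub>R D u v) \<le> e1 * (t * M) * 2 * M"
          by simp
        then show "norm (g' s h) \<le> e1 * (t * M) * 2 * M * norm h"
          unfolding g'_def by (simp add: mult.commute mult_left_mono)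
      qed
    qed (use t in auto)
    moreover have "(e1 * (t * M) * 2 * M) * norm (t - 0) = e * t\<^sup>2"
      using M t by (simp add: e1_def power2_eq_square)
    moreover have "g t - g 0 = f (z + t *\<^sub>R u + t *\<^sub>R v) - f (z + t *\<^sub>R u) - f (z + t *\<^sub>R v) + f z - t\<^sup>2 *\<^sub>R D u v"
      by (simp add: g_def power2_eq_square)
    ultimately show "norm (f (z + t *\<^sub>R u + t *\<^sub>R v) - f (z + t *\<^sub>R u) - f (z + t *\<^sub>R v) + f z - t\<^sup>2 *\<^sub>R D u v) \<le> e * t\<^sup>2"
      by simp
  qed
qed

text \<open>Exchanging \<open>u\<close> and \<open>v\<close> leaves the second difference unchanged,
  so both orders of \<open>D\<close> approximate the same quantity up to an arbitrarily small
  multiple of the squared step.\<close>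

lemma second_derivative_symmetric:
  fixes f :: "'a::real_normed_vector \<Rightarrow> 'b::real_normed_vector"
  assumes f': "\<And>x. x \<in> V \<Longrightarrow> (f has_derivative blinfun_apply (f' x)) (at x)"
    and V: "open V" "z \<in> V" and D: "(f' has_derivative D) (at z)"
  shows "blinfun_apply (D u) v = blinfun_apply (D v) u"
proof (rule ccontr)
  assume ne: "\<not> ?thesis"
  obtain r where r: "r > 0" "ball z r \<subseteq> V" using V by (meson openE)
  \<comment> \<open>A third of the supposed gap: the two approximations allow a gap of at most
    \<open>2 * e\<close>.\<close>
  define e where "e = norm (D u v - D v u) / 3"
  have e: "e > 0" using ne by (simp add: e_def)
  have f'': "\<And>x. x \<in> ball z r \<Longrightarrow> (f has_derivative blinfun_apply (f' x)) (at x)" using r f' by auto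
  obtain d1 where d1: "d1 > 0" "\<And>t. 0 < t \<Longrightarrow> t < d1 \<Longrightarrow>
    norm (f (z + t *\<^sub>R u + t *\<^sub>R v) - f (z + t *\<^sub>R u) - f (z + t *\<^sub>R v) + f z - t\<^sup>2 *\<^sub>R D u v) \<le> e * t\<^sup>2"
    using second_difference_bound[OF f'' r(1) D e] by metis
  obtain d2 where d2: "d2 > 0" "\<And>t. 0 < t \<Longrightarrow> t < d2 \<Longrightarrow>
    norm (f (z + t *\<^sub>R v + t *\<^sub>R u) - f (z + t *\<^sub>R v) - f (z + t *\<^sub>R u) + f z - t\<^sup>2 *\<^sub>R D v u) \<le> e * t\<^sup>2"
    using second_difference_bound[OF f'' r(1) D e] by metis
  define t where "t = min d1 d2 / 2"
  have t: "0 < t" "t < d1" "t < d2" using d1 d2 by (auto simp: t_def min_def)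
  let ?S = "f (z + t *\<^sub>R u + t *\<^sub>R v) - f (z + t *\<^sub>R u) - f (z + t *\<^sub>R v) + f z"
  have A: "norm (?S - t\<^sup>2 *\<^sub>R D u v) \<le> e * t\<^sup>2" using d1(2) t by blast
  have B: "norm (?S - t\<^sup>2 *\<^sub>R D v u) \<le> e * t\<^sup>2" using d2(2)[OF t(1,3)] by (simp add: algebra_simps)
  have "t\<^sup>2 * norm (D u v - D v u) = norm ((?S - t\<^sup>2 *\<^sub>R D v u) - (?S - t\<^sup>2 *\<^sub>R D u v))"
    using norm_scaleR[of "t\<^sup>2" "D u v - D v u"] by (simp add: scaleR_diff_right del: norm_scaleR)
  also have "\<dots> \<le> e * t\<^sup>2 + e * t\<^sup>2" using A B norm_triangle_ineq4 by (smt (verit))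
  also have "\<dots> = t\<^sup>2 * (2 * e)" by simp
  finally have "norm (D u v - D v u) \<le> 2 * e" using t by (simp add: mult_le_cancel_left)
  then show False using e by (simp add: e_def)
qed

section \<open>Christoffel symbols under a change of coordinates\<close>

lemma gram_form_has_derivative:
  fixes h :: "real^2 \<Rightarrow> real^2^2"
  assumes "(h has_derivative D) (at z)"
  shows "((\<lambda>y. h y $ i $ j) has_derivative (\<lambda>v. D v $ i $ j)) (at z)"
  using assms by (intro has_derivative_componentwise_within[THEN iffD1, rule_format] bounded_linear.has_derivative[OF bounded_linear_vec_nth]
    bounded_linear.has_derivative[OF bounded_linear_vec_nth])

lemma vec2_decomp: "(v::real^2) = v $ 1 *\<^sub>R axis 1 1 + v $ 2 *\<^sub>R axis 2 1"
  by (simp add: vec_eq_iff forall_2 axis_def)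

lemma matrix_inv_right: "invertible M \<Longrightarrow> M ** matrix_inv M = mat 1"
  unfolding invertible_def matrix_inv_def by (rule someI2_ex) auto

text \<open>Pairing with \<open>h z\<close> cancels the inverse matrix in the Christoffel symbols.
  What remains is free of indices, so a pullback can be differentiated in it directly.\<close>

lemma koszul_formula:
  fixes h :: "real^2 \<Rightarrow> real^2^2"
  assumes D: "(h has_derivative D) (at z)" and inv: "invertible (h z)"
  shows "y \<bullet> (h z *v christoffel_form h z v w) = 1/2 * (w \<bullet> (D v *v y) + v \<bullet> (D w *v y) - v \<bullet> (D y *v w))"
proof -
  have pd: "partial_deriv i (\<lambda>y. h y $ j $ l) z = D (axis i 1) $ j $ l" for i j l
    unfolding partial_deriv_def using frechet_derivative_at[OF gram_form_has_derivative[OF D, of j l]] by metis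
  define B where "B i j l = D (axis i 1) $ j $ l + D (axis j 1) $ i $ l - D (axis l 1) $ i $ j" for i j l :: 2
  define b :: "real^2" where "b = (\<chi> l. 1/2 * (\<Sum>i\<in>UNIV. \<Sum>j\<in>UNIV. B i j l * v $ i * w $ j))"
  have chr: "christoffel h z m i j = (\<Sum>l\<in>UNIV. matrix_inv (h z) $ m $ l * (B i j l / 2))" for m i j
    by (simp add: christoffel_def pd B_def sum_distrib_left)
  have "christoffel_form h z v w = matrix_inv (h z) *v b"
    by (simp add: vec_eq_iff christoffel_form_def chr matrix_vector_mult_def sum_2 b_def)
      (simp add: algebra_simps add_divide_distrib)
  then have hb: "h z *v christoffel_form h z v w = b"
    using inv by (simp add: matrix_vector_mul_assoc matrix_inv_right)
  have DD': "D u = u $ 1 *\<^sub>R D (axis 1 1) + u $ 2 *\<^sub>R D (axis 2 1)" for u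
    using vec2_decomp[of u] linear_add[OF has_derivative_linear[OF D]] linear_scale[OF has_derivative_linear[OF D]] by metis
  have DD: "D u $ i $ j = u $ 1 * D (axis 1 1) $ i $ j + u $ 2 * D (axis 2 1) $ i $ j" for u i j
    by (subst DD') simp
  have "y \<bullet> b = 1/2 * (\<Sum>l\<in>UNIV. \<Sum>i\<in>UNIV. \<Sum>j\<in>UNIV. B i j l * (v $ i * w $ j * y $ l))"
    by (simp add: inner_vec_def b_def sum_2 algebra_simps)
  also have "\<dots> = 1/2 * (w \<bullet> (D v *v y) + v \<bullet> (D w *v y) - v \<bullet> (D y *v w))"
  proof -
    define d where "d i j l = D (axis i 1) $ j $ l" for i j l
    define m where "m i j l = v $ i * w $ j * y $ l" for i j l
    have "w \<bullet> (D v *v y) = (\<Sum>l\<in>UNIV. \<Sum>i\<in>UNIV. \<Sum>j\<in>UNIV. d i j l * m i j l)"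
      "v \<bullet> (D w *v y) = (\<Sum>l\<in>UNIV. \<Sum>i\<in>UNIV. \<Sum>j\<in>UNIV. d j i l * m i j l)"
      "v \<bullet> (D y *v w) = (\<Sum>l\<in>UNIV. \<Sum>i\<in>UNIV. \<Sum>j\<in>UNIV. d l i j * m i j l)"
      unfolding inner_vec_def matrix_vector_mult_def
      by (simp_all add: sum_2 DD[of v] DD[of w] DD[of y] d_def[symmetric] m_def algebra_simps)
    then show ?thesis
      unfolding m_def[symmetric] B_def d_def[symmetric]
      by (simp add: sum.distrib sum_subtractf ring_distribs)
  qed
  finally show ?thesis using hb by simp
qed

definition pos_gram :: "real^2^2 \<Rightarrow> bool" where
  "pos_gram M \<longleftrightarrow> transpose M = M \<and> (\<forall>v. v \<noteq> 0 \<longrightarrow> v \<bullet> (M *v v) > 0)"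

lemma pos_gram_symmetric: "pos_gram M \<Longrightarrow> v \<bullet> (M *v w) = w \<bullet> (M *v v)"
  by (metis dot_lmul_matrix inner_commute pos_gram_def transpose_matrix_vector)

lemma pos_gram_eq_0: "pos_gram M \<Longrightarrow> (\<And>y. y \<bullet> (M *v v) = 0) \<Longrightarrow> v = 0"
  by (metis less_irrefl pos_gram_def)

lemma pos_gram_invertible:
  assumes "pos_gram M" shows "invertible M"
proof -
  have "inj ((*v) M)"
  proof (rule linear_injective_0[THEN iffD2, rule_format])
    show "linear ((*v) M)" by simp
    fix v assume "M *v v = 0"
    then have "v \<bullet> (M *v v) = 0" by simp
    then show "v = 0" using assms by (metis less_irrefl pos_gram_def)
  qed
  then show ?thesis
    by (metis invertible_left_inverse matrix_left_invertible_injective)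
qed

lemma bounded_bilinear_matrix_vector: "bounded_bilinear (\<lambda>(M::real^'n^'m) v. M *v v)"
proof -
  have "bilinear (\<lambda>(M::real^'n^'m) v. M *v v)"
    unfolding bilinear_def
    by (auto intro!: linearI simp: matrix_vector_mult_add_rdistrib matrix_vector_right_distrib
        scaleR_matrix_vector_assoc matrix_vector_mult_scaleR)
  then show ?thesis by (simp add: bilinear_conv_bounded_bilinear)
qed

lemmas has_derivative_matrix_vector = bounded_bilinear.FDERIV[OF bounded_bilinear_matrix_vector]

text \<open>Differentiate the pullback relation, insert it into the Koszul formula and use that the second
  derivative of \<open>\<Phi>\<close> is symmetric.\<close>

lemma christoffel_transformation:
  fixes h h' :: "real^2 \<Rightarrow> real^2^2" and \<Phi> :: "real^2 \<Rightarrow> real^2"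
  assumes V: "open V" "z \<in> V"
    and P: "\<And>x. x \<in> V \<Longrightarrow> (\<Phi> has_derivative blinfun_apply (P x)) (at x)"
    and P2: "(P has_derivative P2) (at z)"
    and pull: "\<And>x v w. x \<in> V \<Longrightarrow> v \<bullet> (h x *v w) = P x v \<bullet> (h' (\<Phi> x) *v P x w)"
    and D: "(h has_derivative D) (at z)" and D': "(h' has_derivative D') (at (\<Phi> z))"
    and pos: "pos_gram (h z)" and pos': "pos_gram (h' (\<Phi> z))"
  shows "P z (christoffel_form h z v w) = christoffel_form h' (\<Phi> z) (P z v) (P z w) + P2 v w"
proof -
  let ?M = "h' (\<Phi> z)"
  have sym: "P2 a b = P2 b a" for a b
    by (rule second_derivative_symmetric[OF P V P2])
  have dh: "a \<bullet> (D u *v b) = P2 u a \<bullet> (?M *v P z b) + P z a \<bullet> (D' (P z u) *v P z b) + P z a \<bullet> (?M *v P2 u b)"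
    for a b u
  proof -
    have 1: "((\<lambda>x. a \<bullet> (h x *v b)) has_derivative (\<lambda>u. a \<bullet> (D u *v b))) (at z)"
      by (auto intro!: derivative_eq_intros has_derivative_matrix_vector D)
    have PB: "((\<lambda>x. P x c) has_derivative (\<lambda>u. P2 u c)) (at z)" for c
      by (auto intro!: derivative_eq_intros bounded_bilinear.FDERIV[OF bounded_bilinear_blinfun_apply] P2)
    have hP: "((\<lambda>x. h' (\<Phi> x)) has_derivative (\<lambda>u. D' (P z u))) (at z)"
      by (rule has_derivative_compose[OF P[OF V(2)] D'])
    have 2: "((\<lambda>x. P x a \<bullet> (h' (\<Phi> x) *v P x b)) has_derivative
       (\<lambda>u. P z a \<bullet> (?M *v P2 u b + D' (P z u) *v P z b) + P2 u a \<bullet> (?M *v P z b))) (at z)"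
      by (intro has_derivative_inner has_derivative_matrix_vector PB hP)
    have "((\<lambda>x. a \<bullet> (h x *v b)) has_derivative
       (\<lambda>u. P z a \<bullet> (?M *v P2 u b + D' (P z u) *v P z b) + P2 u a \<bullet> (?M *v P z b))) (at z)"
      by (rule has_derivative_transform_within_open[OF 2 V]) (simp add: pull)
    from has_derivative_unique[OF 1 this] show ?thesis
      by (simp add: fun_eq_iff inner_add_right)
  qed
  \<comment> \<open>\<open>P z\<close> preserves a positive definite form, so it is injective and,
    in equal dimensions, onto. Every vector against which the target metric is tested is thus of the
    form \<open>P z y\<close>.\<close>
  have surj: "\<exists>y. P z y = y'" for y'
  proof -
    have "inj (P z)"
    proof (rule linear_injective_0[THEN iffD2, rule_format])
      show "linear (P z)" by (simp add: blinfun.bounded_linear_right bounded_linear.linear)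
      fix v assume "P z v = 0"
      then have "v \<bullet> (h z *v v) = 0" using pull[OF V(2), of v v] by simp
      then show "v = 0" using pos by (metis less_irrefl pos_gram_def)
    qed
    then have "surj (P z)"
      by (simp add: blinfun.bounded_linear_right bounded_linear.linear linear_injective_imp_surjective)
    then show ?thesis by (metis surjD)
  qed
  have "P z (christoffel_form h z v w) - (christoffel_form h' (\<Phi> z) (P z v) (P z w) + P2 v w) = 0"
  proof (rule pos_gram_eq_0[OF pos'])
    fix y'
    obtain y where y: "P z y = y'" using surj by blast
    have "y' \<bullet> (?M *v P z (christoffel_form h z v w)) = y \<bullet> (h z *v christoffel_form h z v w)"
      using pull[OF V(2)] y by simp
    also have "\<dots> = 1/2 * (w \<bullet> (D v *v y) + v \<bullet> (D w *v y) - v \<bullet> (D y *v w))"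
      by (rule koszul_formula[OF D pos_gram_invertible[OF pos]])
    \<comment> \<open>With \<open>P2\<close> symmetric, four of the six second-order terms cancel
      and the other two coincide; halving their sum leaves \<open>P2 v w\<close>.\<close>
    also have "\<dots> = y' \<bullet> (?M *v christoffel_form h' (\<Phi> z) (P z v) (P z w)) + y' \<bullet> (?M *v P2 v w)"
      unfolding koszul_formula[OF D' pos_gram_invertible[OF pos']] dh y
      using sym pos_gram_symmetric[OF pos'] by (simp add: algebra_simps)
    finally show "y' \<bullet> (?M *v (P z (christoffel_form h z v w) -
        (christoffel_form h' (\<Phi> z) (P z v) (P z w) + P2 v w))) = 0"
      by (simp add: matrix_vector_mult_diff_distrib matrix_vector_right_distrib inner_add_right inner_diff_right)
  qed
  then show ?thesis by simp
qed

text \<open>The energy density is the integrand of the theorem, at a parameter near which the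
  curve \<open>x\<close> in the coordinate plane is differentiable.\<close>

definition energy_density_at ::
    "(real^2 \<Rightarrow> real^2^2) \<Rightarrow> real \<Rightarrow> (real \<Rightarrow> real^2) \<Rightarrow> real \<Rightarrow> real \<Rightarrow> bool" where
  "energy_density_at h p x t y \<longleftrightarrow> (\<exists>v b. (\<forall>\<^sub>F r in nhds t. (x has_vector_derivative v r) (at r)) \<and>
     ((\<lambda>r. v r /\<^sub>R gram_norm (h (x r)) (v r)) has_vector_derivative b) (at t) \<and>
     y = gram_norm (h (x t)) ((b + christoffel_form h (x t) (v t) (v t /\<^sub>R gram_norm (h (x t)) (v t)))
            /\<^sub>R gram_norm (h (x t)) (v t)) powr p * gram_norm (h (x t)) (v t))"

section \<open>Invariance and rescaling of the energy density\<close>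

lemma gram_norm_pullback:
  assumes "\<And>v w. v \<bullet> (M *v w) = f v \<bullet> (M' *v f w)"
  shows "gram_norm M' (f v) = gram_norm M v"
  by (simp add: gram_norm_def assms)

lemma has_vector_derivative_eventually:
  assumes "(f has_vector_derivative f') (at t within S)" and "\<forall>\<^sub>F r in nhds t. f r = g r"
  shows "(g has_vector_derivative f') (at t within S)"
proof -
  have "\<forall>\<^sub>F r in nhds t. r \<in> S \<longrightarrow> f r = g r" using assms(2) by eventually_elim simp
  from has_vector_derivative_cong_ev[OF this eventually_nhds_x_imp_x[OF assms(2)]] assms(1) show ?thesis by blast
qed

lemma has_vector_derivative_chain_blinfun:
  assumes "(x has_vector_derivative v) (at r within S)" "(\<Phi> has_derivative blinfun_apply P) (at (x r))"
  shows "((\<Phi> \<circ> x) has_vector_derivative P v) (at r within S)"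
  using has_derivative_compose[OF assms(1)[unfolded has_vector_derivative_def] assms(2)]
  by (simp add: has_vector_derivative_def o_def blinfun.scaleR_right)

lemma energy_density_at_transform:
  fixes h h' :: "real^2 \<Rightarrow> real^2^2" and \<Phi> :: "real^2 \<Rightarrow> real^2"
  assumes V: "open V" "x t \<in> V"
    and P: "\<And>z. z \<in> V \<Longrightarrow> (\<Phi> has_derivative blinfun_apply (P z)) (at z)"
    and P2: "(P has_derivative P2) (at (x t))"
    and pull: "\<And>z v w. z \<in> V \<Longrightarrow> v \<bullet> (h z *v w) = P z v \<bullet> (h' (\<Phi> z) *v P z w)"
    and D: "(h has_derivative D) (at (x t))" and D': "(h' has_derivative D') (at (\<Phi> (x t)))"
    and pos: "pos_gram (h (x t))" and pos': "pos_gram (h' (\<Phi> (x t)))"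
    and ed: "energy_density_at h p x t y"
  shows "energy_density_at h' p (\<Phi> \<circ> x) t y"
proof -
  obtain v b where v: "\<forall>\<^sub>F r in nhds t. (x has_vector_derivative v r) (at r)"
    and b: "((\<lambda>r. v r /\<^sub>R gram_norm (h (x r)) (v r)) has_vector_derivative b) (at t)"
    and y: "y = gram_norm (h (x t)) ((b + christoffel_form h (x t) (v t) (v t /\<^sub>R gram_norm (h (x t)) (v t)))
            /\<^sub>R gram_norm (h (x t)) (v t)) powr p * gram_norm (h (x t)) (v t)"
    using ed unfolding energy_density_at_def by blast
  have vt: "(x has_vector_derivative v t) (at t)" using v by (rule eventually_nhds_x_imp_x)
  have "\<forall>\<^sub>F r in at t. x r \<in> V"
    using has_vector_derivative_continuous[OF vt] V
    by (auto simp: continuous_at intro: topological_tendstoD)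
  then have xV: "\<forall>\<^sub>F r in nhds t. x r \<in> V" using V by (simp add: eventually_nhds_conv_at)
  have gn: "gram_norm (h' (\<Phi> z)) (P z u) = gram_norm (h z) u" if "z \<in> V" for z u
    by (rule gram_norm_pullback) (rule pull[OF that])
  let ?T = "\<lambda>r. v r /\<^sub>R gram_norm (h (x r)) (v r)"
  let ?v = "\<lambda>r. P (x r) (v r)"
  have e1: "\<forall>\<^sub>F r in nhds t. ((\<Phi> \<circ> x) has_vector_derivative ?v r) (at r)"
    using v xV by eventually_elim (rule has_vector_derivative_chain_blinfun, auto intro: P)
  \<comment> \<open>\<open>P\<close> varies along the curve, so the product rule adds
    \<open>P2 (v t) (?T t)\<close>; this is the inhomogeneous term in the transformation law of the
    Christoffel form.\<close>
  have PT: "((\<lambda>r. P (x r) (?T r)) has_vector_derivative (P (x t) b + P2 (v t) (?T t))) (at t)"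
  proof -
    have "((\<lambda>r. P (x r)) has_derivative (\<lambda>s. P2 (s *\<^sub>R v t))) (at t)"
      by (rule has_derivative_compose[OF vt[unfolded has_vector_derivative_def] P2])
    from bounded_bilinear.FDERIV[OF bounded_bilinear_blinfun_apply this b[unfolded has_vector_derivative_def]]
    show ?thesis unfolding has_vector_derivative_def
      by (rule has_derivative_eq_rhs)
        (simp add: fun_eq_iff linear_scale[OF has_derivative_linear[OF P2]] blinfun.scaleR_left
          blinfun.scaleR_right scaleR_add_right)
  qed
  have "\<forall>\<^sub>F r in nhds t. P (x r) (?T r) = ?v r /\<^sub>R gram_norm (h' ((\<Phi> \<circ> x) r)) (?v r)"
    using xV by eventually_elim (simp add: gn blinfun.scaleR_right)
  then have e2: "((\<lambda>r. ?v r /\<^sub>R gram_norm (h' ((\<Phi> \<circ> x) r)) (?v r)) has_vector_derivative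
      (P (x t) b + P2 (v t) (?T t))) (at t)"
    by (rule has_vector_derivative_eventually[OF PT])
  have "P (x t) b + P2 (v t) (?T t) + christoffel_form h' (\<Phi> (x t)) (?v t) (?v t /\<^sub>R gram_norm (h (x t)) (v t))
     = P (x t) (b + christoffel_form h (x t) (v t) (?T t))"
    using christoffel_transformation[OF V P P2 pull D D' pos pos', of "v t" "?T t"]
    by (simp add: blinfun.add_right blinfun.scaleR_right)
  then have "y = gram_norm (h' ((\<Phi> \<circ> x) t)) ((P (x t) b + P2 (v t) (?T t) +
      christoffel_form h' ((\<Phi> \<circ> x) t) (?v t) (?v t /\<^sub>R gram_norm (h' ((\<Phi> \<circ> x) t)) (?v t)))
            /\<^sub>R gram_norm (h' ((\<Phi> \<circ> x) t)) (?v t)) powr p * gram_norm (h' ((\<Phi> \<circ> x) t)) (?v t)"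
    using y gn[OF V(2)] by (simp flip: blinfun.scaleR_right)
  then show ?thesis
    unfolding energy_density_at_def using e1 e2 by (intro exI[of _ ?v] exI conjI)
qed

lemma energy_density_at_cong:
  assumes "energy_density_at h p x t y" and "\<forall>\<^sub>F r in nhds t. x r = x' r"
  shows "energy_density_at h p x' t y"
proof -
  obtain v b where v: "\<forall>\<^sub>F r in nhds t. (x has_vector_derivative v r) (at r)"
    and b: "((\<lambda>r. v r /\<^sub>R gram_norm (h (x r)) (v r)) has_vector_derivative b) (at t)"
    and y: "y = gram_norm (h (x t)) ((b + christoffel_form h (x t) (v t) (v t /\<^sub>R gram_norm (h (x t)) (v t)))
            /\<^sub>R gram_norm (h (x t)) (v t)) powr p * gram_norm (h (x t)) (v t)"
    using assms(1) unfolding energy_density_at_def by blast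
  \<comment> \<open>Derivatives are claimed at all parameters near \<open>t\<close>, so the two
    curves have to agree near each of these as well.\<close>
  have "\<forall>\<^sub>F r in nhds t. \<forall>\<^sub>F s in nhds r. x s = x' s"
    using assms(2) by (simp add: eventually_eventually)
  with v have 1: "\<forall>\<^sub>F r in nhds t. (x' has_vector_derivative v r) (at r)"
    by eventually_elim (rule has_vector_derivative_eventually)
  have 2: "((\<lambda>r. v r /\<^sub>R gram_norm (h (x' r)) (v r)) has_vector_derivative b) (at t)"
    by (rule has_vector_derivative_eventually[OF b]) (use assms(2) in eventually_elim, simp)
  have "x t = x' t" using assms(2) by (rule eventually_nhds_x_imp_x)
  then show ?thesis
    unfolding energy_density_at_def using 1 2 y by (intro exI[of _ v] exI[of _ b]) simp
qed

lemma gram_norm_scaleR: "gram_norm M (c *\<^sub>R v) = \<bar>c\<bar> * gram_norm M v"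
  by (simp add: gram_norm_def matrix_vector_mult_scaleR real_sqrt_mult real_sqrt_abs2)

lemma christoffel_form_scaleR_left: "christoffel_form h z (c *\<^sub>R v) w = c *\<^sub>R christoffel_form h z v w"
  by (simp add: christoffel_form_def vec_eq_iff sum_distrib_left mult_ac)

lemma christoffel_form_scaleR_right: "christoffel_form h z v (c *\<^sub>R w) = c *\<^sub>R christoffel_form h z v w"
  by (simp add: christoffel_form_def vec_eq_iff sum_distrib_left mult_ac)

lemma has_vector_derivative_affine:
  assumes "(f has_vector_derivative f') (at (m * r + k))"
  shows "((\<lambda>r. f (m * r + k)) has_vector_derivative m *\<^sub>R f') (at r)"
proof -
  have "((\<lambda>r. m * r + k) has_vector_derivative m) (at r)"
    by (auto intro!: derivative_eq_intros simp: has_real_derivative_iff_has_vector_derivative[symmetric])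
  from vector_diff_chain_at[OF this assms] show ?thesis by (simp add: o_def)
qed

text \<open>The unit tangent is unaffected by \<open>m > 0\<close>; its derivative and the speed
  both scale by \<open>m\<close>. The curvature is therefore unchanged and only the line element
  contributes the factor.\<close>

lemma energy_density_at_affine:
  assumes "energy_density_at h p x (m * t + k) y" and m: "0 < m"
  shows "energy_density_at h p (\<lambda>r. x (m * r + k)) t (m * y)"
proof -
  let ?t = "m * t + k"
  obtain v b where v: "\<forall>\<^sub>F r in nhds ?t. (x has_vector_derivative v r) (at r)"
    and b: "((\<lambda>r. v r /\<^sub>R gram_norm (h (x r)) (v r)) has_vector_derivative b) (at ?t)"
    and y: "y = gram_norm (h (x ?t)) ((b + christoffel_form h (x ?t) (v ?t) (v ?t /\<^sub>R gram_norm (h (x ?t)) (v ?t)))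
            /\<^sub>R gram_norm (h (x ?t)) (v ?t)) powr p * gram_norm (h (x ?t)) (v ?t)"
    using assms(1) unfolding energy_density_at_def by blast
  have "filterlim (\<lambda>r. m * r + k) (nhds ?t) (nhds t)"
    by (intro tendsto_intros filterlim_ident)
  then have "\<forall>\<^sub>F r in nhds t. (x has_vector_derivative v (m * r + k)) (at (m * r + k))"
    using v by (auto simp: filterlim_iff)
  then have 1: "\<forall>\<^sub>F r in nhds t. ((\<lambda>r. x (m * r + k)) has_vector_derivative m *\<^sub>R v (m * r + k)) (at r)"
    by eventually_elim (rule has_vector_derivative_affine)
  have T: "(m *\<^sub>R v) /\<^sub>R gram_norm M (m *\<^sub>R v) = v /\<^sub>R gram_norm M v" for M v
    using m by (simp add: gram_norm_scaleR)
  have 2: "((\<lambda>r. (m *\<^sub>R v (m * r + k)) /\<^sub>R gram_norm (h (x (m * r + k))) (m *\<^sub>R v (m * r + k)))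
     has_vector_derivative m *\<^sub>R b) (at t)"
    unfolding T using has_vector_derivative_affine[OF b] .
  show ?thesis
    unfolding energy_density_at_def
  proof (intro exI[of _ "\<lambda>r. m *\<^sub>R v (m * r + k)"] exI[of _ "m *\<^sub>R b"] conjI 1 2)
    let ?n = "gram_norm (h (x ?t)) (v ?t)"
    have "(m *\<^sub>R b + christoffel_form h (x ?t) (m *\<^sub>R v ?t) (v ?t /\<^sub>R ?n)) /\<^sub>R gram_norm (h (x ?t)) (m *\<^sub>R v ?t)
      = (b + christoffel_form h (x ?t) (v ?t) (v ?t /\<^sub>R ?n)) /\<^sub>R ?n"
      using m by (simp add: gram_norm_scaleR christoffel_form_scaleR_left flip: scaleR_add_right)
    then show "m * y = gram_norm (h (x ?t)) ((m *\<^sub>R b + christoffel_form h (x ?t) (m *\<^sub>R v ?t)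
         ((m *\<^sub>R v ?t) /\<^sub>R gram_norm (h (x ?t)) (m *\<^sub>R v ?t))) /\<^sub>R gram_norm (h (x ?t)) (m *\<^sub>R v ?t)) powr p
       * gram_norm (h (x ?t)) (m *\<^sub>R v ?t)"
      unfolding T using m y by (simp add: gram_norm_scaleR)
  qed
qed

text \<open>Serves kept arcs that shrink to a point. The final factor, the speed, is zero, so the
  convention for dividing by zero speed does no harm.\<close>

lemma energy_density_at_const: "energy_density_at h p (\<lambda>r. z) t 0"
  unfolding energy_density_at_def
  by (rule exI[of _ "\<lambda>r. 0"], rule exI[of _ 0]) (simp add: gram_norm_def)

text \<open>At interior parameters a derivative within \<open>{0..1}\<close> is an ordinary one.
  This is used at \<open>t\<close> and at all nearby parameters, because the tangent field is
  differentiated once more.\<close>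

lemma integrand_eq_energy_density:
  assumes ed: "energy_density_at (G ch) p (snd ch \<circ> c) t y" and t: "t \<in> {0<..<1}"
    and ch: "ch = chart_at A (c t)"
  shows "geodesic_curvature_norm A G c t powr p * speed A G c t = y"
proof -
  define x where "x = snd ch \<circ> c"
  define h where "h = G ch"
  obtain v b where v: "\<forall>\<^sub>F r in nhds t. (x has_vector_derivative v r) (at r)"
    and b: "((\<lambda>r. v r /\<^sub>R gram_norm (h (x r)) (v r)) has_vector_derivative b) (at t)"
    and y: "y = gram_norm (h (x t)) ((b + christoffel_form h (x t) (v t) (v t /\<^sub>R gram_norm (h (x t)) (v t)))
            /\<^sub>R gram_norm (h (x t)) (v t)) powr p * gram_norm (h (x t)) (v t)"
    using ed unfolding energy_density_at_def x_def h_def by blast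
  have "\<forall>\<^sub>F r in nhds t. r \<in> {0<..<1::real}"
    using t by (intro eventually_nhds_in_open) auto
  with v have vd: "\<forall>\<^sub>F r in nhds t. vector_derivative x (at r within {0..1}) = v r"
  proof eventually_elim
    case (elim r)
    then have "at r within {0..1} = at r" by (intro at_within_interior) (auto simp: interior_atLeastAtMost_real)
    with elim show ?case using vector_derivative_at by fastforce
  qed
  define w where "w = (\<lambda>r. vector_derivative x (at r within {0..1}))"
  have vt: "w t = v t" unfolding w_def using vd by (rule eventually_nhds_x_imp_x)
  have "((\<lambda>r. w r /\<^sub>R gram_norm (h (x r)) (w r)) has_vector_derivative b) (at t)"
    by (rule has_vector_derivative_eventually[OF b]) (use vd in eventually_elim, simp add: w_def)
  moreover have "at t within {0..1} = at t" using t by (intro at_within_interior) (auto simp: interior_atLeastAtMost_real)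
  ultimately have b': "vector_derivative (\<lambda>r. w r /\<^sub>R gram_norm (h (x r)) (w r)) (at t within {0..1}) = b"
    using vector_derivative_at by fastforce
  show ?thesis
    using b' vt y unfolding w_def x_def h_def
    by (simp add: ch[symmetric] geodesic_curvature_norm_def speed_def curvature_vector_in_def Let_def)
qed

lemma gram_norm_0 [simp]: "gram_norm M 0 = 0"
  by (simp add: gram_norm_def)

lemma energy_density_at_geodesic:
  assumes v: "\<forall>\<^sub>F r in nhds t. (x has_vector_derivative v r) (at r) \<and> gram_norm (h (x r)) (v r) = 1"
    and b: "(v has_vector_derivative - christoffel_form h (x t) (v t) (v t)) (at t)"
  shows "energy_density_at h p x t 0"
  unfolding energy_density_at_def
proof (intro exI[of _ v] exI[of _ "- christoffel_form h (x t) (v t) (v t)"] conjI)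
  show "\<forall>\<^sub>F r in nhds t. (x has_vector_derivative v r) (at r)" using v by eventually_elim simp
  have 1: "gram_norm (h (x t)) (v t) = 1" using eventually_nhds_x_imp_x[OF v] by simp
  show "((\<lambda>r. v r /\<^sub>R gram_norm (h (x r)) (v r)) has_vector_derivative
     - christoffel_form h (x t) (v t) (v t)) (at t)"
    by (rule has_vector_derivative_eventually[OF b]) (use v in eventually_elim, simp)
  show "0 = gram_norm (h (x t)) ((- christoffel_form h (x t) (v t) (v t) +
      christoffel_form h (x t) (v t) (v t /\<^sub>R gram_norm (h (x t)) (v t))) /\<^sub>R gram_norm (h (x t)) (v t)) powr p *
      gram_norm (h (x t)) (v t)"
    by (simp add: 1)
qed

section \<open>Conformal metrics\<close>

lemma mat_vector_mult: "mat c *v x = c *\<^sub>R x" for x :: "real^2"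
  by (simp add: vec_eq_iff matrix_vector_mult_def mat_def sum_2 forall_2)

lemma gram_norm_mat: "0 \<le> c \<Longrightarrow> gram_norm (mat (c\<^sup>2)) v = c * norm v"
  by (simp add: gram_norm_def mat_vector_mult real_sqrt_mult norm_eq_sqrt_inner)

lemma gram_norm_conformal: "gram_norm (mat (exp (2 * l))) v = exp l * norm v"
  using gram_norm_mat[of "exp l" v] by (simp add: exp_double)

lemma inner_vec2: "v \<bullet> w = v $ 1 * w $ 1 + v $ 2 * w $ 2" for v w :: "real^2"
  by (simp add: inner_vec_def sum_2)

lemma rot_simps [simp]: "rot v $ 1 = - v $ 2" "rot v $ 2 = v $ 1"
  by (simp_all add: rot_def)

lemma norm_rot [simp]: "norm (rot v) = norm v"
  by (simp add: norm_eq_sqrt_inner inner_vec2)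

lemma orthonormal_expansion:
  assumes "norm T = 1" shows "g = (g \<bullet> T) *\<^sub>R T + (g \<bullet> rot T) *\<^sub>R rot T"
proof -
  have "T $ 1 * T $ 1 + T $ 2 * T $ 2 = 1"
    using assms by (simp add: norm_eq_sqrt_inner inner_vec2)
  then show ?thesis by (simp add: vec_eq_iff forall_2 inner_vec2) algebra
qed

lemma grad_has_derivative:
  assumes "f differentiable at z"
  shows "(f has_derivative (\<lambda>v. grad f z \<bullet> v)) (at z)"
proof -
  have d: "(f has_derivative frechet_derivative f (at z)) (at z)"
    using assms by (simp add: frechet_derivative_works)
  have "frechet_derivative f (at z) v = grad f z \<bullet> v" for v
    using arg_cong[OF vec2_decomp[of v], of "frechet_derivative f (at z)"]
      linear_add[OF has_derivative_linear[OF d]] linear_scale[OF has_derivative_linear[OF d]]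
    by (simp add: grad_def inner_vec2 partial_deriv_def mult.commute)
  then have "frechet_derivative f (at z) = (\<lambda>v. grad f z \<bullet> v)" by (rule ext)
  with d show ?thesis by metis
qed

text \<open>\<open>lam\<close> is half the logarithm of a diagonal entry of \<open>h\<close>, so it
  inherits differentiability from the metric. The second form, in terms of \<open>D\<close>, later
  yields continuity of the gradient.\<close>

lemma conformal_factor_differentiable:
  fixes h :: "real^2 \<Rightarrow> real^2^2"
  assumes V: "open V" "z \<in> V" and conf: "\<And>y. y \<in> V \<Longrightarrow> h y = mat (exp (2 * lam y))"
    and D: "(h has_derivative D) (at z)"
  shows "(lam has_derivative (\<lambda>v. grad lam z \<bullet> v)) (at z)"
    and "(lam has_derivative (\<lambda>v. exp (- 2 * lam z) * D v $ 1 $ 1 / 2)) (at z)"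
proof -
  have e: "h y $ 1 $ 1 = exp (2 * lam y)" if "y \<in> V" for y using conf[OF that] by (simp add: mat_def)
  have "((\<lambda>y. ln (h y $ 1 $ 1) / 2) has_derivative (\<lambda>v. exp (- 2 * lam z) * D v $ 1 $ 1 / 2)) (at z)"
    using e[OF V(2)]
    by (auto intro!: derivative_eq_intros gram_form_has_derivative[OF D] simp: exp_minus field_simps)
  then show 2: "(lam has_derivative (\<lambda>v. exp (- 2 * lam z) * D v $ 1 $ 1 / 2)) (at z)"
    by (rule has_derivative_transform_within_open[OF _ V]) (simp add: e)
  then have "lam differentiable at z" by (auto simp: differentiable_def)
  then show "(lam has_derivative (\<lambda>v. grad lam z \<bullet> v)) (at z)" by (rule grad_has_derivative)
qed

text \<open>The derivative of a conformal metric is the scalar matrix with entry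
  \<open>2 * E * (g \<bullet> v)\<close>. Inserted into the Koszul formula it leaves a common factor
  \<open>E > 0\<close>, which cancels.\<close>

lemma conformal_christoffel:
  fixes h :: "real^2 \<Rightarrow> real^2^2"
  assumes V: "open V" "z \<in> V" and conf: "\<And>y. y \<in> V \<Longrightarrow> h y = mat (exp (2 * lam y))"
    and D: "(h has_derivative D) (at z)"
  shows "christoffel_form h z v w =
    (grad lam z \<bullet> v) *\<^sub>R w + (grad lam z \<bullet> w) *\<^sub>R v - (v \<bullet> w) *\<^sub>R grad lam z"
proof -
  note l = conformal_factor_differentiable[OF V conf D]
  define g where "g = grad lam z"
  define E where "E = exp (2 * lam z)"
  have E: "E > 0" by (simp add: E_def)
  have "((\<lambda>y. mat (exp (2 * lam y)) :: real^2^2) has_derivative D) (at z)"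
    by (rule has_derivative_transform_within_open[OF D V]) (simp add: conf)
  moreover have "((\<lambda>y. mat (exp (2 * lam y)) :: real^2^2) has_derivative (\<lambda>v. mat (2 * E * (g \<bullet> v)))) (at z)"
    unfolding has_derivative_componentwise_within[where f="\<lambda>y. mat (exp (2 * lam y)) :: real^2^2"]
  proof
    fix b :: "real^2^2" assume "b \<in> Basis"
    have "((\<lambda>y. mat c \<bullet> b) = (\<lambda>y. c * (mat 1 \<bullet> b)))" for c :: real
      by (simp add: inner_vec_def mat_def sum_2 algebra_simps)
    then have eq: "mat c \<bullet> b = c * (mat 1 \<bullet> b)" for c :: real by meson
    show "((\<lambda>x. mat (exp (2 * lam x)) \<bullet> b) has_derivative (\<lambda>x. mat (2 * E * (g \<bullet> x)) \<bullet> b)) (at z)"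
      unfolding eq[of "exp _"] eq[of "2 * _ * _"]
      by (auto intro!: derivative_eq_intros l(1) simp: E_def g_def)
  qed
  ultimately have Dv: "D = (\<lambda>v. mat (2 * E * (g \<bullet> v)))" by (rule has_derivative_unique)
  have hz: "h z = mat E" using conf[OF V(2)] by (simp add: E_def)
  have inv: "invertible (h z)"
    unfolding hz using E by (intro pos_gram_invertible) (simp add: pos_gram_def mat_vector_mult)
  let ?C = "christoffel_form h z v w" and ?R = "(g \<bullet> v) *\<^sub>R w + (g \<bullet> w) *\<^sub>R v - (v \<bullet> w) *\<^sub>R g"
  have "y \<bullet> ?C = y \<bullet> ?R" for y
  proof -
    have "E * (y \<bullet> ?C) = 1/2 * (w \<bullet> (D v *v y) + v \<bullet> (D w *v y) - v \<bullet> (D y *v w))"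
      using koszul_formula[OF D inv, of y v w] by (simp add: hz mat_vector_mult)
    also have "\<dots> = E * (y \<bullet> ?R)"
      by (simp add: Dv mat_vector_mult inner_simps inner_commute algebra_simps)
    finally show ?thesis using E by simp
  qed
  then have "?C = ?R" by (metis vector_eq_rdot inner_commute)
  then show ?thesis by (simp add: g_def)
qed

text \<open>The metric unit tangent is \<open>exp (- lam)\<close> times the Euclidean one. The
  derivative of this factor cancels the tangential part of the Christoffel term, and only the
  multiple \<open>k + \<partial>\<^sub>u lam\<close> of the normal survives. The exponent
  \<open>1 - p\<close> combines the factor \<open>exp (- lam)\<close> of the curvature, taken to the
  power \<open>p\<close>, with \<open>exp lam\<close> from the line element.\<close>

lemma conformal_energy_density:
  fixes h :: "real^2 \<Rightarrow> real^2^2"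
  assumes V: "open V" "x t \<in> V" and conf: "\<And>y. y \<in> V \<Longrightarrow> h y = mat (exp (2 * lam y))"
    and D: "(h has_derivative D) (at (x t))"
    and x: "\<forall>\<^sub>F r in nhds t. (x has_vector_derivative T r) (at r) \<and> norm (T r) = 1"
    and k: "(T has_vector_derivative k *\<^sub>R rot (T t)) (at t)"
  shows "energy_density_at h p x t
    (exp ((1 - p) * lam (x t)) * \<bar>k + grad lam (x t) \<bullet> (- rot (T t))\<bar> powr p)"
proof -
  let ?l = "lam (x t)" and ?g = "grad lam (x t)"
  have xt: "(x has_vector_derivative T t) (at t)" and T1: "norm (T t) = 1"
    using eventually_nhds_x_imp_x[OF x] by auto
  have "\<forall>\<^sub>F r in at t. x r \<in> V"
    using has_vector_derivative_continuous[OF xt] V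
    by (auto simp: continuous_at intro: topological_tendstoD)
  then have xV: "\<forall>\<^sub>F r in nhds t. x r \<in> V" using V by (simp add: eventually_nhds_conv_at)
  have dl: "((\<lambda>r. lam (x r)) has_real_derivative ?g \<bullet> T t) (at t)"
    using has_derivative_compose[OF xt[unfolded has_vector_derivative_def] conformal_factor_differentiable(1)[OF V conf D]]
    by (simp add: has_field_derivative_def mult.commute[of _ "?g \<bullet> T t"])
  define b where "b = exp (- ?l) *\<^sub>R (k *\<^sub>R rot (T t) - (?g \<bullet> T t) *\<^sub>R T t)"
  have "((\<lambda>r. exp (- lam (x r)) *\<^sub>R T r) has_vector_derivative b) (at t)"
    by (auto intro!: derivative_eq_intros dl k simp: b_def algebra_simps)
  moreover have "\<forall>\<^sub>F r in nhds t. exp (- lam (x r)) *\<^sub>R T r = T r /\<^sub>R gram_norm (h (x r)) (T r)"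
    using x xV by eventually_elim (simp add: conf gram_norm_conformal exp_minus)
  ultimately have Tb: "((\<lambda>r. T r /\<^sub>R gram_norm (h (x r)) (T r)) has_vector_derivative b) (at t)"
    by (rule has_vector_derivative_eventually)
  have n: "gram_norm (h (x t)) v = exp ?l * norm v" for v using conf[OF V(2)] by (simp add: gram_norm_conformal)
  define X where "X = k + ?g \<bullet> (- rot (T t))"
  have "b + christoffel_form h (x t) (T t) (T t /\<^sub>R exp ?l)
     = exp (- ?l) *\<^sub>R (k *\<^sub>R rot (T t) + (?g \<bullet> T t) *\<^sub>R T t - ?g)"
    using T1 by (simp add: b_def conformal_christoffel[OF V conf D] exp_minus dot_square_norm scaleR_diff_right
        scaleR_add_right)
  also have "k *\<^sub>R rot (T t) + (?g \<bullet> T t) *\<^sub>R T t - ?g = X *\<^sub>R rot (T t)"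
    by (subst (2) orthonormal_expansion[OF T1, of ?g]) (simp add: X_def algebra_simps)
  finally have "b + christoffel_form h (x t) (T t) (T t /\<^sub>R gram_norm (h (x t)) (T t)) = exp (- ?l) *\<^sub>R X *\<^sub>R rot (T t)"
    using T1 by (simp add: n)
  then have "gram_norm (h (x t)) ((b + christoffel_form h (x t) (T t) (T t /\<^sub>R gram_norm (h (x t)) (T t)))
      /\<^sub>R gram_norm (h (x t)) (T t)) = exp (- ?l) * \<bar>X\<bar>"
    using T1 by (simp add: n exp_minus field_simps)
  moreover have "(exp (- ?l) * \<bar>X\<bar>) powr p * exp ?l = exp ((1 - p) * ?l) * \<bar>X\<bar> powr p"
    by (simp add: powr_mult exp_powr_real algebra_simps flip: exp_add)
  ultimately show ?thesis
    unfolding energy_density_at_def X_def[symmetric] using x Tb T1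
    by (intro exI[of _ T] exI[of _ b]) (auto simp: n elim: eventually_mono)
qed

section \<open>Charts, curves and metric disks\<close>

lemma has_integral_join:
  fixes g1 g2 :: "real \<Rightarrow> real"
  assumes "(g1 has_integral I1) {0..1}" "(g2 has_integral I2) {0..1}"
  shows "((\<lambda>t. if t \<le> 1/2 then 2 * g1 (2 * t) else 2 * g2 (2 * t - 1)) has_integral I1 + I2) {0..1}"
proof (rule has_integral_combine[of 0 "1/2"])
  have "((\<lambda>t. 2 * g1 (2 * t)) has_integral I1) {0..1/2}"
    using has_integral_mult_right[OF has_integral_affinity'[OF assms(1)[unfolded cbox_interval[symmetric]], of 2 0], of 2]
    by simp
  then show "((\<lambda>t. if t \<le> 1/2 then 2 * g1 (2 * t) else 2 * g2 (2 * t - 1)) has_integral I1) {0..1/2}"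
    by (rule has_integral_eq[rotated]) auto
  have "((\<lambda>t. 2 * g2 (2 * t - 1)) has_integral I2) {1/2..1}"
    using has_integral_mult_right[OF has_integral_affinity'[OF assms(2)[unfolded cbox_interval[symmetric]], of 2 "-1"], of 2]
    by simp
  then show "((\<lambda>t. if t \<le> 1/2 then 2 * g1 (2 * t) else 2 * g2 (2 * t - 1)) has_integral I2) {1/2..1}"
    by (rule has_integral_spike_finite[rotated 2, of _ _ _ "{1/2}"]) auto
qed auto

lemma has_vector_derivative_reflect:
  assumes "(f has_vector_derivative f') (at (l - t) within {0..l})"
  shows "((\<lambda>t. f (l - t)) has_vector_derivative - f') (at t within {0..l::real})"
proof -
  have img: "(\<lambda>t. l - t) ` {0..l} = {0..l}"
  proof (intro equalityI subsetI)
    fix x assume "x \<in> {0..l}"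
    then show "x \<in> (\<lambda>t. l - t) ` {0..l}" by (intro image_eqI[of _ _ "l - x"]) auto
  qed auto
  have "((\<lambda>t. l - t) has_vector_derivative - 1) (at t within {0..l})"
    by (auto intro!: derivative_eq_intros simp: has_real_derivative_iff_has_vector_derivative[symmetric])
  from vector_diff_chain_within[OF this, of f f'] assms show ?thesis by (simp add: img o_def)
qed

lemma inner_transpose: "v \<bullet> (transpose M *v w) = (M *v v) \<bullet> w" for M :: "real^'n^'m"
  by (metis dot_lmul_matrix inner_commute transpose_matrix_vector)

section \<open>Charts, coordinate changes and the metric\<close>

locale riemannian =
  fixes S :: "'a::t2_space set" and A :: "'a chart set" and G :: "'a chart \<Rightarrow> real^2 \<Rightarrow> real^2^2"
  assumes surface: "riemannian_surface S A G"
begin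

lemma chart_is_chart: "ch \<in> A \<Longrightarrow> is_chart S ch"
  using surface by (auto simp: riemannian_surface_def C2_surface_def)

lemma
  assumes "ch \<in> A"
  shows chart_openin: "openin (top_of_set S) (fst ch)"
    and chart_image_open: "open (snd ch ` fst ch)"
    and chart_inj: "inj_on (snd ch) (fst ch)"
    and chart_continuous: "continuous_on (fst ch) (snd ch)"
    and chart_inv_continuous: "continuous_on (snd ch ` fst ch) (inv_into (fst ch) (snd ch))"
proof -
  obtain U \<psi> where ch: "ch = (U, \<psi>)" by (cases ch)
  obtain \<psi>' where hom: "homeomorphism U (\<psi> ` U) \<psi> \<psi>'"
    and o: "openin (top_of_set S) U" "open (\<psi> ` U)"
    using chart_is_chart[OF assms] ch by (auto simp: is_chart_def)
  show "openin (top_of_set S) (fst ch)" "open (snd ch ` fst ch)" "continuous_on (fst ch) (snd ch)"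
    using hom o ch by (auto simp: homeomorphism_def)
  show inj: "inj_on (snd ch) (fst ch)"
    using hom ch by (simp add: homeomorphism_def) (metis inj_on_inverseI)
  have "inv_into U \<psi> z = \<psi>' z" if "z \<in> \<psi> ` U" for z
    using hom that inj ch by (auto simp: homeomorphism_def)
  then show "continuous_on (snd ch ` fst ch) (inv_into (fst ch) (snd ch))"
    using hom ch by (auto simp: homeomorphism_def cong: continuous_on_cong)
qed

lemma chart_subset: "ch \<in> A \<Longrightarrow> fst ch \<subseteq> S"
  using chart_openin openin_imp_subset by blast

lemma chart_open_trace:
  assumes "ch \<in> A" obtains T where "open T" "fst ch = S \<inter> T"
  using chart_openin[OF assms] unfolding openin_open by blast

lemma chart_at_atlas:
  assumes "x \<in> S" shows "chart_at A x \<in> A" "x \<in> fst (chart_at A x)"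
proof -
  have "\<exists>c. c \<in> A \<and> x \<in> fst c"
    using assms surface unfolding riemannian_surface_def C2_surface_def by blast
  then show "chart_at A x \<in> A" "x \<in> fst (chart_at A x)"
    using someI_ex[of "\<lambda>c. c \<in> A \<and> x \<in> fst c"] unfolding chart_at_def by auto
qed

lemma chart_open_image:
  assumes "ch \<in> A" "openin (top_of_set S) W" "W \<subseteq> fst ch"
  shows "open (snd ch ` W)"
proof -
  obtain T where T: "open T" "W = S \<inter> T" using assms(2) unfolding openin_open by blast
  let ?f = "inv_into (fst ch) (snd ch)"
  have "snd ch ` W = ?f -` T \<inter> snd ch ` fst ch"
    using assms(3) T chart_subset[OF assms(1)] chart_inj[OF assms(1)] by auto
  moreover have "open (?f -` T \<inter> snd ch ` fst ch)"
    using continuous_on_open_vimage[OF chart_image_open[OF assms(1)]] chart_inv_continuous[OF assms(1)] T by blast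
  ultimately show ?thesis by simp
qed

lemma overlap_open: "c \<in> A \<Longrightarrow> c' \<in> A \<Longrightarrow> open (overlap c c')"
  unfolding overlap_def by (intro chart_open_image openin_Int chart_openin) auto

lemma transition_apply: "c \<in> A \<Longrightarrow> x \<in> fst c \<Longrightarrow> transition c c' (snd c x) = snd c' x"
  using chart_inj by (simp add: transition_def)

lemma overlapI: "x \<in> fst c \<Longrightarrow> x \<in> fst c' \<Longrightarrow> snd c x \<in> overlap c c'"
  by (simp add: overlap_def)

lemma metric_pos_gram: "ch \<in> A \<Longrightarrow> z \<in> snd ch ` fst ch \<Longrightarrow> pos_gram (G ch z)"
  using surface by (auto simp: riemannian_surface_def riemannian_metric_def pos_gram_def)

lemma metric_C1:
  assumes "ch \<in> A"
  obtains G' where "\<And>z. z \<in> snd ch ` fst ch \<Longrightarrow> (G ch has_derivative blinfun_apply (G' z)) (at z)"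
    "continuous_on (snd ch ` fst ch) G'"
proof -
  have "C1_on (snd ch ` fst ch) (G ch)"
    using surface assms unfolding riemannian_surface_def riemannian_metric_def by blast
  then show thesis using that unfolding C1_on_def by blast
qed

lemma metric_continuous: "ch \<in> A \<Longrightarrow> continuous_on (snd ch ` fst ch) (G ch)"
  by (metis metric_C1 continuous_at_imp_continuous_on has_derivative_continuous)

text \<open>Brings the matrix transformation law into the form used by
  \<open>christoffel_transformation\<close>: a pullback of bilinear forms under the derivative
  \<open>P\<close>.\<close>

lemma transition_C2:
  assumes "c \<in> A" "c' \<in> A"
  obtains P P2 where
    "\<And>z. z \<in> overlap c c' \<Longrightarrow> (transition c c' has_derivative blinfun_apply (P z)) (at z)"
    "\<And>z. z \<in> overlap c c' \<Longrightarrow> (P has_derivative P2 z) (at z)"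
    "continuous_on (overlap c c') P"
    "\<And>z v w. z \<in> overlap c c' \<Longrightarrow>
       v \<bullet> (G c z *v w) = P z v \<bullet> (G c' (transition c c' z) *v P z w)"
proof -
  have "C2_compatible c c'"
    using surface assms by (auto simp: riemannian_surface_def C2_surface_def)
  then obtain P P2 where P: "\<And>z. z \<in> overlap c c' \<Longrightarrow> (transition c c' has_derivative blinfun_apply (P z)) (at z)"
    and P2: "\<And>z. z \<in> overlap c c' \<Longrightarrow> (P has_derivative blinfun_apply (P2 z)) (at z)"
    unfolding C2_compatible_def C2_on_def C1_on_def by blast
  have cont: "continuous_on (overlap c c') P"
    using P2 by (meson continuous_at_imp_continuous_on has_derivative_continuous)
  have "v \<bullet> (G c z *v w) = P z v \<bullet> (G c' (transition c c' z) *v P z w)" if z: "z \<in> overlap c c'" for z v w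
  proof -
    have J: "jacobian c c' z *v v = P z v" for v
      using frechet_derivative_at[OF P[OF z]] matrix_works[of "blinfun_apply (P z)"] blinfun.bounded_linear_right
      by (metis jacobian_def bounded_linear.linear linear_matrix_vector_mul_eq)
    have "G c z = transpose (jacobian c c' z) ** G c' (transition c c' z) ** jacobian c c' z"
      using surface assms z unfolding riemannian_surface_def riemannian_metric_def by blast
    then have "G c z *v w = transpose (jacobian c c' z) *v (G c' (transition c c' z) *v (jacobian c c' z *v w))"
      by (simp add: matrix_vector_mul_assoc matrix_mul_assoc)
    then have "v \<bullet> (G c z *v w) = (jacobian c c' z *v v) \<bullet> (G c' (transition c c' z) *v (jacobian c c' z *v w))"
      by (metis inner_transpose)
    then show ?thesis by (simp add: J)
  qed
  with that[OF P P2 cont] show thesis by simp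
qed

text \<open>Chart domains are open only relative to \<open>S\<close>, so continuity alone does not
  keep the curve inside one; staying in \<open>S\<close> is a separate premise.\<close>

lemma eventually_in_chart:
  assumes ch: "ch \<in> A" and x: "c t \<in> fst ch" and "(c \<longlongrightarrow> c t) F" and "\<forall>\<^sub>F r in F. c r \<in> S"
  shows "\<forall>\<^sub>F r in F. c r \<in> fst ch"
proof -
  obtain T where T: "open T" "fst ch = S \<inter> T" using chart_open_trace[OF ch] .
  then have "\<forall>\<^sub>F r in F. c r \<in> T" using assms by (intro topological_tendstoD) auto
  with assms(4) show ?thesis by eventually_elim (simp add: T)
qed

text \<open>Allows the density to be computed in a convenient chart, an isothermal one at a corner,
  and then read in the chart selected by \<open>chart_at\<close>.\<close>

lemma energy_density_at_chart:
  assumes c: "c \<in> A" "c' \<in> A" and x: "\<forall>\<^sub>F r in nhds t. x r \<in> fst c \<inter> fst c'"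
    and ed: "energy_density_at (G c) p (snd c \<circ> x) t y"
  shows "energy_density_at (G c') p (snd c' \<circ> x) t y"
proof -
  obtain P P2 where P: "\<And>z. z \<in> overlap c c' \<Longrightarrow> (transition c c' has_derivative blinfun_apply (P z)) (at z)"
    "\<And>z. z \<in> overlap c c' \<Longrightarrow> (P has_derivative P2 z) (at z)"
    "\<And>z v w. z \<in> overlap c c' \<Longrightarrow> v \<bullet> (G c z *v w) = P z v \<bullet> (G c' (transition c c' z) *v P z w)"
    using transition_C2[OF c] by metis
  have xt: "x t \<in> fst c" "x t \<in> fst c'" using eventually_nhds_x_imp_x[OF x] by auto
  obtain D where D: "(G c has_derivative D) (at ((snd c \<circ> x) t))"
    using metric_C1[OF c(1)] xt by (metis comp_apply imageI)
  have tr: "transition c c' ((snd c \<circ> x) t) = snd c' (x t)" using xt c by (simp add: transition_apply)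
  obtain D' where D': "(G c' has_derivative D') (at (transition c c' ((snd c \<circ> x) t)))"
    unfolding tr using metric_C1[OF c(2)] xt by (metis imageI)
  have "energy_density_at (G c') p (transition c c' \<circ> (snd c \<circ> x)) t y"
    by (rule energy_density_at_transform[where h = "G c" and h' = "G c'" and P = P and x = "snd c \<circ> x",
          OF overlap_open[OF c] _ P(1) P(2) P(3) D D'])
      (use xt c ed tr in \<open>auto simp: overlapI metric_pos_gram\<close>)
  then show ?thesis
    by (rule energy_density_at_cong) (use x in eventually_elim, use c in \<open>simp add: transition_apply\<close>)
qed

text \<open>Stated for derivatives within an arbitrary set \<open>N\<close>, so that it also covers
  the one-sided velocities of two arcs meeting at a vertex.\<close>

lemma velocity_chart:
  assumes c: "c \<in> A" "c' \<in> A"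
  obtains P :: "real^2 \<Rightarrow> (real^2) \<Rightarrow>\<^sub>L (real^2)" where "continuous_on (overlap c c') P"
    "\<And>x v t N. x t \<in> fst c \<Longrightarrow> x t \<in> fst c' \<Longrightarrow> ((snd c \<circ> x) has_vector_derivative v) (at t within N) \<Longrightarrow> t \<in> N \<Longrightarrow>
       \<forall>\<^sub>F r in at t within N. x r \<in> fst c \<inter> fst c' \<Longrightarrow>
       ((snd c' \<circ> x) has_vector_derivative P (snd c (x t)) v) (at t within N)"
    "\<And>x v w. x \<in> fst c \<Longrightarrow> x \<in> fst c' \<Longrightarrow>
       P (snd c x) v \<bullet> (G c' (snd c' x) *v P (snd c x) w) = v \<bullet> (G c (snd c x) *v w)"
proof -
  obtain P P2 where P: "\<And>z. z \<in> overlap c c' \<Longrightarrow> (transition c c' has_derivative blinfun_apply (P z)) (at z)"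
    "\<And>z. z \<in> overlap c c' \<Longrightarrow> (P has_derivative P2 z) (at z)" "continuous_on (overlap c c') P"
    "\<And>z v w. z \<in> overlap c c' \<Longrightarrow> v \<bullet> (G c z *v w) = P z v \<bullet> (G c' (transition c c' z) *v P z w)"
    using transition_C2[OF c] by metis
  have 2: "((snd c' \<circ> x) has_vector_derivative P (snd c (x t)) v) (at t within N)"
    if x: "x t \<in> fst c" "x t \<in> fst c'" and v: "((snd c \<circ> x) has_vector_derivative v) (at t within N)" "t \<in> N"
      and ev: "\<forall>\<^sub>F r in at t within N. x r \<in> fst c \<inter> fst c'" for x :: "real \<Rightarrow> 'a" and v t N
  proof -
    have "(transition c c' has_derivative blinfun_apply (P ((snd c \<circ> x) t))) (at ((snd c \<circ> x) t))"
      using x by (auto intro: P overlapI)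
    from has_vector_derivative_chain_blinfun[OF v(1) this]
    have 1: "((transition c c' \<circ> (snd c \<circ> x)) has_vector_derivative P (snd c (x t)) v) (at t within N)" by (simp add: o_def)
    have "\<forall>\<^sub>F r in at t within N. (transition c c' \<circ> (snd c \<circ> x)) r = (snd c' \<circ> x) r"
      using ev by eventually_elim (use c in \<open>simp add: transition_apply\<close>)
    with 1 show ?thesis
      unfolding has_vector_derivative_def
      by (rule has_derivative_transform_eventually) (use x v c in \<open>auto simp: transition_apply\<close>)
  qed
  have 3: "P (snd c x) v \<bullet> (G c' (snd c' x) *v P (snd c x) w) = v \<bullet> (G c (snd c x) *v w)"
    if "x \<in> fst c" "x \<in> fst c'" for x v w
    using P(4)[OF overlapI[OF that], of v w] c that by (simp add: transition_apply)
  show thesis by (rule that[OF P(3) 2 3])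
qed

text \<open>\<open>g\<close> is the speed of \<open>c\<close>, which is the same in all charts.\<close>

definition C1_curve :: "(real \<Rightarrow> 'a) \<Rightarrow> (real \<Rightarrow> real) \<Rightarrow> bool" where
  "C1_curve c g \<longleftrightarrow> path c \<and> path_image c \<subseteq> S \<and> (\<exists>F. finite F \<and> {0, 1} \<subseteq> F \<and> (\<forall>ch\<in>A. \<exists>v.
     continuous_on {t \<in> {0..1} - F. c t \<in> fst ch} v \<and>
     (\<forall>t\<in>{0..1} - F. c t \<in> fst ch \<longrightarrow> ((snd ch \<circ> c) has_vector_derivative v t) (at t) \<and>
        gram_norm (G ch (snd ch (c t))) (v t) = g t)))"

section \<open>Lengths of curves and metric disks\<close>

lemma path_eventually_in_chart:
  assumes "path c" "path_image c \<subseteq> S" "ch \<in> A" "t \<in> {0<..<1}" "c t \<in> fst ch"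
  shows "\<forall>\<^sub>F r in nhds t. c r \<in> fst ch"
proof -
  have at: "at t within {0..1} = at t"
    using assms by (intro at_within_interior) (auto simp: interior_atLeastAtMost_real)
  have "(c \<longlongrightarrow> c t) (at t within {0..1})"
    using assms by (auto simp: path_def continuous_on_def)
  then have "(c \<longlongrightarrow> c t) (at t)" by (simp add: at)
  moreover have "\<forall>\<^sub>F r in nhds t. r \<in> {0<..<1::real}" using assms by (intro eventually_nhds_in_open) auto
  then have "\<forall>\<^sub>F r in nhds t. c r \<in> S"
    by eventually_elim (use assms(2) in \<open>auto simp: path_image_def\<close>)
  ultimately have "\<forall>\<^sub>F r in at t. c r \<in> fst ch"
    using assms by (intro eventually_in_chart) (auto simp: eventually_nhds_conv_at)
  then show ?thesis using assms by (simp add: eventually_nhds_conv_at)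
qed

lemma metric_diskI:
  assumes c: "C1_curve c g" and g: "(g has_integral I) {0..1}" "I < r"
  shows "pathfinish c \<in> metric_disk S A G (pathstart c) r"
proof -
  obtain F where p: "path c" "path_image c \<subseteq> S" and F: "finite F" "{0, 1} \<subseteq> F" and
    v: "\<And>ch. ch \<in> A \<Longrightarrow> \<exists>v. continuous_on {t \<in> {0..1} - F. c t \<in> fst ch} v \<and>
     (\<forall>t\<in>{0..1} - F. c t \<in> fst ch \<longrightarrow> ((snd ch \<circ> c) has_vector_derivative v t) (at t) \<and>
        gram_norm (G ch (snd ch (c t))) (v t) = g t)"
    using c unfolding C1_curve_def by blast
  have sp: "speed A G c t = g t" if t: "t \<in> {0..1} - F" for t
  proof -
    have tS: "c t \<in> S" using p t by (auto simp: path_image_def)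
    obtain w where w: "((snd (chart_at A (c t)) \<circ> c) has_vector_derivative w) (at t)"
      "gram_norm (G (chart_at A (c t)) (snd (chart_at A (c t)) (c t))) w = g t"
      using v[OF chart_at_atlas(1)[OF tS]] t chart_at_atlas(2)[OF tS] by blast
    have "0 < t" "t < 1" using F t by (auto simp: order.order_iff_strict)
    then have "at t within {0..1} = at t"
      by (intro at_within_interior) (auto simp: interior_atLeastAtMost_real)
    then show ?thesis using w vector_derivative_at by (fastforce simp: speed_def Let_def)
  qed
  have "(speed A G c has_integral I) {0..1}"
    by (rule has_integral_spike_finite[OF F(1) sp g(1)]) auto
  moreover have "piecewise_C1_path S A c"
    unfolding piecewise_C1_path_def C1_differentiable_on_def
  proof (intro conjI p exI[of _ F] F ballI)
    fix ch assume "ch \<in> A"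
    from v[OF this] show "\<exists>D. (\<forall>x\<in>{t \<in> {0..1} - F. c t \<in> fst ch}. (snd ch \<circ> c has_vector_derivative D x) (at x)) \<and>
             continuous_on {t \<in> {0..1} - F. c t \<in> fst ch} D" by blast
  qed
  ultimately show ?thesis using g(2) by (auto simp: metric_disk_def has_integral_iff)
qed

text \<open>The velocities supplied chart by chart all have the norm \<open>speed A G c t\<close>,
  because derivatives of transition maps are isometries of the Gram matrices.\<close>

lemma metric_diskE:
  assumes "x \<in> metric_disk S A G q r"
  obtains c g I where "C1_curve c g" "(g has_integral I) {0..1}" "I < r" "pathstart c = q" "pathfinish c = x"
proof -
  obtain c where c: "piecewise_C1_path S A c" "pathstart c = q" "pathfinish c = x"
    and int: "speed A G c integrable_on {0..1}" "integral {0..1} (speed A G c) < r"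
    using assms unfolding metric_disk_def by blast
  obtain F where p: "path c" "path_image c \<subseteq> S" and F: "finite F"
    and C1: "\<And>ch. ch \<in> A \<Longrightarrow> (snd ch \<circ> c) C1_differentiable_on {t \<in> {0..1} - F. c t \<in> fst ch}"
    using c unfolding piecewise_C1_path_def by blast
  let ?F = "F \<union> {0, 1}"
  have "C1_curve c (speed A G c)"
    unfolding C1_curve_def
  proof (intro conjI p exI[of _ ?F] ballI)
    fix ch assume ch: "ch \<in> A"
    obtain D where D: "\<And>t. t \<in> {0..1} - F \<Longrightarrow> c t \<in> fst ch \<Longrightarrow> ((snd ch \<circ> c) has_vector_derivative D t) (at t)"
      and Dc: "continuous_on {t \<in> {0..1} - F. c t \<in> fst ch} D"
      using C1[OF ch] unfolding C1_differentiable_on_def by blast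
    have "gram_norm (G ch (snd ch (c t))) (D t) = speed A G c t"
      if t: "t \<in> {0..1} - ?F" and ct: "c t \<in> fst ch" for t
    proof -
      let ?ch = "chart_at A (c t)"
      have tS: "c t \<in> S" using p t by (auto simp: path_image_def)
      note ca = chart_at_atlas[OF tS]
      obtain P :: "real^2 \<Rightarrow> (real^2) \<Rightarrow>\<^sub>L (real^2)" where P: 
        "\<And>x v t N. x t \<in> fst ch \<Longrightarrow> x t \<in> fst ?ch \<Longrightarrow> ((snd ch \<circ> x) has_vector_derivative v) (at t within N) \<Longrightarrow> t \<in> N \<Longrightarrow>
           \<forall>\<^sub>F r in at t within N. x r \<in> fst ch \<inter> fst ?ch \<Longrightarrow>
           ((snd ?ch \<circ> x) has_vector_derivative P (snd ch (x t)) v) (at t within N)"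
        "\<And>x v w. x \<in> fst ch \<Longrightarrow> x \<in> fst ?ch \<Longrightarrow>
           P (snd ch x) v \<bullet> (G ?ch (snd ?ch x) *v P (snd ch x) w) = v \<bullet> (G ch (snd ch x) *v w)"
        using velocity_chart[OF ch ca(1)] by metis
      have t1: "t \<in> {0<..<1}" using t by auto
      have ev: "\<forall>\<^sub>F r in nhds t. c r \<in> fst ch \<inter> fst ?ch"
        using path_eventually_in_chart[OF p ch t1 ct] path_eventually_in_chart[OF p ca(1) t1 ca(2)]
        by eventually_elim simp
      have "((snd ?ch \<circ> c) has_vector_derivative P (snd ch (c t)) (D t)) (at t)"
        using t ct ca ev by (intro P D) (auto simp: eventually_nhds_conv_at)
      moreover have "at t within {0..1} = at t"
        using t1 by (intro at_within_interior) (auto simp: interior_atLeastAtMost_real)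
      ultimately have "vector_derivative (snd ?ch \<circ> c) (at t within {0..1}) = P (snd ch (c t)) (D t)"
        using vector_derivative_at by fastforce
      then have "speed A G c t = gram_norm (G ?ch (snd ?ch (c t))) (P (snd ch (c t)) (D t))"
        by (simp add: speed_def Let_def)
      then show ?thesis by (simp add: gram_norm_def P(2)[OF ct ca(2)])
    qed
    moreover have "continuous_on {t \<in> {0..1} - ?F. c t \<in> fst ch} D"
      by (rule continuous_on_subset[OF Dc]) auto
    ultimately show "\<exists>v. continuous_on {t \<in> {0..1} - ?F. c t \<in> fst ch} v \<and>
     (\<forall>t\<in>{0..1} - ?F. c t \<in> fst ch \<longrightarrow> ((snd ch \<circ> c) has_vector_derivative v t) (at t) \<and>
        gram_norm (G ch (snd ch (c t))) (v t) = speed A G c t)"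
      using D by (intro exI[of _ D]) auto
  qed (use F in auto)
  from that[OF this integrable_integral[OF int(1)] int(2) c(2,3)] show thesis .
qed

lemma C1_curve_join:
  assumes c1: "C1_curve c1 g1" and c2: "C1_curve c2 g2" and eq: "pathfinish c1 = pathstart c2"
  shows "C1_curve (c1 +++ c2) (\<lambda>t. if t \<le> 1/2 then 2 * g1 (2 * t) else 2 * g2 (2 * t - 1))"
proof -
  obtain F1 where p1: "path c1" "path_image c1 \<subseteq> S" and F1: "finite F1" "{0, 1} \<subseteq> F1" and
    v1: "\<And>ch. ch \<in> A \<Longrightarrow> \<exists>v. continuous_on {t \<in> {0..1} - F1. c1 t \<in> fst ch} v \<and>
     (\<forall>t\<in>{0..1} - F1. c1 t \<in> fst ch \<longrightarrow> ((snd ch \<circ> c1) has_vector_derivative v t) (at t) \<and>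
        gram_norm (G ch (snd ch (c1 t))) (v t) = g1 t)"
    using c1 unfolding C1_curve_def by blast
  obtain F2 where p2: "path c2" "path_image c2 \<subseteq> S" and F2: "finite F2" "{0, 1} \<subseteq> F2" and
    v2: "\<And>ch. ch \<in> A \<Longrightarrow> \<exists>v. continuous_on {t \<in> {0..1} - F2. c2 t \<in> fst ch} v \<and>
     (\<forall>t\<in>{0..1} - F2. c2 t \<in> fst ch \<longrightarrow> ((snd ch \<circ> c2) has_vector_derivative v t) (at t) \<and>
        gram_norm (G ch (snd ch (c2 t))) (v t) = g2 t)"
    using c2 unfolding C1_curve_def by blast
  \<comment> \<open>The rescaled exceptional parameters of both halves. Since \<open>1\<close>
    belongs to \<open>F1\<close>, the joint \<open>1/2\<close> is exceptional too.\<close>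
  let ?F = "(\<lambda>t. t / 2) ` F1 \<union> (\<lambda>t. (t + 1) / 2) ` F2"
  have half: "2 * t \<in> {0..1} - F1 \<and> t < 1/2" if "t \<in> {0..1} - ?F" "t \<le> 1/2" for t
  proof -
    have "2 * t \<notin> F1"
    proof
      assume "2 * t \<in> F1"
      then have "2 * t / 2 \<in> (\<lambda>t. t / 2) ` F1" by (rule imageI)
      then show False using that by simp
    qed
    moreover have "t \<noteq> 1/2" using F1 that by force
    ultimately show ?thesis using that by auto
  qed
  have half': "2 * t - 1 \<in> {0..1} - F2" if "t \<in> {0..1} - ?F" "t > 1/2" for t
  proof -
    have "2 * t - 1 \<notin> F2"
    proof
      assume "2 * t - 1 \<in> F2"
      then have "(2 * t - 1 + 1) / 2 \<in> (\<lambda>t. (t + 1) / 2) ` F2" by (rule imageI)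
      then show False using that by simp
    qed
    then show ?thesis using that by auto
  qed
  show ?thesis
    unfolding C1_curve_def
  proof (intro conjI exI[of _ ?F] ballI)
    show "path (c1 +++ c2)" "path_image (c1 +++ c2) \<subseteq> S"
      using p1 p2 eq by (auto simp: path_image_join)
    show "finite ?F" "{0, 1} \<subseteq> ?F" using F1 F2 by force+
    fix ch assume ch: "ch \<in> A"
    obtain w1 where w1: "continuous_on {t \<in> {0..1} - F1. c1 t \<in> fst ch} w1"
      "\<And>t. t\<in>{0..1} - F1 \<Longrightarrow> c1 t \<in> fst ch \<Longrightarrow> ((snd ch \<circ> c1) has_vector_derivative w1 t) (at t) \<and>
        gram_norm (G ch (snd ch (c1 t))) (w1 t) = g1 t" using v1[OF ch] by blast
    obtain w2 where w2: "continuous_on {t \<in> {0..1} - F2. c2 t \<in> fst ch} w2"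
      "\<And>t. t\<in>{0..1} - F2 \<Longrightarrow> c2 t \<in> fst ch \<Longrightarrow> ((snd ch \<circ> c2) has_vector_derivative w2 t) (at t) \<and>
        gram_norm (G ch (snd ch (c2 t))) (w2 t) = g2 t" using v2[OF ch] by blast
    define v where "v t = (if t \<le> 1/2 then 2 *\<^sub>R w1 (2 * t) else 2 *\<^sub>R w2 (2 * t - 1))" for t
    let ?T = "{t \<in> {0..1} - ?F. (c1 +++ c2) t \<in> fst ch}"
    let ?T1 = "?T \<inter> {..1/2}" and ?T2 = "?T \<inter> {1/2..}"
    have "?T = ?T1 \<union> ?T2" by auto
    \<comment> \<open>The joint is not in \<open>?T\<close>, so the two relatively closed pieces are
      disjoint and the matching condition for the velocities is vacuous.\<close>
    moreover have "continuous_on (?T1 \<union> ?T2) v"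
      unfolding v_def
    proof (rule continuous_on_cases_local)
      show "closedin (top_of_set (?T1 \<union> ?T2)) ?T1" "closedin (top_of_set (?T1 \<union> ?T2)) ?T2"
        unfolding \<open>?T = ?T1 \<union> ?T2\<close>[symmetric] by (intro closedin_closed_Int; simp)+
      have "(\<lambda>t. 2 * t) ` ?T1 \<subseteq> {t \<in> {0..1} - F1. c1 t \<in> fst ch}"
        using half by (auto simp: joinpaths_def)
      then show "continuous_on ?T1 (\<lambda>t. 2 *\<^sub>R w1 (2 * t))"
        by (intro continuous_intros continuous_on_compose2[OF w1(1)])
      have "(\<lambda>t. 2 * t - 1) ` ?T2 \<subseteq> {t \<in> {0..1} - F2. c2 t \<in> fst ch}"
      proof
        fix s assume "s \<in> (\<lambda>t. 2 * t - 1) ` ?T2"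
        then obtain t where t: "s = 2 * t - 1" "t \<in> ?T" "t \<ge> 1/2" by auto
        then have "t > 1/2" using half[of t] by force
        then show "s \<in> {t \<in> {0..1} - F2. c2 t \<in> fst ch}" using half'[of t] t by (auto simp: joinpaths_def)
      qed
      then show "continuous_on ?T2 (\<lambda>t. 2 *\<^sub>R w2 (2 * t - 1))"
        by (intro continuous_intros continuous_on_compose2[OF w2(1)])
      show "2 *\<^sub>R w1 (2 * t) = 2 *\<^sub>R w2 (2 * t - 1)" if "t \<in> ?T1 \<and> \<not> t \<le> 1/2 \<or> t \<in> ?T2 \<and> t \<le> 1/2" for t
        using that half[of t] by auto
    qed
    ultimately have cont: "continuous_on ?T v" by metis
    have "((snd ch \<circ> (c1 +++ c2)) has_vector_derivative v t) (at t) \<and>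
        gram_norm (G ch (snd ch ((c1 +++ c2) t))) (v t) = (if t \<le> 1/2 then 2 * g1 (2 * t) else 2 * g2 (2 * t - 1))"
      if t: "t \<in> {0..1} - ?F" and ct: "(c1 +++ c2) t \<in> fst ch" for t
    proof (cases "t \<le> 1/2")
      case True
      have d: "((snd ch \<circ> c1) has_vector_derivative w1 (2 * t)) (at (2 * t + 0))"
        "gram_norm (G ch (snd ch (c1 (2 * t)))) (w1 (2 * t)) = g1 (2 * t)"
        using w1(2)[of "2 * t"] half[OF t True] ct True by (auto simp: joinpaths_def)
      have "\<forall>\<^sub>F r in nhds t. r \<in> {..<1/2}" using half[OF t True] by (intro eventually_nhds_in_open) auto
      then have "\<forall>\<^sub>F r in nhds t. (snd ch \<circ> c1) (2 * r + 0) = (snd ch \<circ> (c1 +++ c2)) r"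
        by eventually_elim (auto simp: joinpaths_def)
      from has_vector_derivative_eventually[OF has_vector_derivative_affine[OF d(1)] this] d(2) True show ?thesis
        by (simp add: v_def joinpaths_def gram_norm_scaleR o_def)
    next
      case False
      have d: "((snd ch \<circ> c2) has_vector_derivative w2 (2 * t - 1)) (at (2 * t + (-1)))"
        "gram_norm (G ch (snd ch (c2 (2 * t - 1)))) (w2 (2 * t - 1)) = g2 (2 * t - 1)"
        using w2(2)[of "2 * t - 1"] half'[OF t] ct False by (auto simp: joinpaths_def)
      have "\<forall>\<^sub>F r in nhds t. r \<in> {1/2<..}" using False by (intro eventually_nhds_in_open) auto
      then have "\<forall>\<^sub>F r in nhds t. (snd ch \<circ> c2) (2 * r + (-1)) = (snd ch \<circ> (c1 +++ c2)) r"
        by eventually_elim (auto simp: joinpaths_def)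
      from has_vector_derivative_eventually[OF has_vector_derivative_affine[OF d(1)] this] d(2) False show ?thesis
        by (simp add: v_def joinpaths_def gram_norm_scaleR o_def)
    qed
    with cont show "\<exists>v. continuous_on ?T v \<and>
     (\<forall>t\<in>{0..1} - ?F. (c1 +++ c2) t \<in> fst ch \<longrightarrow> ((snd ch \<circ> (c1 +++ c2)) has_vector_derivative v t) (at t) \<and>
        gram_norm (G ch (snd ch ((c1 +++ c2) t))) (v t) = (if t \<le> 1/2 then 2 * g1 (2 * t) else 2 * g2 (2 * t - 1)))"
      by blast
  qed
qed

lemma metric_disk_triangle:
  assumes "x \<in> metric_disk S A G q r" "y \<in> metric_disk S A G x r'"
  shows "y \<in> metric_disk S A G q (r + r')"
proof -
  obtain c1 g1 I1 where 1: "C1_curve c1 g1" "(g1 has_integral I1) {0..1}" "I1 < r" "pathstart c1 = q" "pathfinish c1 = x"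
    using metric_diskE[OF assms(1)] .
  obtain c2 g2 I2 where 2: "C1_curve c2 g2" "(g2 has_integral I2) {0..1}" "I2 < r'" "pathstart c2 = x" "pathfinish c2 = y"
    using metric_diskE[OF assms(2)] .
  have "I1 + I2 < r + r'" using 1 2 by simp
  from metric_diskI[OF C1_curve_join[OF 1(1) 2(1)] has_integral_join[OF 1(2) 2(2)] this] 1 2 show ?thesis by simp
qed

lemma metric_disk_center: "q \<in> S \<Longrightarrow> 0 < r \<Longrightarrow> q \<in> metric_disk S A G q r"
proof -
  assume q: "q \<in> S" "0 < r"
  have "C1_curve (\<lambda>_. q) (\<lambda>_. 0)"
    unfolding C1_curve_def
    by (auto intro!: exI[of _ "{0, 1}"] exI[of _ "\<lambda>_. 0"] simp: path_def path_image_def q o_def)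
  from metric_diskI[OF this has_integral_0 q(2)] show ?thesis by (simp add: pathstart_def pathfinish_def)
qed

lemma segment_C1_curve:
  assumes ch: "ch \<in> A" and seg: "closed_segment a b \<subseteq> snd ch ` fst ch"
  shows "C1_curve (inv_into (fst ch) (snd ch) \<circ> linepath a b) (\<lambda>t. gram_norm (G ch (linepath a b t)) (b - a))"
proof -
  let ?c = "inv_into (fst ch) (snd ch) \<circ> linepath a b"
  have lp: "linepath a b t \<in> snd ch ` fst ch" if "t \<in> {0..1}" for t
    using seg linepath_image_01 that by blast
  have c_in: "?c t \<in> fst ch" and sc: "snd ch (?c t) = linepath a b t" if "t \<in> {0..1}" for t
    using lp[OF that] by (auto simp: inv_into_into f_inv_into_f)
  have p: "path ?c"
    using path_continuous_image[OF path_linepath continuous_on_subset[OF chart_inv_continuous[OF ch]]] seg by simp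
  have pS: "path_image ?c \<subseteq> S" using c_in chart_subset[OF ch] by (force simp: path_image_def)
  show ?thesis
    unfolding C1_curve_def
  proof (intro conjI p pS exI[of _ "{0, 1}"] ballI)
    fix ch' assume ch': "ch' \<in> A"
    obtain P :: "real^2 \<Rightarrow> (real^2) \<Rightarrow>\<^sub>L (real^2)" where P: "continuous_on (overlap ch ch') P"
      "\<And>x v t N. x t \<in> fst ch \<Longrightarrow> x t \<in> fst ch' \<Longrightarrow> ((snd ch \<circ> x) has_vector_derivative v) (at t within N) \<Longrightarrow> t \<in> N \<Longrightarrow>
         \<forall>\<^sub>F r in at t within N. x r \<in> fst ch \<inter> fst ch' \<Longrightarrow>
         ((snd ch' \<circ> x) has_vector_derivative P (snd ch (x t)) v) (at t within N)"
      "\<And>x v w. x \<in> fst ch \<Longrightarrow> x \<in> fst ch' \<Longrightarrow>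
         P (snd ch x) v \<bullet> (G ch' (snd ch' x) *v P (snd ch x) w) = v \<bullet> (G ch (snd ch x) *v w)"
      using velocity_chart[OF ch ch'] by metis
    let ?T = "{t \<in> {0..1} - {0, 1}. ?c t \<in> fst ch'}"
    have "linepath a b ` ?T \<subseteq> overlap ch ch'"
    proof
      fix z assume "z \<in> linepath a b ` ?T"
      then obtain t where t: "t \<in> ?T" "z = linepath a b t" by blast
      then show "z \<in> overlap ch ch'" using overlapI[of "?c t" ch ch'] c_in[of t] sc[of t] by auto
    qed
    then have "continuous_on ?T (\<lambda>t. P (linepath a b t) (b - a))"
      by (intro continuous_intros continuous_on_compose2[OF P(1)] continuous_on_linepath)
    moreover have "((snd ch' \<circ> ?c) has_vector_derivative P (linepath a b t) (b - a)) (at t) \<and>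
        gram_norm (G ch' (snd ch' (?c t))) (P (linepath a b t) (b - a)) = gram_norm (G ch (linepath a b t)) (b - a)"
      if t: "t \<in> {0..1} - {0, 1}" and ct: "?c t \<in> fst ch'" for t
    proof -
      have t1: "t \<in> {0<..<1}" and t01: "t \<in> {0..1}" using t by auto
      have "\<forall>\<^sub>F r in nhds t. r \<in> {0<..<1::real}" using t1 by (intro eventually_nhds_in_open) auto
      then have ev: "\<forall>\<^sub>F r in nhds t. linepath a b r = (snd ch \<circ> ?c) r"
      proof eventually_elim
        case (elim r)
        then show ?case using sc[of r] by simp
      qed
      have lv: "(linepath a b has_vector_derivative (b - a)) (at t)"
        by (auto intro!: derivative_eq_intros simp: linepath_def algebra_simps)
      have "((snd ch \<circ> ?c) has_vector_derivative (b - a)) (at t)"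
        by (rule has_vector_derivative_eventually[OF lv ev])
      moreover have "\<forall>\<^sub>F r in nhds t. ?c r \<in> fst ch \<inter> fst ch'"
        using path_eventually_in_chart[OF p pS ch t1 c_in[OF t01]] path_eventually_in_chart[OF p pS ch' t1 ct]
        by eventually_elim simp
      ultimately have "((snd ch' \<circ> ?c) has_vector_derivative P (snd ch (?c t)) (b - a)) (at t)"
        using c_in[OF t01] ct by (intro P) (auto simp: eventually_nhds_conv_at)
      then show ?thesis
        using P(3)[OF c_in[OF t01] ct, of "b - a" "b - a"] by (simp only: sc[OF t01] gram_norm_def)
    qed
    ultimately show "\<exists>v. continuous_on ?T v \<and> (\<forall>t\<in>{0..1} - {0, 1}. ?c t \<in> fst ch' \<longrightarrow>
        ((snd ch' \<circ> ?c) has_vector_derivative v t) (at t) \<and>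
        gram_norm (G ch' (snd ch' (?c t))) (v t) = gram_norm (G ch (linepath a b t)) (b - a))"
      by (intro exI[of _ "\<lambda>t. P (linepath a b t) (b - a)"]) blast
  qed auto
qed

text \<open>Riemannian distances are bounded above by lifting coordinate segments; continuity of the
  metric makes the speed of the lift integrable.\<close>

lemma segment_metric_disk:
  assumes ch: "ch \<in> A" and seg: "closed_segment a b \<subseteq> snd ch ` fst ch"
    and B: "\<And>z. z \<in> closed_segment a b \<Longrightarrow> gram_norm (G ch z) (b - a) \<le> B" and r: "B < r"
  shows "inv_into (fst ch) (snd ch) b \<in> metric_disk S A G (inv_into (fst ch) (snd ch) a) r"
proof -
  have lp: "linepath a b ` {0..1} \<subseteq> snd ch ` fst ch" using seg linepath_image_01 by metis
  have "continuous_on {0..1} (\<lambda>t. G ch (linepath a b t))"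
    by (rule continuous_on_compose2[OF metric_continuous[OF ch] continuous_on_linepath lp])
  then have "continuous_on {0..1} (\<lambda>t. gram_norm (G ch (linepath a b t)) (b - a))"
    unfolding gram_norm_def
    by (intro continuous_intros bounded_bilinear.continuous_on[OF bounded_bilinear_matrix_vector])
  then have int: "(\<lambda>t. gram_norm (G ch (linepath a b t)) (b - a)) integrable_on {0..1}"
    by (rule integrable_continuous_real)
  have "integral {0..1} (\<lambda>t. gram_norm (G ch (linepath a b t)) (b - a)) \<le> integral {0..1} (\<lambda>t::real. B)"
    by (rule integral_le[OF int]) (auto intro!: B linepath_in_path)
  then have "integral {0..1} (\<lambda>t. gram_norm (G ch (linepath a b t)) (b - a)) < r" using r by simp
  from metric_diskI[OF segment_C1_curve[OF ch seg] integrable_integral[OF int] this] show ?thesis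
    by (simp add: pathstart_def pathfinish_def linepath_0' linepath_1')
qed

section \<open>Geodesic arcs\<close>

lemma unit_speed_geodesicE:
  assumes "unit_speed_geodesic S A G l \<sigma>" "ch \<in> A"
  obtains v where "\<And>t. t \<in> {0..l} \<Longrightarrow> \<sigma> t \<in> fst ch \<Longrightarrow> ((snd ch \<circ> \<sigma>) has_vector_derivative v t) (at t within {0..l})"
    "\<And>t. t \<in> {0..l} \<Longrightarrow> \<sigma> t \<in> fst ch \<Longrightarrow>
       (v has_vector_derivative - christoffel_form (G ch) (snd ch (\<sigma> t)) (v t) (v t)) (at t within {0..l})"
    "\<And>t. t \<in> {0..l} \<Longrightarrow> \<sigma> t \<in> fst ch \<Longrightarrow> gram_norm (G ch (snd ch (\<sigma> t))) (v t) = 1"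
  using assms unfolding unit_speed_geodesic_def by metis

lemma geodesic_restrict:
  assumes "unit_speed_geodesic S A G l \<sigma>" "l' \<le> l"
  shows "unit_speed_geodesic S A G l' \<sigma>"
  unfolding unit_speed_geodesic_def
proof (intro conjI ballI)
  have sub: "{0..l'} \<subseteq> {0..l}" using assms by auto
  then show "continuous_on {0..l'} \<sigma>" "\<sigma> ` {0..l'} \<subseteq> S"
    using assms(1) by (auto simp: unit_speed_geodesic_def intro: continuous_on_subset)
  fix ch assume "ch \<in> A"
  obtain v where v: "\<And>t. t \<in> {0..l} \<Longrightarrow> \<sigma> t \<in> fst ch \<Longrightarrow> ((snd ch \<circ> \<sigma>) has_vector_derivative v t) (at t within {0..l})"
    "\<And>t. t \<in> {0..l} \<Longrightarrow> \<sigma> t \<in> fst ch \<Longrightarrow>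
       (v has_vector_derivative - christoffel_form (G ch) (snd ch (\<sigma> t)) (v t) (v t)) (at t within {0..l})"
    "\<And>t. t \<in> {0..l} \<Longrightarrow> \<sigma> t \<in> fst ch \<Longrightarrow> gram_norm (G ch (snd ch (\<sigma> t))) (v t) = 1"
    using unit_speed_geodesicE[OF assms(1) \<open>ch \<in> A\<close>] by metis
  show "\<exists>v. \<forall>t\<in>{0..l'}. \<sigma> t \<in> fst ch \<longrightarrow>
        ((snd ch \<circ> \<sigma>) has_vector_derivative v t) (at t within {0..l'}) \<and>
        (v has_vector_derivative - christoffel_form (G ch) (snd ch (\<sigma> t)) (v t) (v t)) (at t within {0..l'}) \<and>
        gram_norm (G ch (snd ch (\<sigma> t))) (v t) = 1"
  proof (intro exI[of _ v] ballI impI conjI)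
    fix t assume t: "t \<in> {0..l'}" "\<sigma> t \<in> fst ch"
    then have t': "t \<in> {0..l}" using sub by blast
    show "((snd ch \<circ> \<sigma>) has_vector_derivative v t) (at t within {0..l'})"
      by (rule has_vector_derivative_within_subset[OF v(1)[OF t' t(2)] sub])
    show "(v has_vector_derivative - christoffel_form (G ch) (snd ch (\<sigma> t)) (v t) (v t)) (at t within {0..l'})"
      by (rule has_vector_derivative_within_subset[OF v(2)[OF t' t(2)] sub])
    show "gram_norm (G ch (snd ch (\<sigma> t))) (v t) = 1" by (rule v(3)[OF t' t(2)])
  qed
qed

text \<open>The geodesic equation is quadratic in the velocity and survives a change of sign. With
  this the incoming arc can be run from the vertex outwards.\<close>

lemma geodesic_reverse:
  assumes "unit_speed_geodesic S A G l \<sigma>"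
  shows "unit_speed_geodesic S A G l (\<lambda>t. \<sigma> (l - t))"
  unfolding unit_speed_geodesic_def
proof (intro conjI ballI)
  have "continuous_on {0..l} \<sigma>" "\<sigma> ` {0..l} \<subseteq> S" using assms by (auto simp: unit_speed_geodesic_def)
  then show "continuous_on {0..l} (\<lambda>t. \<sigma> (l - t))" "(\<lambda>t. \<sigma> (l - t)) ` {0..l} \<subseteq> S"
    by (auto intro!: continuous_on_compose2[of "{0..l}" \<sigma>] continuous_intros)
  fix ch assume "ch \<in> A"
  obtain v where v: "\<And>t. t \<in> {0..l} \<Longrightarrow> \<sigma> t \<in> fst ch \<Longrightarrow> ((snd ch \<circ> \<sigma>) has_vector_derivative v t) (at t within {0..l})"
    "\<And>t. t \<in> {0..l} \<Longrightarrow> \<sigma> t \<in> fst ch \<Longrightarrow>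
       (v has_vector_derivative - christoffel_form (G ch) (snd ch (\<sigma> t)) (v t) (v t)) (at t within {0..l})"
    "\<And>t. t \<in> {0..l} \<Longrightarrow> \<sigma> t \<in> fst ch \<Longrightarrow> gram_norm (G ch (snd ch (\<sigma> t))) (v t) = 1"
    using unit_speed_geodesicE[OF assms(1) \<open>ch \<in> A\<close>] by metis
  show "\<exists>v. \<forall>t\<in>{0..l}. \<sigma> (l - t) \<in> fst ch \<longrightarrow>
        ((snd ch \<circ> (\<lambda>t. \<sigma> (l - t))) has_vector_derivative v t) (at t within {0..l}) \<and>
        (v has_vector_derivative - christoffel_form (G ch) (snd ch (\<sigma> (l - t))) (v t) (v t)) (at t within {0..l}) \<and>
        gram_norm (G ch (snd ch (\<sigma> (l - t)))) (v t) = 1"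
  proof (intro exI[of _ "\<lambda>t. - v (l - t)"] ballI impI conjI)
    fix t assume t: "t \<in> {0..l}" "\<sigma> (l - t) \<in> fst ch"
    then have t': "l - t \<in> {0..l}" by auto
    show "((snd ch \<circ> (\<lambda>t. \<sigma> (l - t))) has_vector_derivative - v (l - t)) (at t within {0..l})"
      using has_vector_derivative_reflect[OF v(1)[OF t' t(2)]] by (simp add: o_def)
    have "christoffel_form (G ch) z (- w) (- w) = christoffel_form (G ch) z w w" for z w
      using christoffel_form_scaleR_left[of "G ch" z "-1" w] christoffel_form_scaleR_right[of "G ch" z "- w" "-1" w] by simp
    then show "((\<lambda>t. - v (l - t)) has_vector_derivative
        - christoffel_form (G ch) (snd ch (\<sigma> (l - t))) (- v (l - t)) (- v (l - t))) (at t within {0..l})"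
      using has_vector_derivative_minus[OF has_vector_derivative_reflect[OF v(2)[OF t' t(2)]]] by simp
    show "gram_norm (G ch (snd ch (\<sigma> (l - t)))) (- v (l - t)) = 1"
      using v(3)[OF t' t(2)] gram_norm_scaleR[of _ "-1"] by simp
  qed
qed

text \<open>The arc up to time \<open>t\<close>, rescaled to \<open>{0..1}\<close>, has constant
  speed \<open>t\<close> and therefore length \<open>t\<close>.\<close>

lemma geodesic_metric_disk:
  assumes geo: "unit_speed_geodesic S A G l \<sigma>" and t: "0 \<le> t" "t \<le> l" "t < r"
  shows "\<sigma> t \<in> metric_disk S A G (\<sigma> 0) r"
proof (cases "t = 0")
  case True
  have "\<sigma> 0 \<in> S" using geo t by (auto simp: unit_speed_geodesic_def)
  with True t show ?thesis by (simp add: metric_disk_center)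
next
  case False
  then have t0: "t > 0" using t by simp
  let ?c = "\<lambda>s. \<sigma> (t * s)"
  have c: "continuous_on {0..l} \<sigma>" "\<sigma> ` {0..l} \<subseteq> S" using geo by (auto simp: unit_speed_geodesic_def)
  have ts: "t * s \<in> {0..l}" if "s \<in> {0..1}" for s
    using that t mult_left_le[of s t] by auto
  have "C1_curve ?c (\<lambda>_. t)"
    unfolding C1_curve_def
  proof (intro conjI exI[of _ "{0, 1}"] ballI)
    show "path ?c" unfolding path_def
      by (rule continuous_on_compose2[OF c(1)]) (auto intro!: continuous_intros ts[simplified])
    show "path_image ?c \<subseteq> S" using c ts by (force simp: path_image_def)
    fix ch assume ch: "ch \<in> A"
    obtain v where v: "\<And>t. t \<in> {0..l} \<Longrightarrow> \<sigma> t \<in> fst ch \<Longrightarrow> ((snd ch \<circ> \<sigma>) has_vector_derivative v t) (at t within {0..l})"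
      "\<And>t. t \<in> {0..l} \<Longrightarrow> \<sigma> t \<in> fst ch \<Longrightarrow>
         (v has_vector_derivative - christoffel_form (G ch) (snd ch (\<sigma> t)) (v t) (v t)) (at t within {0..l})"
      "\<And>t. t \<in> {0..l} \<Longrightarrow> \<sigma> t \<in> fst ch \<Longrightarrow> gram_norm (G ch (snd ch (\<sigma> t))) (v t) = 1"
      using unit_speed_geodesicE[OF geo ch] by metis
    let ?T = "{s \<in> {0..1} - {0, 1}. ?c s \<in> fst ch}"
    have "continuous_on {t \<in> {0..l}. \<sigma> t \<in> fst ch} v"
      unfolding continuous_on_eq_continuous_within
      by (auto intro!: continuous_within_subset[OF has_vector_derivative_continuous[OF v(2)]])
    then have "continuous_on ?T (\<lambda>s. t *\<^sub>R v (t * s))"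
    proof (rule continuous_on_scaleR[OF continuous_on_const continuous_on_compose2])
      show "continuous_on ?T (\<lambda>s. t * s)" by (intro continuous_intros)
      show "(\<lambda>s. t * s) ` ?T \<subseteq> {t \<in> {0..l}. \<sigma> t \<in> fst ch}" using ts by blast
    qed
    moreover have "((snd ch \<circ> ?c) has_vector_derivative t *\<^sub>R v (t * s)) (at s) \<and>
        gram_norm (G ch (snd ch (?c s))) (t *\<^sub>R v (t * s)) = t"
      if s: "s \<in> {0..1} - {0, 1}" and cs: "?c s \<in> fst ch" for s
    proof -
      have "s < 1" "0 < s" using s by auto
      then have "0 < t * s" "t * s < t" using t0 by auto
      then have "0 < t * s" "t * s < l" using t by auto
      then have "at (t * s) within {0..l} = at (t * s)"
        by (intro at_within_interior) (auto simp: interior_atLeastAtMost_real)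
      then have "((snd ch \<circ> \<sigma>) has_vector_derivative v (t * s)) (at (t * s + 0))"
        using v(1)[OF ts cs] s by simp
      from has_vector_derivative_affine[OF this] v(3)[OF ts cs] s t0 show ?thesis
        by (simp add: o_def gram_norm_scaleR)
    qed
    ultimately show "\<exists>v. continuous_on ?T v \<and> (\<forall>s\<in>{0..1} - {0, 1}. ?c s \<in> fst ch \<longrightarrow>
        ((snd ch \<circ> ?c) has_vector_derivative v s) (at s) \<and> gram_norm (G ch (snd ch (?c s))) (v s) = t)"
      by (intro exI[of _ "\<lambda>s. t *\<^sub>R v (t * s)"]) blast
  qed auto
  moreover have "((\<lambda>_. t) has_integral t) {0..1::real}" using has_integral_const_real[of t 0 1] by simp
  ultimately show ?thesis using metric_diskI[of ?c "\<lambda>_. t" t r] t by (simp add: pathstart_def pathfinish_def)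
qed

end

section \<open>Isothermal charts\<close>

text \<open>Compactness of \<open>S\<close> is used in its filter form, which yields a cluster point
  instead of a convergent subsequence; this extracts actual parameters from it.\<close>

lemma cluster_point_witness:
  assumes "inf (nhds y) (filtermap f F) \<noteq> bot" "open T" "y \<in> T" "eventually Q F"
  shows "\<exists>s. Q s \<and> f s \<in> T"
proof (rule ccontr)
  assume no: "\<not> ?thesis"
  have "\<forall>\<^sub>F s in F. f s \<notin> T" using assms(4) by eventually_elim (use no in auto)
  then have "\<forall>\<^sub>F x in filtermap f F. x \<notin> T" by (simp add: eventually_filtermap)
  moreover have "\<forall>\<^sub>F x in nhds y. x \<in> T" using assms by (intro eventually_nhds_in_open)
  ultimately have "\<forall>\<^sub>F x in inf (nhds y) (filtermap f F). False"
    unfolding eventually_inf by (metis (mono_tags))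
  then show False using assms(1) by (simp add: eventually_False)
qed

lemma norm_change_le:
  fixes f :: "real \<Rightarrow> 'b::real_normed_vector"
  assumes f': "\<And>t. t \<in> {0..a} \<Longrightarrow> (f has_vector_derivative f' t) (at t within {0..a})"
    and B: "\<And>t. t \<in> {0..a} \<Longrightarrow> norm (f' t) \<le> B" and t: "t \<in> {0..a}"
  shows "norm (f t - f 0) \<le> B * t"
proof -
  have "norm (f t - f 0) \<le> B * norm (t - 0)"
  proof (rule differentiable_bound[where S = "{0..a}" and f' = "\<lambda>s h. h *\<^sub>R f' s"])
    fix s assume s: "s \<in> {0..a}"
    show "(f has_derivative (\<lambda>h. h *\<^sub>R f' s)) (at s within {0..a})"
      using f'[OF s] by (simp add: has_vector_derivative_def)
    show "onorm (\<lambda>h. h *\<^sub>R f' s) \<le> B"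
      by (rule onorm_le) (use mult_right_mono[OF B[OF s] abs_ge_zero] in \<open>simp add: mult.commute\<close>)
  qed (use t in auto)
  then show ?thesis using t by simp
qed

lemma gram_norm_bounded_on_compact:
  fixes M :: "'x::topological_space \<Rightarrow> real^2^2"
  assumes "compact K" "continuous_on K M"
  obtains B where "0 < B" "\<And>z v. z \<in> K \<Longrightarrow> gram_norm (M z) v \<le> B * norm v"
proof -
  obtain C where C: "0 < C" "\<And>N v. norm ((N::real^2^2) *v v) \<le> norm N * norm v * C"
    using bounded_bilinear.pos_bounded[OF bounded_bilinear_matrix_vector] by blast
  obtain b where b: "\<And>z. z \<in> K \<Longrightarrow> norm (M z) \<le> b"
    using compact_imp_bounded[OF compact_continuous_image[OF assms(2,1)]]
    by (auto simp: bounded_iff)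
  define B where "B = sqrt ((\<bar>b\<bar> + 1) * C)"
  have "gram_norm (M z) v \<le> B * norm v" if z: "z \<in> K" for z v
  proof -
    have "v \<bullet> (M z *v v) \<le> norm v * norm (M z *v v)" by (rule norm_cauchy_schwarz)
    also have "\<dots> \<le> norm v * ((\<bar>b\<bar> + 1) * norm v * C)"
      using b[OF z] C(1) by (intro mult_left_mono order_trans[OF C(2)] mult_right_mono) auto
    also have "\<dots> = ((\<bar>b\<bar> + 1) * C) * (norm v)\<^sup>2" by (simp add: power2_eq_square)
    finally have "sqrt (v \<bullet> (M z *v v)) \<le> sqrt (((\<bar>b\<bar> + 1) * C) * (norm v)\<^sup>2)" by (rule real_sqrt_le_mono)
    then show ?thesis by (simp only: gram_norm_def B_def real_sqrt_mult) simp
  qed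
  moreover have "0 < B" using C by (simp add: B_def)
  ultimately show thesis using that by blast
qed

section \<open>Size of isothermal charts\<close>

locale isothermal = riemannian S A G for S :: "'a::t2_space set" and A G +
  fixes \<phi> :: "'a \<Rightarrow> 'a \<Rightarrow> real^2" and lam :: "'a \<Rightarrow> real^2 \<Rightarrow> real" and \<epsilon> \<delta>1 C0 :: real
  assumes compact: "compact S"
    and eps: "0 < \<epsilon>" and delta1: "0 < \<delta>1" and C0: "0 < C0"
    and charts: "normalized_isothermal_charts S A G \<epsilon> \<delta>1 C0 \<phi> lam"
begin

abbreviation disk :: "'a \<Rightarrow> real \<Rightarrow> 'a set" where
  "disk q d \<equiv> metric_disk S A G q (d / 2)"

abbreviation iso :: "'a \<Rightarrow> real \<Rightarrow> 'a chart" where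
  "iso q d \<equiv> (disk q d, \<phi> q)"

lemma
  assumes "q \<in> S"
  shows phi_center [simp]: "\<phi> q q = 0" and lam_center [simp]: "lam q 0 = 0"
  using charts assms by (auto simp: normalized_isothermal_charts_def)

lemma
  assumes "q \<in> S" "0 < d" "d < \<delta>1"
  shows iso_atlas: "iso q d \<in> A"
    and iso_metric: "z \<in> \<phi> q ` disk q d \<Longrightarrow> G (iso q d) z = mat (exp (2 * lam q z))"
    and exp_lam_close: "z \<in> \<phi> q ` disk q d \<Longrightarrow> \<bar>exp (lam q z) - 1\<bar> \<le> \<epsilon>"
    and grad_lam_le: "z \<in> \<phi> q ` disk q d \<Longrightarrow> norm (grad (lam q) z) \<le> C0 * d"
proof -
  have "iso q d \<in> A \<and> (\<forall>z\<in>\<phi> q ` disk q d. G (iso q d) z = mat (exp (2 * lam q z)) \<and>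
      \<bar>exp (lam q z) - 1\<bar> \<le> \<epsilon> \<and> norm (grad (lam q) z) \<le> C0 * d)"
  proof -
    have "\<forall>d\<in>{0<..<\<delta>1}. let U = metric_disk S A G q (d / 2) in
        (U, \<phi> q) \<in> A \<and> (\<forall>z\<in>\<phi> q ` U. G (U, \<phi> q) z = mat (exp (2 * lam q z)) \<and>
           \<bar>exp (lam q z) - 1\<bar> \<le> \<epsilon> \<and> norm (grad (lam q) z) \<le> C0 * d)"
      using charts assms(1) unfolding normalized_isothermal_charts_def by blast
    from bspec[OF this, of d] show ?thesis using assms(2,3) by (simp only: Let_def) simp
  qed
  then show "iso q d \<in> A"
    "z \<in> \<phi> q ` disk q d \<Longrightarrow> G (iso q d) z = mat (exp (2 * lam q z))"
    "z \<in> \<phi> q ` disk q d \<Longrightarrow> \<bar>exp (lam q z) - 1\<bar> \<le> \<epsilon>"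
    "z \<in> \<phi> q ` disk q d \<Longrightarrow> norm (grad (lam q) z) \<le> C0 * d" by blast+
qed

lemma center_in_disk: "q \<in> S \<Longrightarrow> 0 < d \<Longrightarrow> q \<in> disk q d"
  by (simp add: metric_disk_center)

lemma disk_mono: "d \<le> d' \<Longrightarrow> disk q d \<subseteq> disk q d'"
  by (auto simp: metric_disk_def)

context
  fixes q d assumes q: "q \<in> S" and d: "0 < d" "d < \<delta>1"
begin

lemma iso_open: "open (\<phi> q ` disk q d)"
  using chart_image_open[OF iso_atlas[OF q d]] by simp

lemma iso_inv: "x \<in> disk q d \<Longrightarrow> inv_into (disk q d) (\<phi> q) (\<phi> q x) = x"
  using chart_inj[OF iso_atlas[OF q d]] by simp

lemma zero_in_iso: "0 \<in> \<phi> q ` disk q d"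
  using center_in_disk[OF q d(1)] phi_center[OF q] by (metis imageI)

lemma lam_has_derivative:
  assumes "z \<in> \<phi> q ` disk q d"
  shows "(lam q has_derivative (\<lambda>v. grad (lam q) z \<bullet> v)) (at z)"
proof -
  obtain G' where "(G (iso q d) has_derivative blinfun_apply (G' z)) (at z)"
    using metric_C1[OF iso_atlas[OF q d]] assms by (metis fst_conv snd_conv)
  from conformal_factor_differentiable(1)[OF iso_open assms iso_metric[OF q d] this] show ?thesis by simp
qed

text \<open>Away from the origin the chart data bound the gradient without giving its continuity;
  this is read off from the C1 coefficients of the metric. It makes the integrand at a corner
  integrable.\<close>

lemma grad_lam_continuous: "continuous_on (\<phi> q ` disk q d) (grad (lam q))"
proof -
  obtain G' where G': "\<And>z. z \<in> \<phi> q ` disk q d \<Longrightarrow> (G (iso q d) has_derivative blinfun_apply (G' z)) (at z)"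
    "continuous_on (\<phi> q ` disk q d) G'"
    using metric_C1[OF iso_atlas[OF q d]] by (metis fst_conv snd_conv)
  have "grad (lam q) z = (\<chi> i. exp (- 2 * lam q z) * G' z (axis i 1) $ 1 $ 1 / 2)" if z: "z \<in> \<phi> q ` disk q d" for z
    by (simp add: grad_def partial_deriv_def vec_eq_iff
        frechet_derivative_at[OF conformal_factor_differentiable(2)[OF iso_open z iso_metric[OF q d] G'(1)[OF z]], symmetric])
  moreover have "continuous_on (\<phi> q ` disk q d) (lam q)"
    using lam_has_derivative by (meson continuous_at_imp_continuous_on has_derivative_continuous)
  then have "continuous_on (\<phi> q ` disk q d) (\<lambda>z. \<chi> i. exp (- 2 * lam q z) * G' z (axis i 1) $ 1 $ 1 / 2)"
    by (intro continuous_intros G'(2)) auto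
  ultimately show ?thesis by (simp cong: continuous_on_cong)
qed

lemma segment_in_disk:
  assumes "closed_segment 0 z \<subseteq> \<phi> q ` disk q d" "(1 + \<epsilon>) * norm z < r"
  shows "inv_into (disk q d) (\<phi> q) z \<in> metric_disk S A G q r"
proof -
  have "gram_norm (G (iso q d) y) (z - 0) \<le> (1 + \<epsilon>) * norm z" if "y \<in> closed_segment 0 z" for y
  proof -
    have y: "y \<in> \<phi> q ` disk q d" using assms that by blast
    have "exp (lam q y) \<le> 1 + \<epsilon>" using exp_lam_close[OF q d y] by linarith
    then show ?thesis by (simp add: iso_metric[OF q d y] gram_norm_conformal mult_right_mono)
  qed
  from segment_metric_disk[OF iso_atlas[OF q d], of 0 z, OF _ this assms(2)] assms(1)
  show ?thesis using iso_inv[OF center_in_disk[OF q d(1)]] by (simp add: q)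
qed

text \<open>Lift the segment \<open>[0, z]\<close> as long as it stays in the image. Its lift has length at most
  \<open>(1 + \<epsilon>) * norm z\<close>, hence accumulates (by compactness of \<open>S\<close>) at a point of the open disk.\<close>

lemma iso_image_ball:
  assumes z: "(1 + \<epsilon>) * norm z < d / 2"
  shows "z \<in> \<phi> q ` disk q d"
proof (rule ccontr)
  assume notin: "z \<notin> \<phi> q ` disk q d"
  \<comment> \<open>The parameters at which the segment is outside the open image. \<open>N\<close>
    is compact, and its least element \<open>s'\<close> is the first exit, positive because the
    origin lies in the image.\<close>
  define N where "N = {0..1} \<inter> (\<lambda>s. s *\<^sub>R z) -` (- \<phi> q ` disk q d)"
  have "closed N" unfolding N_def
    using iso_open by (intro closed_Int closed_vimage) (auto intro!: continuous_intros)
  then have "compact ({0..1} \<inter> N)" by (intro compact_Int_closed) auto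
  moreover have "{0..1} \<inter> N = N" by (auto simp: N_def)
  ultimately have "compact N" by simp
  moreover have "1 \<in> N" using notin by (simp add: N_def)
  ultimately obtain s' where s': "s' \<in> N" "\<And>s. s \<in> N \<Longrightarrow> s' \<le> s" using compact_attains_inf[of N] by auto
  have "s' \<noteq> 0" using s'(1) zero_in_iso by (auto simp: N_def)
  then have s'0: "0 < s'" "s' \<le> 1" using s'(1) by (auto simp: N_def)
  have below: "s *\<^sub>R z \<in> \<phi> q ` disk q d" if "0 \<le> s" "s < s'" for s
    using s'(2)[of s] that s'0 by (auto simp: N_def)
  let ?y = "\<lambda>s. inv_into (disk q d) (\<phi> q) (s *\<^sub>R z)"
  have y: "?y s \<in> disk q d" "\<phi> q (?y s) = s *\<^sub>R z" if "0 \<le> s" "s < s'" for s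
    using below[OF that] by (auto simp: inv_into_into f_inv_into_f)
  have disk_S: "disk q d \<subseteq> S" using chart_subset[OF iso_atlas[OF q d]] by simp
  have ev: "\<forall>\<^sub>F s in at_left s'. 0 \<le> s \<and> s < s'"
    using eventually_at_left_real[OF s'0(1)] by eventually_elim auto
  have "\<forall>\<^sub>F x in filtermap ?y (at_left s'). x \<in> S"
    unfolding eventually_filtermap using ev by eventually_elim (use y disk_S in blast)
  moreover have "filtermap ?y (at_left s') \<noteq> bot" by (simp add: filtermap_bot_iff)
  ultimately obtain w where w: "w \<in> S" "inf (nhds w) (filtermap ?y (at_left s')) \<noteq> bot"
    using compact unfolding compact_filter by blast
  let ?ch = "chart_at A w"
  note ch = chart_at_atlas[OF w(1)]
  let ?a = "snd ?ch w"
  obtain \<rho> where \<rho>: "\<rho> > 0" "cball ?a \<rho> \<subseteq> snd ?ch ` fst ?ch"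
    using chart_image_open[OF ch(1)] ch(2) open_contains_cball by (metis imageI)
  obtain B where B: "0 < B" "\<And>z v. z \<in> cball ?a \<rho> \<Longrightarrow> gram_norm (G ?ch z) v \<le> B * norm v"
    using gram_norm_bounded_on_compact[OF compact_cball continuous_on_subset[OF metric_continuous[OF ch(1)] \<rho>(2)]] by metis
  \<comment> \<open>The slack in the hypothesis. One half turns the length bound for the lift into a
    strict one, the other half pays for the way from a lifted point to the cluster point
    \<open>w\<close>.\<close>
  define gap where "gap = d / 2 - (1 + \<epsilon>) * norm z"
  have gap: "gap > 0" using z by (simp add: gap_def)
  define \<rho>' where "\<rho>' = min \<rho> (gap / 2 / B)"
  have \<rho>': "\<rho>' > 0" "\<rho>' \<le> \<rho>" "B * \<rho>' \<le> gap / 2"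
    using \<rho> gap B by (auto simp: \<rho>'_def min_def field_simps)
  have openin_pre: "openin (top_of_set S) {x \<in> fst c. snd c x \<in> O1}" if "c \<in> A" "open O1" for c and O1 :: "(real^2) set"
  proof -
    have "openin (top_of_set (fst c)) (fst c \<inter> snd c -` O1)"
      using chart_continuous[OF that(1)] that(2) by (simp add: continuous_openin_preimage_gen)
    moreover have "{x \<in> fst c. snd c x \<in> O1} = fst c \<inter> snd c -` O1" by auto
    ultimately show ?thesis using openin_trans[OF _ chart_openin[OF that(1)]] by simp
  qed
  obtain T where T: "open T" "{x \<in> fst ?ch. snd ?ch x \<in> ball ?a \<rho>'} = S \<inter> T"
    using openin_pre[OF ch(1) open_ball] unfolding openin_open by blast
  have "w \<in> {x \<in> fst ?ch. snd ?ch x \<in> ball ?a \<rho>'}" using ch \<rho>' by simp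
  then have "w \<in> T" using T by blast
  obtain s where s: "0 \<le> s" "s < s'" "?y s \<in> T"
    using cluster_point_witness[OF w(2) T(1) \<open>w \<in> T\<close> ev] by blast
  then have ys: "?y s \<in> fst ?ch" "snd ?ch (?y s) \<in> ball ?a \<rho>'"
    using y(1) disk_S T(2) by blast+
  have n: "(1 + \<epsilon>) * norm (s *\<^sub>R z) < (1 + \<epsilon>) * norm z + gap / 2"
  proof -
    have "s * norm z \<le> 1 * norm z" using s s'0 by (intro mult_right_mono) auto
    then have "(1 + \<epsilon>) * (s * norm z) \<le> (1 + \<epsilon>) * norm z" using eps by (intro mult_left_mono) auto
    then show ?thesis using gap s by simp
  qed
  have "closed_segment 0 (s *\<^sub>R z) \<subseteq> \<phi> q ` disk q d"
  proof
    fix x assume "x \<in> closed_segment 0 (s *\<^sub>R z)"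
    then obtain u where u: "0 \<le> u" "u \<le> 1" "x = (u * s) *\<^sub>R z" by (auto simp: in_segment)
    have "u * s \<le> s" using u s by (simp add: mult_left_le_one_le)
    then show "x \<in> \<phi> q ` disk q d" using below[of "u * s"] u s by auto
  qed
  from segment_in_disk[OF this n]
  have 1: "?y s \<in> metric_disk S A G q ((1 + \<epsilon>) * norm z + gap / 2)" .
  have seg: "closed_segment (snd ?ch (?y s)) ?a \<subseteq> cball ?a \<rho>'"
    using ys(2) \<rho>' by (intro closed_segment_subset) auto
  have "w \<in> metric_disk S A G (?y s) (gap / 2)"
  proof -
    have dn: "norm (?a - snd ?ch (?y s)) < \<rho>'" using ys(2) by (simp add: dist_norm)
    have "gram_norm (G ?ch x) (?a - snd ?ch (?y s)) \<le> B * norm (?a - snd ?ch (?y s))"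
      if "x \<in> closed_segment (snd ?ch (?y s)) ?a" for x
      using that seg \<rho>'(2) by (intro B(2)) (auto intro: order_trans)
    moreover have "B * norm (?a - snd ?ch (?y s)) < gap / 2"
      using mult_strict_left_mono[OF dn B(1)] \<rho>'(3) by linarith
    moreover have "closed_segment (snd ?ch (?y s)) ?a \<subseteq> snd ?ch ` fst ?ch"
      using seg \<rho>'(2) \<rho>(2) by (meson subset_cball subset_trans)
    ultimately have "inv_into (fst ?ch) (snd ?ch) ?a \<in>
        metric_disk S A G (inv_into (fst ?ch) (snd ?ch) (snd ?ch (?y s))) (gap / 2)"
      by (intro segment_metric_disk[OF ch(1)])
    then show ?thesis using chart_inj[OF ch(1)] ch(2) ys(1) by simp
  qed
  from metric_disk_triangle[OF 1 this] have wd: "w \<in> disk q d" by (simp add: gap_def)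
  \<comment> \<open>\<open>\<phi> q\<close> is continuous at \<open>w\<close>, now known to lie in
    the disk. Some lifted points near \<open>w\<close> have images \<open>s *\<^sub>R z\<close> near
    the exit point, so the Hausdorff property identifies the two; the exit point then lies in the
    image after all.\<close>
  have "\<phi> q w = s' *\<^sub>R z"
  proof (rule ccontr)
    assume ne: "\<phi> q w \<noteq> s' *\<^sub>R z"
    obtain O1 O2 where O: "open O1" "open O2" "\<phi> q w \<in> O1" "s' *\<^sub>R z \<in> O2" "O1 \<inter> O2 = {}"
      using hausdorff[OF ne] by blast
    obtain T1 where T1: "open T1" "{x \<in> disk q d. \<phi> q x \<in> O1} = S \<inter> T1"
      using openin_pre[OF iso_atlas[OF q d] O(1)] unfolding openin_open by auto
    have "((\<lambda>s. s *\<^sub>R z) \<longlongrightarrow> s' *\<^sub>R z) (at_left s')" by (intro tendsto_intros)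
    then have "\<forall>\<^sub>F s in at_left s'. s *\<^sub>R z \<in> O2" using O by (intro topological_tendstoD)
    with ev have "\<forall>\<^sub>F s in at_left s'. (0 \<le> s \<and> s < s') \<and> s *\<^sub>R z \<in> O2" by eventually_elim simp
    moreover have "w \<in> T1" using T1(2) wd O(3) by blast
    ultimately obtain s where s: "0 \<le> s" "s < s'" "s *\<^sub>R z \<in> O2" "?y s \<in> T1"
      using cluster_point_witness[OF w(2) T1(1)] by blast
    then have "\<phi> q (?y s) \<in> O1" using T1(2) y(1)[of s] disk_S by blast
    then show False using y(2)[of s] s O(5) by auto
  qed
  then show False using s'(1) wd by (simp add: N_def) (metis imageI)
qed

end

section \<open>Geodesics issuing from a vertex\<close>

text \<open>Diameter \<open>3 * a\<close> means radius \<open>3 * a / 2\<close>, enough for an arc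
  of length \<open>a\<close>. There the gradient is at most \<open>3 * C0 * a\<close> and the speed
  at most \<open>2\<close>, so the acceleration is at most
  \<open>3 * (3 * C0 * a) * 4 = 36 * C0 * a\<close>. Each integration contributes one more factor
  \<open>a\<close>.\<close>

lemma geodesic_estimates:
  assumes q: "q \<in> S" and a: "0 < a" "3 * a < \<delta>1" and small: "3 * C0 * a\<^sup>2 \<le> 1/2"
    and geo: "unit_speed_geodesic S A G a \<sigma>" and start: "\<sigma> 0 = q"
  obtains v0 va where "((\<phi> q \<circ> \<sigma>) has_vector_derivative v0) (at 0 within {0..a})"
    "((\<phi> q \<circ> \<sigma>) has_vector_derivative va) (at a within {0..a})"
    "norm v0 = 1" "va \<noteq> 0" "norm (va - v0) \<le> 36 * C0 * a\<^sup>2" "norm (\<phi> q (\<sigma> a) - a *\<^sub>R v0) \<le> 36 * C0 * a ^ 3"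
proof -
  have d: "0 < 3 * a" using a by simp
  note ch = iso_atlas[OF q d a(2)]
  let ?x = "\<phi> q \<circ> \<sigma>"
  have in_disk: "\<sigma> t \<in> disk q (3 * a)" if "t \<in> {0..a}" for t
    using geodesic_metric_disk[OF geo, of t "3 * a / 2"] that a by (simp add: start)
  then have in_img: "?x t \<in> \<phi> q ` disk q (3 * a)" if "t \<in> {0..a}" for t using that by simp
  obtain v where v: "\<And>t. t \<in> {0..a} \<Longrightarrow> (?x has_vector_derivative v t) (at t within {0..a})"
    "\<And>t. t \<in> {0..a} \<Longrightarrow> (v has_vector_derivative - christoffel_form (G (iso q (3 * a))) (?x t) (v t) (v t)) (at t within {0..a})"
    "\<And>t. t \<in> {0..a} \<Longrightarrow> gram_norm (G (iso q (3 * a)) (?x t)) (v t) = 1"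
    using unit_speed_geodesicE[OF geo ch] in_disk by (metis comp_apply fst_conv snd_conv)
  let ?E = "\<lambda>t. exp (lam q (?x t))"
  have nv: "?E t * norm (v t) = 1" if t: "t \<in> {0..a}" for t
    using v(3)[OF t] iso_metric[OF q d a(2) in_img[OF t]] by (simp add: gram_norm_conformal)
  have gle: "norm (grad (lam q) (?x t)) \<le> 3 * C0 * a" if t: "t \<in> {0..a}" for t
    using grad_lam_le[OF q d a(2) in_img[OF t]] by simp
  \<comment> \<open>As \<open>?E t * norm (v t) = 1\<close>, the derivative of \<open>?E\<close> is controlled by the gradient of \<open>lam q\<close> alone.\<close>
  have E': "(?E has_vector_derivative ?E t * (grad (lam q) (?x t) \<bullet> v t)) (at t within {0..a})" if t: "t \<in> {0..a}" for t
  proof -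
    have "((\<lambda>t. lam q (?x t)) has_real_derivative (grad (lam q) (?x t) \<bullet> v t)) (at t within {0..a})"
      using has_derivative_compose[OF v(1)[OF t, unfolded has_vector_derivative_def] lam_has_derivative[OF q d a(2) in_img[OF t]]]
      by (simp add: has_field_derivative_def mult.commute[of _ "grad (lam q) (\<phi> q (\<sigma> t)) \<bullet> v t"])
    then have "(?E has_real_derivative ?E t * (grad (lam q) (?x t) \<bullet> v t)) (at t within {0..a})"
      by (auto intro!: derivative_eq_intros)
    then show ?thesis by (simp add: has_real_derivative_iff_has_vector_derivative)
  qed
  have E'_le: "norm (?E t * (grad (lam q) (?x t) \<bullet> v t)) \<le> 3 * C0 * a" if t: "t \<in> {0..a}" for t
  proof -
    have "norm (?E t * (grad (lam q) (?x t) \<bullet> v t)) \<le> ?E t * (norm (grad (lam q) (?x t)) * norm (v t))"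
      by (simp add: abs_mult Cauchy_Schwarz_ineq2)
    also have "\<dots> = norm (grad (lam q) (?x t)) * (?E t * norm (v t))" by simp
    also have "\<dots> \<le> 3 * C0 * a" using gle[OF t] by (simp only: nv[OF t])
    finally show ?thesis .
  qed
  \<comment> \<open>As \<open>\<epsilon>\<close> may exceed \<open>1\<close>, it gives no lower
    bound for the conformal factor. The bound \<open>1/2\<close> comes from the slow variation of
    \<open>?E\<close>, which equals \<open>1\<close> at the vertex.\<close>
  have v2: "norm (v t) \<le> 2" if t: "t \<in> {0..a}" for t
  proof -
    have "norm (?E t - ?E 0) \<le> 3 * C0 * a * t" by (rule norm_change_le[OF E' E'_le t])
    also have "\<dots> \<le> 3 * C0 * a * a" using t a C0 by (intro mult_left_mono) auto
    finally have "\<bar>?E t - 1\<bar> \<le> 1/2" using small by (simp add: start q power2_eq_square)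
    then have "1/2 \<le> ?E t" by linarith
    then have "1/2 * norm (v t) \<le> 1" using mult_right_mono[of "1/2" "?E t" "norm (v t)"] nv[OF t] by simp
    then show ?thesis by simp
  qed
  have chr: "norm (- christoffel_form (G (iso q (3 * a))) (?x t) (v t) (v t)) \<le> 36 * C0 * a" if t: "t \<in> {0..a}" for t
  proof -
    obtain D where D: "(G (iso q (3 * a)) has_derivative D) (at (?x t))"
      using metric_C1[OF ch] in_img[OF t] by (metis fst_conv snd_conv)
    let ?g = "grad (lam q) (?x t)" and ?w = "v t"
    have "christoffel_form (G (iso q (3 * a))) (?x t) ?w ?w = (2 * (?g \<bullet> ?w)) *\<^sub>R ?w - (?w \<bullet> ?w) *\<^sub>R ?g"
      using conformal_christoffel[OF iso_open[OF q d a(2)] in_img[OF t] iso_metric[OF q d a(2)] D, of ?w ?w]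
      by (simp add: scaleR_2[symmetric] del: scaleR_2)
    also have "norm \<dots> \<le> 2 * \<bar>?g \<bullet> ?w\<bar> * norm ?w + norm ?w * norm ?w * norm ?g"
      by (rule order_trans[OF norm_triangle_ineq4]) (simp add: abs_mult dot_square_norm power2_eq_square)
    also have "\<dots> \<le> 2 * (norm ?g * norm ?w) * norm ?w + norm ?w * norm ?w * norm ?g"
      by (intro add_mono mult_mono Cauchy_Schwarz_ineq2 order_refl mult_nonneg_nonneg) auto
    also have "\<dots> = 3 * norm ?g * (norm ?w * norm ?w)" by simp
    also have "\<dots> \<le> 3 * (3 * C0 * a) * (2 * 2)"
      using gle[OF t] v2[OF t] C0 a by (intro mult_mono) auto
    finally show ?thesis by simp
  qed
  have vt: "norm (v t - v 0) \<le> 36 * C0 * a\<^sup>2" if t: "t \<in> {0..a}" for t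
  proof -
    have "norm (v t - v 0) \<le> 36 * C0 * a * t" by (rule norm_change_le[OF v(2) chr t])
    also have "\<dots> \<le> 36 * C0 * a * a" using t a C0 by (intro mult_left_mono) auto
    finally show ?thesis by (simp add: power2_eq_square)
  qed
  \<comment> \<open>Comparison with the straight motion of velocity \<open>v 0\<close>; the
    difference has the derivative \<open>v t - v 0\<close>, just estimated.\<close>
  have "norm ((?x a - a *\<^sub>R v 0) - (?x 0 - 0 *\<^sub>R v 0)) \<le> 36 * C0 * a\<^sup>2 * a"
  proof (rule norm_change_le[where f' = "\<lambda>t. v t - v 0"])
    fix t assume t: "t \<in> {0..a}"
    show "((\<lambda>t. ?x t - t *\<^sub>R v 0) has_vector_derivative v t - v 0) (at t within {0..a})"
      by (auto intro!: derivative_eq_intros v(1)[OF t, unfolded o_def])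
    show "norm (v t - v 0) \<le> 36 * C0 * a\<^sup>2" by (rule vt[OF t])
  qed (use a in auto)
  then have xa: "norm (\<phi> q (\<sigma> a) - a *\<^sub>R v 0) \<le> 36 * C0 * a ^ 3"
    by (simp add: start q power2_eq_square power3_eq_cube)
  show thesis
  proof (rule that[of "v 0" "v a"])
    show "norm (v 0) = 1" using nv[of 0] a by (simp add: start q)
    show "v a \<noteq> 0" using nv[of a] a by auto
  qed (use v(1)[of 0] v(1)[of a] vt[of a] xa a in auto)
qed

text \<open>At the vertex \<open>lam\<close> vanishes, so the isothermal Gram matrix is the identity
  and angles are Euclidean. The minus sign appears because \<open>u1\<close> is the velocity of the
  reversed incoming arc.\<close>

lemma turning_angle_eq:
  assumes d: "0 < d" "d < \<delta>1" and q: "vertex L \<gamma> i = q" "\<gamma> (Suc i) 0 = q"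
    and L: "0 < L i" "0 < L (Suc i)"
    and geo: "unit_speed_geodesic S A G (L i) (\<gamma> i)" "unit_speed_geodesic S A G (L (Suc i)) (\<gamma> (Suc i))"
    and a: "0 < a" "a \<le> L i" "a \<le> L (Suc i)"
    and u1: "((\<phi> q \<circ> (\<lambda>t. \<gamma> i (L i - t))) has_vector_derivative u1) (at 0 within {0..a})" "norm u1 = 1"
    and u2: "((\<phi> q \<circ> \<gamma> (Suc i)) has_vector_derivative u2) (at 0 within {0..a})" "norm u2 = 1"
  shows "turning_angle A G L \<gamma> i = arccos (- (u1 \<bullet> u2))"
proof -
  have q': "\<gamma> i (L i) = q" using q(1) by (simp add: vertex_def)
  have qS: "q \<in> S" using geo(1) L q' by (auto simp: unit_speed_geodesic_def)
  let ?ch = "chart_at A q" and ?e = "iso q d"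
  note ca = chart_at_atlas[OF qS] and e = iso_atlas[OF qS d]
  have qe: "q \<in> fst ?e" using center_in_disk[OF qS d(1)] by simp
  \<comment> \<open>One-sided derivatives are unique only at a limit point of the interval;
    uniqueness identifies \<open>u1\<close> and \<open>u2\<close> with the velocities of the
    unrestricted arcs.\<close>
  have nontriv: "at 0 within {0..a} \<noteq> bot"
    using a by (simp add: trivial_limit_within islimpt_Icc)
  obtain v1 where v1: "((\<phi> q \<circ> \<gamma> i) has_vector_derivative v1) (at (L i) within {0..L i})"
    using unit_speed_geodesicE[OF geo(1) e] L qe q' by (metis atLeastAtMost_iff less_imp_le order_refl snd_conv)
  have "((\<phi> q \<circ> (\<lambda>t. \<gamma> i (L i - t))) has_vector_derivative - v1) (at 0 within {0..L i})"
    using has_vector_derivative_reflect[of "\<phi> q \<circ> \<gamma> i" v1 "L i" 0] v1 by (simp add: o_def)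
  then have "((\<phi> q \<circ> (\<lambda>t. \<gamma> i (L i - t))) has_vector_derivative - v1) (at 0 within {0..a})"
    by (rule has_vector_derivative_within_subset) (use a in auto)
  from vector_derivative_unique_within[OF nontriv u1(1) this] have u1v: "v1 = - u1" by simp
  obtain v2 where v2: "((\<phi> q \<circ> \<gamma> (Suc i)) has_vector_derivative v2) (at 0 within {0..L (Suc i)})"
    using unit_speed_geodesicE[OF geo(2) e] L qe q(2) by (metis atLeastAtMost_iff less_imp_le order_refl snd_conv)
  have "((\<phi> q \<circ> \<gamma> (Suc i)) has_vector_derivative v2) (at 0 within {0..a})"
    by (rule has_vector_derivative_within_subset[OF v2]) (use a in auto)
  from vector_derivative_unique_within[OF nontriv u2(1) this] have u2v: "v2 = u2" by simp
  obtain P :: "real^2 \<Rightarrow> (real^2) \<Rightarrow>\<^sub>L (real^2)" where P: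
    "\<And>x v t N. x t \<in> fst ?e \<Longrightarrow> x t \<in> fst ?ch \<Longrightarrow> ((snd ?e \<circ> x) has_vector_derivative v) (at t within N) \<Longrightarrow> t \<in> N \<Longrightarrow>
       \<forall>\<^sub>F r in at t within N. x r \<in> fst ?e \<inter> fst ?ch \<Longrightarrow>
       ((snd ?ch \<circ> x) has_vector_derivative P (snd ?e (x t)) v) (at t within N)"
    "\<And>x v w. x \<in> fst ?e \<Longrightarrow> x \<in> fst ?ch \<Longrightarrow>
       P (snd ?e x) v \<bullet> (G ?ch (snd ?ch x) *v P (snd ?e x) w) = v \<bullet> (G ?e (snd ?e x) *v w)"
    using velocity_chart[OF e ca(1)] by metis
  have change: "vector_derivative (snd ?ch \<circ> x) (at t within {0..l}) = P (snd ?e q) v"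
    if g: "unit_speed_geodesic S A G l x" and t: "t \<in> {0..l}" "x t = q" "0 < l"
      and v: "((\<phi> q \<circ> x) has_vector_derivative v) (at t within {0..l})" for x l t v
  proof -
    have c: "(x \<longlongrightarrow> x t) (at t within {0..l})" and S: "x ` {0..l} \<subseteq> S"
      using g t by (auto simp: unit_speed_geodesic_def continuous_on_def)
    have "\<forall>\<^sub>F r in at t within {0..l}. r \<in> {0..l}" by (simp add: eventually_at_filter)
    then have xS: "\<forall>\<^sub>F r in at t within {0..l}. x r \<in> S" by eventually_elim (use S in auto)
    have ev: "\<forall>\<^sub>F r in at t within {0..l}. x r \<in> fst ?e \<inter> fst ?ch"
      using eventually_in_chart[OF e _ c xS] eventually_in_chart[OF ca(1) _ c xS] qe ca(2) t(2)
      by (simp add: eventually_conj_iff)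
    have "((snd ?ch \<circ> x) has_vector_derivative P (snd ?e (x t)) v) (at t within {0..l})"
      using qe ca(2) v t ev by (intro P(1)) auto
    then show ?thesis
      using t by (intro vector_derivative_within_cbox[of 0 l, simplified]) auto
  qed
  have "G ?e (snd ?e q) = mat (exp (2 * lam q (\<phi> q q)))"
    using iso_metric[OF qS d] qe by simp
  then have Ge: "G ?e (snd ?e q) = mat 1" using qS by simp
  have inner: "P (snd ?e q) v \<bullet> (G ?ch (snd ?ch q) *v P (snd ?e q) w) = v \<bullet> w" for v w
    unfolding P(2)[OF qe ca(2)] Ge by simp
  have "turning_angle A G L \<gamma> i = gram_angle (G ?ch (snd ?ch q)) (P (snd ?e q) v1) (P (snd ?e q) v2)"
    unfolding turning_angle_def Let_def q(1)
    using change[OF geo(1) _ q' L(1) v1] change[OF geo(2) _ q(2) L(2) v2] L by simp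
  also have "\<dots> = arccos (- (u1 \<bullet> u2))"
    by (simp add: gram_angle_def gram_norm_def inner[simplified] u1v u2v norm_eq_sqrt_inner[symmetric] u1 u2)
  finally show ?thesis .
qed

end

section \<open>Rounding a corner\<close>

lemma inner_rot [simp]: "v \<bullet> rot v = 0" "rot v \<bullet> v = 0"
  by (simp_all add: inner_vec2)

lemma rot_linear: "rot (v + w) = rot v + rot w" "rot (c *\<^sub>R v) = c *\<^sub>R rot v" "rot (- v) = - rot v" "rot (rot v) = - v"
  by (simp_all add: vec_eq_iff forall_2)

lemma unit_vec2: "norm v = 1 \<longleftrightarrow> (v $ 1)\<^sup>2 + (v $ 2)\<^sup>2 = 1" for v :: "real^2"
  by (simp add: norm_eq_sqrt_inner inner_vec2 power2_eq_square)

lemma cross_squared: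
  assumes "norm v = 1" "norm w = 1" shows "(rot v \<bullet> w)\<^sup>2 = 1 - (v \<bullet> w)\<^sup>2"
  using assms unfolding unit_vec2 inner_vec2 rot_simps by algebra

lemma norm_orthonormal_combination:
  assumes "norm v = 1" "a\<^sup>2 + b\<^sup>2 = 1" shows "norm (a *\<^sub>R v + b *\<^sub>R rot v) = 1"
  using assms unfolding unit_vec2 by simp algebra

lemma le_tan: assumes "0 \<le> x" "x < pi / 2" shows "x \<le> tan x"
proof -
  have c: "cos x > 0" using assms by (intro cos_gt_zero_pi) auto
  have "sin 0 - 0 * cos 0 \<le> sin x - x * cos x"
  proof (rule DERIV_nonneg_imp_nondecreasing[OF assms(1)])
    fix t assume t: "0 \<le> t" "t \<le> x"
    have "((\<lambda>t. sin t - t * cos t) has_real_derivative t * sin t) (at t)"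
      by (auto intro!: derivative_eq_intros)
    moreover have "0 \<le> t * sin t" using t assms by (intro mult_nonneg_nonneg sin_ge_zero) auto
    ultimately show "\<exists>y. ((\<lambda>t. sin t - t * cos t) has_real_derivative y) (at t) \<and> 0 \<le> y" by blast
  qed
  then show ?thesis using c by (simp add: tan_def field_simps)
qed

lemma has_vector_derivative_If_le:
  fixes f g :: "real \<Rightarrow> 'b::real_normed_vector"
  assumes "\<And>s. (f has_vector_derivative f' s) (at s)" "\<And>s. (g has_vector_derivative g' s) (at s)"
    and "f p = g p" "f' p = g' p"
  shows "((\<lambda>s. if s \<le> p then f s else g s) has_vector_derivative (if s \<le> p then f' s else g' s)) (at s)"
proof -
  have "((\<lambda>s. if s \<in> {..p} then f s else g s) has_vector_derivative (if s \<in> {..p} then f' s else g' s)) (at s within UNIV)"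
  proof (rule has_vector_derivative_If_within_closures[where T = "{p<..}"])
    have cl: "closure {p<..} = {p..}" by simp
    have pp: "x = p" if "x \<in> closure {..p}" "x \<in> closure {p<..}" for x
      using that unfolding cl by simp
    show "f s = g s" "f' s = g' s" if "s \<in> closure {..p}" "s \<in> closure {p<..}"
      using pp[OF that] assms by auto
  qed (use assms in \<open>auto intro: has_vector_derivative_at_within\<close>)
  then show ?thesis by simp
qed

section \<open>The rounded corner between two transversal lines\<close>

text \<open>\<open>w1\<close> and \<open>w2\<close> point from the two ends towards
  \<open>Q\<close>, so the rounding leaves in direction \<open>- w2\<close>. Transversality makes
  \<open>Q\<close> unique and keeps the angle strictly between \<open>0\<close> and
  \<open>pi\<close>, away from the straight case of \<open>rounding\<close>.\<close>

locale corner =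
  fixes r1 r2 :: ray and w1 w2 Q :: "real^2" and ell1 ell2 :: real
  assumes dirs: "snd r1 \<noteq> 0" "snd r2 \<noteq> 0"
    and w1_def: "w1 = - sgn (snd r1)" and w2_def: "w2 = - sgn (snd r2)"
    and Q1: "Q = fst r1 + ell1 *\<^sub>R w1" and Q2: "Q = fst r2 + ell2 *\<^sub>R w2"
    and pos: "0 < ell1" "0 < ell2" and transversal: "rot w1 \<bullet> w2 \<noteq> 0"
begin

abbreviation "\<theta> \<equiv> rounding_angle r1 r2"
abbreviation "R \<equiv> rounding_radius r1 r2"
abbreviation "m \<equiv> min ell1 ell2"

definition "\<tau> = sgn (rot w1 \<bullet> (- w2))"
definition "p1 = ell1 - m"
definition "p2 = p1 + R * \<theta>"

lemma unit: "norm w1 = 1" "norm w2 = 1"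
  using dirs by (auto simp: w1_def w2_def norm_sgn)

lemma corner_point_eq: "corner_point r1 r2 = Q"
  unfolding corner_point_def
proof (rule the_equality)
  define t1 t2 where "t1 = norm (snd r1)" and "t2 = norm (snd r2)"
  have t: "t1 > 0" "t2 > 0" using dirs by (auto simp: t1_def t2_def)
  have s1: "snd r1 = - t1 *\<^sub>R w1" "snd r2 = - t2 *\<^sub>R w2"
    using t by (simp_all add: w1_def w2_def sgn_div_norm t1_def t2_def)
  have "Q = fst r1 + (- ell1 / t1) *\<^sub>R snd r1" "Q = fst r2 + (- ell2 / t2) *\<^sub>R snd r2"
    using Q1 Q2 t unfolding s1 by simp_all
  then show "(\<exists>s. Q = fst r1 + s *\<^sub>R snd r1) \<and> (\<exists>t. Q = fst r2 + t *\<^sub>R snd r2)" by blast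
  fix Q' assume "(\<exists>s. Q' = fst r1 + s *\<^sub>R snd r1) \<and> (\<exists>t. Q' = fst r2 + t *\<^sub>R snd r2)"
  then obtain s t where e: "Q' = fst r1 + s *\<^sub>R snd r1" "Q' = fst r2 + t *\<^sub>R snd r2" by blast
  have "Q' - Q = (fst r1 + s *\<^sub>R snd r1) - (fst r1 + ell1 *\<^sub>R w1)" using e(1) Q1 by metis
  then have "Q' - Q = (- (s * t1) - ell1) *\<^sub>R w1" unfolding s1 by (simp add: algebra_simps)
  moreover have "Q' - Q = (fst r2 + t *\<^sub>R snd r2) - (fst r2 + ell2 *\<^sub>R w2)" using e(2) Q2 by metis
  then have "Q' - Q = (- (t * t2) - ell2) *\<^sub>R w2" unfolding s1 by (simp add: algebra_simps)
  ultimately obtain a b where ab: "Q' - Q = a *\<^sub>R w1" "Q' - Q = b *\<^sub>R w2" by blast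
  \<comment> \<open>The displacement is a multiple of both directions; pairing with
    \<open>rot w1\<close> shows that its coefficient along the transversal \<open>w2\<close> is
    zero.\<close>
  have "rot w1 \<bullet> (Q' - Q) = 0" using ab(1) by simp
  then have "b = 0" using ab(2) transversal by simp
  then show "Q' = Q" using ab by simp
qed

lemma dist_corner: "dist Q (fst r1) = ell1" "dist Q (fst r2) = ell2"
proof -
  show "dist Q (fst r1) = ell1" by (subst Q1) (use pos unit in \<open>simp add: dist_norm\<close>)
  show "dist Q (fst r2) = ell2" by (subst Q2) (use pos unit in \<open>simp add: dist_norm\<close>)
qed

lemma tangent_length_eq: "tangent_length r1 r2 = m"
  by (simp add: tangent_length_def corner_point_eq dist_corner)

lemma inner_abs_less: "\<bar>w1 \<bullet> w2\<bar> < 1"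
proof -
  have "(rot w1 \<bullet> w2)\<^sup>2 > 0" using transversal by simp
  then have "(w1 \<bullet> w2)\<^sup>2 < 1" using cross_squared[OF unit] by simp
  then show ?thesis by (simp add: abs_square_less_1)
qed

lemma ray_angle_eq: "ray_angle r1 r2 = arccos (w1 \<bullet> w2)"
  using dirs by (simp add: ray_angle_def gram_angle_def gram_norm_def norm_eq_sqrt_inner[symmetric]
      w1_def w2_def sgn_div_norm field_simps)

lemma rounding_angle_eq: "\<theta> = arccos (- (w1 \<bullet> w2))"
  using inner_abs_less by (simp add: rounding_angle_def ray_angle_eq arccos_minus abs_less_iff)

lemma angle_range: "0 < \<theta>" "\<theta> < pi" and ray_angle_ne: "ray_angle r1 r2 \<noteq> pi"
proof -
  have "-1 < - (w1 \<bullet> w2)" "- (w1 \<bullet> w2) < 1" using inner_abs_less by (simp_all add: abs_less_iff)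
  from arccos_lt_bounded[OF this] show "0 < \<theta>" "\<theta> < pi" by (simp_all add: rounding_angle_eq)
  then show "ray_angle r1 r2 \<noteq> pi" by (simp add: rounding_angle_def)
qed

lemma cos_angle: "cos \<theta> = - (w1 \<bullet> w2)"
  using inner_abs_less by (simp add: rounding_angle_eq cos_arccos_abs)

lemma tau_abs: "\<bar>\<tau>\<bar> = 1" "\<tau>\<^sup>2 = 1"
  using transversal by (auto simp: \<tau>_def sgn_if)

text \<open>The angle lies in \<open>(0, pi)\<close> and has positive sine, so the orientation of
  the turn is carried by \<open>\<tau>\<close> alone.\<close>

lemma sin_angle: "\<tau> * sin \<theta> = rot w1 \<bullet> (- w2)"
proof -
  have "(sin \<theta>)\<^sup>2 = (rot w1 \<bullet> w2)\<^sup>2"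
    using cross_squared[OF unit] by (simp add: sin_squared_eq cos_angle)
  then have "sin \<theta> = \<bar>rot w1 \<bullet> w2\<bar>"
    using angle_range by (metis abs_of_nonneg less_imp_le power2_eq_iff_nonneg abs_ge_zero power2_abs sin_ge_zero)
  then show ?thesis by (simp add: \<tau>_def sgn_mult_abs)
qed

lemma direction_out: "- w2 = cos \<theta> *\<^sub>R w1 + (\<tau> * sin \<theta>) *\<^sub>R rot w1"
proof -
  have "cos \<theta> = (- w2) \<bullet> w1" "\<tau> * sin \<theta> = (- w2) \<bullet> rot w1"
    by (simp_all add: cos_angle sin_angle inner_commute)
  with orthonormal_expansion[OF unit(1), of "- w2"] show ?thesis by (simp only:)
qed

lemma m_pos: "0 < m" using pos by simp

lemma tan_pos: "0 < tan (\<theta> / 2)"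
  using angle_range by (intro tan_gt_zero) auto

lemma R_eq: "R = m / tan (\<theta> / 2)"
  by (simp add: rounding_radius_def tangent_length_eq)

lemma R_pos: "0 < R" using m_pos tan_pos by (simp add: R_eq)

lemma m_eq: "m = R * tan (\<theta> / 2)" using tan_pos by (simp add: R_eq)

text \<open>The half-angle formula for \<open>m = R * tan (\<theta> / 2)\<close>. These two
  identities make an arc that starts at distance \<open>m\<close> before \<open>Q\<close> end on the
  other line at distance \<open>m\<close> from \<open>Q\<close>.\<close>

lemma arc_chord: "R * sin \<theta> = m * (1 + cos \<theta>)" "R * (1 - cos \<theta>) = m * sin \<theta>"
proof -
  have c: "1 + cos \<theta> > 0" using inner_abs_less by (simp add: cos_angle abs_less_iff)
  have t: "tan (\<theta> / 2) = sin \<theta> / (cos \<theta> + 1)" using tan_half[of "\<theta> / 2"] by simp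
  show 1: "R * sin \<theta> = m * (1 + cos \<theta>)" using c by (simp add: m_eq t field_simps)
  have "(1 + cos \<theta>) * (R * (1 - cos \<theta>)) = R * (1 - (cos \<theta>)\<^sup>2)" by algebra
  also have "\<dots> = R * (sin \<theta>)\<^sup>2" by (simp add: sin_squared_eq)
  also have "\<dots> = (1 + cos \<theta>) * (m * sin \<theta>)" using 1 by (simp add: power2_eq_square)
  finally show "R * (1 - cos \<theta>) = m * sin \<theta>" using c by simp
qed

lemma p_order: "0 \<le> p1" "p1 < p2"
  using R_pos angle_range by (auto simp: p1_def p2_def)

lemma length_eq: "rounding_length r1 r2 = p2 + (ell2 - m)"
  using ray_angle_ne by (simp add: rounding_length_def corner_point_eq dist_corner p2_def p1_def min_def)

lemma p2_le_length: "p2 \<le> rounding_length r1 r2"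
  by (simp add: length_eq)

section \<open>Arc length parameterization and curvature of the rounded corner\<close>

definition "c1 s = fst r1 + s *\<^sub>R w1"
definition "c2 s = (Q - m *\<^sub>R w1) + (R * sin ((s - p1) / R)) *\<^sub>R w1 + (\<tau> * R * (1 - cos ((s - p1) / R))) *\<^sub>R rot w1"
definition "c3 s = (Q - m *\<^sub>R w2) + (s - p2) *\<^sub>R (- w2)"
definition "T2 s = cos ((s - p1) / R) *\<^sub>R w1 + (\<tau> * sin ((s - p1) / R)) *\<^sub>R rot w1"
definition "T s = (if s \<le> p1 then w1 else if s \<le> p2 then T2 s else - w2)"
definition "\<kappa> s = (if s \<le> p1 then 0 else if s \<le> p2 then \<tau> / R else 0)"

lemma rounding_eq: "rounding r1 r2 = (\<lambda>s. if s \<le> p1 then c1 s else if s \<le> p2 then c2 s else c3 s)"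
  using ray_angle_ne
  by (simp add: rounding_def[abs_def] corner_point_eq tangent_length_eq dist_corner Let_def
      c1_def[abs_def] c2_def[abs_def] c3_def[abs_def] p1_def p2_def w1_def[symmetric] w2_def[symmetric] \<tau>_def
      diff_diff_eq fun_eq_iff)

lemma c_derivs:
  "(c1 has_vector_derivative w1) (at s)" "(c2 has_vector_derivative T2 s) (at s)"
  "(c3 has_vector_derivative - w2) (at s)" "(T2 has_vector_derivative (\<tau> / R) *\<^sub>R rot (T2 s)) (at s)"
proof -
  have R0: "R \<noteq> 0" using R_pos by simp
  show "(c1 has_vector_derivative w1) (at s)" "(c3 has_vector_derivative - w2) (at s)"
    unfolding c1_def[abs_def] c3_def[abs_def] by (auto intro!: derivative_eq_intros)
  have sc: "((\<lambda>s. sin ((s - p1) / R)) has_real_derivative cos ((s - p1) / R) / R) (at s)"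
    "((\<lambda>s. cos ((s - p1) / R)) has_real_derivative - sin ((s - p1) / R) / R) (at s)"
    using R_pos by (auto intro!: derivative_eq_intros)
  show "(c2 has_vector_derivative T2 s) (at s)"
    unfolding c2_def[abs_def] T2_def
    by (auto intro!: derivative_eq_intros sc simp: R0)
  show "(T2 has_vector_derivative (\<tau> / R) *\<^sub>R rot (T2 s)) (at s)"
    unfolding T2_def[abs_def]
    by (rule has_vector_derivative_eq_rhs)
      (auto intro!: derivative_eq_intros sc simp: rot_linear scaleR_add_right tau_abs[unfolded power2_eq_square] R0 algebra_simps)
qed

lemma joints: "c1 p1 = c2 p1" "w1 = T2 p1" "c2 p2 = c3 p2" "T2 p2 = - w2"
proof -
  have e: "(p2 - p1) / R = \<theta>" using R_pos by (simp add: p2_def)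
  show "c1 p1 = c2 p1" "w1 = T2 p1" unfolding c1_def c2_def T2_def p1_def by (simp_all add: Q1 algebra_simps)
  show T2p: "T2 p2 = - w2" unfolding T2_def e direction_out ..
  have "c2 p2 = Q + (R * sin \<theta> - m) *\<^sub>R w1 + (\<tau> * (R * (1 - cos \<theta>))) *\<^sub>R rot w1"
    unfolding c2_def e by (simp add: algebra_simps)
  also have "\<dots> = Q + m *\<^sub>R (cos \<theta> *\<^sub>R w1 + (\<tau> * sin \<theta>) *\<^sub>R rot w1)"
    unfolding arc_chord by (simp add: algebra_simps)
  also have "\<dots> = c3 p2" by (simp add: direction_out[symmetric] c3_def)
  finally show "c2 p2 = c3 p2" .
qed

lemma rounding_derivative: "(rounding r1 r2 has_vector_derivative T s) (at s)"
proof -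
  have inner: "((\<lambda>s. if s \<le> p2 then c2 s else c3 s) has_vector_derivative (if s \<le> p2 then T2 s else - w2)) (at s)" for s
    using joints by (intro has_vector_derivative_If_le c_derivs) auto
  show ?thesis
    unfolding rounding_eq T_def using joints p_order
    by (intro has_vector_derivative_If_le[where g' = "\<lambda>s. if s \<le> p2 then T2 s else - w2"] c_derivs inner) auto
qed

lemma norm_T: "norm (T s) = 1"
  using unit by (auto simp: T_def T2_def tau_abs power_mult_distrib intro!: norm_orthonormal_combination)

lemma T_continuous: "continuous_on X T"
proof -
  have T2: "continuous_on X T2" for X
    using c_derivs(4) by (meson continuous_at_imp_continuous_on has_vector_derivative_continuous)
  have inner: "continuous_on X (\<lambda>s. if s \<le> p2 then T2 s else - w2)" for X
    using joints by (intro continuous_on_cases_le[where h = id, simplified] T2 continuous_intros) auto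
  show ?thesis unfolding T_def[abs_def]
    using joints p_order by (intro continuous_on_cases_le[where h = id, simplified] inner continuous_intros) auto
qed

text \<open>The curvature jumps where a segment meets the arc. Excluding these two parameters costs
  nothing, as only integrals of the curvature are used.\<close>

lemma T_derivative:
  assumes "s \<noteq> p1" "s \<noteq> p2"
  shows "(T has_vector_derivative \<kappa> s *\<^sub>R rot (T s)) (at s)"
proof -
  consider "s < p1" | "p1 < s" "s < p2" | "p2 < s" using assms by linarith
  then show ?thesis
  proof cases
    case 1
    have "\<forall>\<^sub>F r in nhds s. r \<in> {..<p1}" using 1 by (intro eventually_nhds_in_open) auto
    then have "\<forall>\<^sub>F r in nhds s. w1 = T r" by eventually_elim (simp add: T_def)
    from has_vector_derivative_eventually[OF has_vector_derivative_const this] show ?thesis using 1 by (simp add: \<kappa>_def)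
  next
    case 2
    have "\<forall>\<^sub>F r in nhds s. r \<in> {p1<..<p2}" using 2 by (intro eventually_nhds_in_open) auto
    then have "\<forall>\<^sub>F r in nhds s. T2 r = T r" by eventually_elim (simp add: T_def)
    from has_vector_derivative_eventually[OF c_derivs(4) this] 
    have "(T has_vector_derivative (\<tau> / R) *\<^sub>R rot (T2 s)) (at s)" .
    moreover have "T2 s = T s" "\<tau> / R = \<kappa> s" using 2 by (simp_all add: T_def \<kappa>_def)
    ultimately show ?thesis by (simp only:)
  next
    case 3
    have "\<forall>\<^sub>F r in nhds s. r \<in> {p2<..}" using 3 by (intro eventually_nhds_in_open) auto
    then have "\<forall>\<^sub>F r in nhds s. - w2 = T r" by eventually_elim (use p_order in \<open>simp add: T_def\<close>)
    from has_vector_derivative_eventually[OF has_vector_derivative_const this] show ?thesis using 3 p_order by (simp add: \<kappa>_def)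
  qed
qed

abbreviation "len \<equiv> rounding_length r1 r2"

lemma len_pos: "0 < len" using p_order p2_le_length by linarith

lemma plane_tangent_eq: "s \<in> {0..len} \<Longrightarrow> plane_tangent len (rounding r1 r2) s = T s"
  unfolding plane_tangent_def
  using len_pos by (intro vector_derivative_within_cbox[of 0 len, simplified] has_vector_derivative_at_within[OF rounding_derivative]) auto

lemma plane_curvature_eq:
  assumes s: "s \<in> {0..len}" "s \<noteq> p1" "s \<noteq> p2"
  shows "plane_curvature len (rounding r1 r2) s = \<kappa> s"
proof -
  have "(plane_tangent len (rounding r1 r2) has_vector_derivative \<kappa> s *\<^sub>R rot (T s)) (at s within {0..len})"
    by (rule has_vector_derivative_transform[OF s(1) plane_tangent_eq has_vector_derivative_at_within[OF T_derivative[OF s(2,3)]]])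
  then have "vector_derivative (plane_tangent len (rounding r1 r2)) (at s within {0..len}) = \<kappa> s *\<^sub>R rot (T s)"
    using len_pos s by (intro vector_derivative_within_cbox[of 0 len, simplified]) auto
  then show ?thesis
    by (simp add: plane_curvature_def plane_normal_def plane_tangent_eq[OF s(1)] dot_square_norm norm_T)
qed

lemma conormal_deriv_eq:
  "s \<in> {0..len} \<Longrightarrow> conormal_deriv len (rounding r1 r2) f s = grad f (rounding r1 r2 s) \<bullet> (- rot (T s))"
  by (simp add: conormal_deriv_def plane_normal_def plane_tangent_eq)

text \<open>Only the arc contributes: its curvature is \<open>1 / R\<close> in absolute value, over
  the length \<open>R * \<theta>\<close>.\<close>

lemma curvature_integral:
  "((\<lambda>s. \<bar>plane_curvature len (rounding r1 r2) s\<bar> powr p) has_integral R powr (1 - p) * \<theta>) {0..len}"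
proof (rule has_integral_spike_finite[where S = "{p1, p2}"])
  let ?k = "\<lambda>s. if s \<in> {p1..p2} then R powr (- p) else 0"
  show "\<bar>plane_curvature len (rounding r1 r2) s\<bar> powr p = ?k s" if "s \<in> {0..len} - {p1, p2}" for s
    using that p_order R_pos tau_abs by (auto simp: plane_curvature_eq \<kappa>_def abs_divide powr_minus powr_divide divide_simps)
  have "((\<lambda>s. R powr (- p)) has_integral (R powr (- p) * (p2 - p1))) {p1..p2}"
    using has_integral_const_real[of "R powr (- p)" p1 p2] p_order by (simp add: mult.commute)
  moreover have "R powr (- p) * (p2 - p1) = R powr (1 - p) * \<theta>"
    using R_pos by (simp add: p2_def powr_diff powr_minus field_simps)
  ultimately have "((\<lambda>s. R powr (- p)) has_integral R powr (1 - p) * \<theta>) {p1..p2}" by simp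
  then show "(?k has_integral R powr (1 - p) * \<theta>) {0..len}"
    using p_order p2_le_length by (subst has_integral_restrict) auto
qed auto

text \<open>The inequality \<open>x \<le> tan x\<close> at half the angle; it is the source of the
  arc length estimate in the theorem.\<close>

lemma arc_length_le: "R * \<theta> \<le> 2 * m"
proof -
  have "R * (\<theta> / 2) \<le> R * tan (\<theta> / 2)"
    using R_pos angle_range by (intro mult_left_mono le_tan) auto
  then show ?thesis unfolding m_eq[symmetric] by linarith
qed

lemma rounding_norm_le:
  assumes s: "s \<in> {0..len}" shows "norm (rounding r1 r2 s) \<le> norm (fst r1) + len"
proof -
  have "norm (rounding r1 r2 s - rounding r1 r2 0) \<le> 1 * s"
    by (rule norm_change_le[OF has_vector_derivative_at_within[OF rounding_derivative] _ s]) (simp add: norm_T)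
  moreover have "rounding r1 r2 0 = fst r1" using p_order by (simp add: rounding_eq c1_def)
  ultimately show ?thesis using s norm_triangle_sub[of "rounding r1 r2 s" "fst r1"] by auto
qed

lemma len_le: "len \<le> \<bar>ell1 - ell2\<bar> + 2 * m"
  using arc_length_le unfolding length_eq p2_def p1_def by linarith

end

section \<open>Stability of a corner under perturbation\<close>

text \<open>By the double angle formula, a cosine of at least \<open>- c\<close> gives
  \<open>cos (x / 2)\<close> squared at least \<open>(1 - c) / 2\<close>: the half angle stays away
  from the pole of the tangent.\<close>

lemma cos_half_product_ge:
  assumes "\<bar>cos x\<bar> \<le> c" "\<bar>cos y\<bar> \<le> c" "c < 1" "0 \<le> x" "x \<le> pi" "0 \<le> y" "y \<le> pi"
  shows "(1 - c) / 2 \<le> cos (x / 2) * cos (y / 2)" "0 < cos (x / 2)" "0 < cos (y / 2)"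
proof -
  have half: "sqrt ((1 - c) / 2) \<le> cos (z / 2)" if "\<bar>cos z\<bar> \<le> c" "0 \<le> z" "z \<le> pi" for z :: real
  proof (rule real_le_lsqrt)
    have "cos z = 2 * (cos (z / 2))\<^sup>2 - 1" using cos_double_cos[of "z / 2"] by simp
    then show "(1 - c) / 2 \<le> (cos (z / 2))\<^sup>2" using that(1) by (simp add: abs_le_iff)
    show "0 \<le> cos (z / 2)" using that by (intro cos_ge_zero) auto
  qed
  have p: "0 < sqrt ((1 - c) / 2)" using assms(3) by simp
  then show "0 < cos (x / 2)" "0 < cos (y / 2)" using half[of x] half[of y] assms by linarith+
  have "sqrt ((1 - c) / 2) * sqrt ((1 - c) / 2) \<le> cos (x / 2) * cos (y / 2)"
    using half[of x] half[of y] assms p by (intro mult_mono) linarith+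
  then show "(1 - c) / 2 \<le> cos (x / 2) * cos (y / 2)" using assms(3) by simp
qed

lemma arccos_lipschitz:
  assumes "\<bar>x\<bar> \<le> c" "\<bar>y\<bar> \<le> c" "c < 1"
  shows "\<bar>arccos x - arccos y\<bar> \<le> \<bar>x - y\<bar> / sqrt (1 - c\<^sup>2)"
proof -
  have c0: "0 \<le> c" using assms by linarith
  have "c\<^sup>2 < 1" using c0 assms(3) by (simp add: abs_square_less_1)
  then have pos: "0 < sqrt (1 - c\<^sup>2)" by simp
  have "norm (arccos x - arccos y) \<le> 1 / sqrt (1 - c\<^sup>2) * norm (x - y)"
  proof (rule field_differentiable_bound[where S = "{-c..c}" and f' = "\<lambda>t. inverse (- sqrt (1 - t\<^sup>2))"])
    fix t assume t: "t \<in> {-c..c}"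
    then have "DERIV arccos t :> inverse (- sqrt (1 - t\<^sup>2))" using assms(3) by (intro DERIV_arccos) auto
    then show "(arccos has_field_derivative inverse (- sqrt (1 - t\<^sup>2))) (at t within {-c..c})"
      by (rule has_field_derivative_at_within)
    have "t\<^sup>2 \<le> c\<^sup>2" using t c0 by (intro abs_le_square_iff[THEN iffD1]) auto
    then have "sqrt (1 - c\<^sup>2) \<le> sqrt (1 - t\<^sup>2)" by simp
    then show "norm (inverse (- sqrt (1 - t\<^sup>2))) \<le> 1 / sqrt (1 - c\<^sup>2)"
      using pos by (simp add: divide_inverse le_imp_inverse_le abs_inverse)
  qed (use assms in auto)
  then show ?thesis by (simp add: divide_inverse mult.commute)
qed

text \<open>A difference of tangents is the sine of the difference divided by the product of the
  cosines, and this product is bounded below.\<close>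

lemma tan_half_lipschitz:
  assumes "\<bar>cos x\<bar> \<le> c" "\<bar>cos y\<bar> \<le> c" "c < 1" "0 \<le> x" "x \<le> pi" "0 \<le> y" "y \<le> pi"
  shows "\<bar>tan (x / 2) - tan (y / 2)\<bar> \<le> \<bar>x - y\<bar> / (1 - c)"
proof -
  note h = cos_half_product_ge[OF assms]
  have "tan u - tan v = sin (u - v) / (cos u * cos v)" if "0 < cos u" "0 < cos v" for u v :: real
    using that by (simp add: tan_def sin_diff field_simps)
  from this[OF h(2,3)] have "tan (x / 2) - tan (y / 2) = sin (x / 2 - y / 2) / (cos (x / 2) * cos (y / 2))" .
  then have "\<bar>tan (x / 2) - tan (y / 2)\<bar> = \<bar>sin (x / 2 - y / 2)\<bar> / (cos (x / 2) * cos (y / 2))"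
    using h by (simp add: abs_mult)
  also have "\<dots> \<le> \<bar>x / 2 - y / 2\<bar> / ((1 - c) / 2)"
    using h assms(3) by (intro frac_le abs_sin_x_le_abs_x) auto
  also have "\<dots> = \<bar>x - y\<bar> / (1 - c)" by (simp add: field_simps flip: diff_divide_distrib)
  finally show ?thesis .
qed

text \<open>The unperturbed configuration consists of the points \<open>a u\<^sub>1\<close>, \<open>a u\<^sub>2\<close> on two rays from the origin
  with turning angle \<open>\<theta>\<close>; the new corner point \<open>Q\<close> is found by Cramer's rule.\<close>

lemma perturbed_corner:
  fixes r1 r2 :: ray and u1 u2 :: "real^2"
  defines "n1 \<equiv> sgn (snd r1)" and "n2 \<equiv> sgn (snd r2)"
  assumes dirs: "snd r1 \<noteq> 0" "snd r2 \<noteq> 0"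
    and u: "norm u1 = 1" "norm u2 = 1" and \<theta>: "\<theta> = arccos (- (u1 \<bullet> u2))" "\<theta> \<in> {\<eta>..pi - \<eta>}"
    and \<eta>: "0 < \<eta>" "\<eta> < pi / 2"
    and c: "c = (1 + cos \<eta>) / 2" and s0: "s0 = sqrt (1 - c\<^sup>2)"
    and n: "norm (n1 - u1) \<le> e1" "norm (n2 - u2) \<le> e1"
    and A: "norm (fst r1 - a *\<^sub>R n1) \<le> e2" "norm (fst r2 - a *\<^sub>R n2) \<le> e2"
    and small: "2 * e1 \<le> (1 - cos \<eta>) / 2" "2 * e2 / s0 < a"
  obtains Q ell1 ell2 where "corner r1 r2 (- n1) (- n2) Q ell1 ell2"
    "\<bar>ell1 - a\<bar> \<le> 2 * e2 / s0" "\<bar>ell2 - a\<bar> \<le> 2 * e2 / s0"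
    "\<bar>rounding_angle r1 r2 - \<theta>\<bar> \<le> 2 * e1 / s0"
    "\<bar>tan (rounding_angle r1 r2 / 2) - tan (\<theta> / 2)\<bar> \<le> 2 * e1 / (s0 * (1 - c))"
proof -
  have n1: "norm n1 = 1" "norm n2 = 1" using dirs by (simp_all add: n1_def n2_def norm_sgn)
  have ce: "0 < cos \<eta>" "cos \<eta> < 1" using \<eta> cos_gt_zero_pi[of \<eta>] cos_monotone_0_pi[of 0 \<eta>] by auto
  have c1: "0 < c" "c < 1" using ce by (auto simp: c)
  have "c\<^sup>2 < 1" using c1 by (simp add: abs_square_less_1)
  then have s0p: "0 < s0" "s0\<^sup>2 = 1 - c\<^sup>2" by (auto simp: s0)
  have ui: "\<bar>- (u1 \<bullet> u2)\<bar> \<le> 1" using Cauchy_Schwarz_ineq2[of u1 u2] u by simp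
  have cos\<theta>: "cos \<theta> = - (u1 \<bullet> u2)" using ui by (simp add: \<theta>(1) cos_arccos_abs)
  have "cos \<theta> \<le> cos \<eta>" using \<theta>(2) \<eta> by (intro cos_monotone_0_pi_le) auto
  moreover have "cos (pi - \<eta>) \<le> cos \<theta>" using \<theta>(2) \<eta> by (intro cos_monotone_0_pi_le) auto
  ultimately have u12: "\<bar>u1 \<bullet> u2\<bar> \<le> cos \<eta>" by (simp add: cos\<theta> abs_le_iff)
  have nu: "\<bar>n1 \<bullet> n2 - u1 \<bullet> u2\<bar> \<le> 2 * e1"
  proof -
    have "n1 \<bullet> n2 - u1 \<bullet> u2 = (n1 - u1) \<bullet> n2 + u1 \<bullet> (n2 - u2)" by (simp add: inner_diff_left inner_diff_right)
    also have "\<bar>\<dots>\<bar> \<le> norm (n1 - u1) * norm n2 + norm u1 * norm (n2 - u2)"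
      by (intro order_trans[OF abs_triangle_ineq] add_mono Cauchy_Schwarz_ineq2)
    finally show ?thesis using n n1 u by simp
  qed
  \<comment> \<open>\<open>c\<close> is the midpoint of \<open>cos \<eta>\<close> and
    \<open>1\<close>: the exact directions satisfy the bound \<open>cos \<eta>\<close>, and the
    perturbation of their inner product uses up at most half of the distance to
    \<open>1\<close>.\<close>
  have n12: "\<bar>n1 \<bullet> n2\<bar> \<le> c" 
  proof -
    have "\<bar>n1 \<bullet> n2\<bar> \<le> \<bar>n1 \<bullet> n2 - u1 \<bullet> u2\<bar> + \<bar>u1 \<bullet> u2\<bar>"
      using abs_triangle_ineq[of "n1 \<bullet> n2 - u1 \<bullet> u2" "u1 \<bullet> u2"] by simp
    also have "\<dots> \<le> 2 * e1 + cos \<eta>" using nu u12 by (rule add_mono)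
    also have "\<dots> \<le> (1 - cos \<eta>) / 2 + cos \<eta>" using small(1) by simp
    also have "\<dots> = c" by (simp add: c field_simps)
    finally show ?thesis .
  qed
  \<comment> \<open>The determinant of the linear system for the intersection point, bounded below
    by \<open>s0\<close> in absolute value.\<close>
  define X where "X = rot n1 \<bullet> n2"
  have "X\<^sup>2 = 1 - (n1 \<bullet> n2)\<^sup>2" unfolding X_def by (rule cross_squared[OF n1])
  moreover have "(n1 \<bullet> n2)\<^sup>2 \<le> c\<^sup>2" using n12 c1 by (intro abs_le_square_iff[THEN iffD1]) auto
  ultimately have "s0\<^sup>2 \<le> X\<^sup>2" using s0p by simp
  then have "\<bar>s0\<bar> \<le> \<bar>X\<bar>" by (simp only: abs_le_square_iff)
  then have Xs: "s0 \<le> \<bar>X\<bar>" by simp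
  then have X0: "X \<noteq> 0" using s0p by auto
  \<comment> \<open>If the endpoints were exactly \<open>a *\<^sub>R n1\<close> and
    \<open>a *\<^sub>R n2\<close>, the lines would meet at the origin. \<open>E\<close> is the
    deviation, and the corrections \<open>q1\<close>, \<open>q2\<close> of the two distances solve
    \<open>E = q1 *\<^sub>R n1 - q2 *\<^sub>R n2\<close>.\<close>
  define E where "E = (fst r1 - a *\<^sub>R n1) - (fst r2 - a *\<^sub>R n2)"
  have E: "norm E \<le> 2 * e2" unfolding E_def using norm_triangle_ineq4 A by (smt (verit))
  define q1 q2 where "q1 = - (rot n2 \<bullet> E) / X" and "q2 = - (rot n1 \<bullet> E) / X"
  have qb: "\<bar>- (rot w \<bullet> E) / X\<bar> \<le> 2 * e2 / s0" if w: "norm w = 1" for w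
  proof -
    have "\<bar>- (rot w \<bullet> E) / X\<bar> = \<bar>rot w \<bullet> E\<bar> / \<bar>X\<bar>" by (simp add: abs_divide)
    also have "\<dots> \<le> norm E / s0"
      using Cauchy_Schwarz_ineq2[of "rot w" E] w Xs s0p by (intro frac_le) auto
    also have "\<dots> \<le> 2 * e2 / s0" using E s0p by (intro divide_right_mono) auto
    finally show ?thesis .
  qed
  have q: "\<bar>q1\<bar> \<le> 2 * e2 / s0" "\<bar>q2\<bar> \<le> 2 * e2 / s0"
    unfolding q1_def q2_def by (intro qb n1)+
  have "X *\<^sub>R E = (X * q1) *\<^sub>R n1 - (X * q2) *\<^sub>R n2"
    using X0 unfolding q1_def q2_def X_def
    by (simp add: vec_eq_iff forall_2 inner_vec2) algebra
  then have "X *\<^sub>R E = X *\<^sub>R (q1 *\<^sub>R n1 - q2 *\<^sub>R n2)" by (simp add: scaleR_diff_right)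
  then have Eq: "E = q1 *\<^sub>R n1 - q2 *\<^sub>R n2" using X0 by simp
  define Q where "Q = fst r1 - (a + q1) *\<^sub>R n1"
  have Q2: "Q = fst r2 - (a + q2) *\<^sub>R n2"
    using Eq unfolding E_def Q_def by (simp add: algebra_simps)
  have cor: "corner r1 r2 (- n1) (- n2) Q (a + q1) (a + q2)"
  proof
    show "Q = fst r1 + (a + q1) *\<^sub>R - n1" by (simp add: Q_def)
    show "Q = fst r2 + (a + q2) *\<^sub>R - n2" by (simp add: Q2)
    show "rot (- n1) \<bullet> - n2 \<noteq> 0" using X0 by (simp add: X_def rot_linear)
    \<comment> \<open>This is where the smallness of \<open>e2\<close> places \<open>Q\<close> on
      the required side of both endpoints.\<close>
    show "0 < a + q1" "0 < a + q2" using q small(2) by (simp_all add: abs_le_iff)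
  qed (use dirs in \<open>auto simp: n1_def n2_def\<close>)
  interpret corner r1 r2 "- n1" "- n2" Q "a + q1" "a + q2" by (rule cor)
  have ang: "\<bar>rounding_angle r1 r2 - \<theta>\<bar> \<le> 2 * e1 / s0"
  proof -
    have "\<bar>arccos (- (n1 \<bullet> n2)) - arccos (- (u1 \<bullet> u2))\<bar> \<le> \<bar>- (n1 \<bullet> n2) - - (u1 \<bullet> u2)\<bar> / sqrt (1 - c\<^sup>2)"
      using n12 u12 ce c1 by (intro arccos_lipschitz) (auto simp: c)
    also have "\<dots> \<le> 2 * e1 / s0" unfolding s0[symmetric] using nu s0p by (intro divide_right_mono) auto
    finally show ?thesis by (simp add: rounding_angle_eq \<theta>(1))
  qed
  have "\<bar>tan (rounding_angle r1 r2 / 2) - tan (\<theta> / 2)\<bar> \<le> \<bar>rounding_angle r1 r2 - \<theta>\<bar> / (1 - c)"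
    using angle_range \<theta>(2) \<eta> n12 u12 ce c1
    by (intro tan_half_lipschitz) (auto simp: cos_angle cos\<theta> c)
  also have "\<dots> \<le> 2 * e1 / s0 / (1 - c)" using ang c1 by (intro divide_right_mono) auto
  finally have tn: "\<bar>tan (rounding_angle r1 r2 / 2) - tan (\<theta> / 2)\<bar> \<le> 2 * e1 / (s0 * (1 - c))" by simp
  show thesis by (rule that[OF cor _ _ ang tn]) (use q in simp_all)
qed

section \<open>The energy of the rounded polygonal\<close>

context riemannian
begin

section \<open>Additivity of the energy and its vanishing on geodesics\<close>

text \<open>All charts share one density \<open>g\<close>, because \<open>chart_at\<close> may
  select a different chart at every parameter. Keeping the endpoints in \<open>N\<close> leaves only
  two-sided derivatives.\<close>

definition energy_curve :: "real \<Rightarrow> (real \<Rightarrow> 'a) \<Rightarrow> real \<Rightarrow> bool" where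
  "energy_curve p c J \<longleftrightarrow> (\<exists>N g. finite N \<and> {0, 1} \<subseteq> N \<and> (g has_integral J) {0..1} \<and>
     (\<forall>t\<in>{0..1} - N. c t \<in> S \<and> (\<forall>ch\<in>A. c t \<in> fst ch \<longrightarrow> energy_density_at (G ch) p (snd ch \<circ> c) t (g t))))"

lemma energy_curve_integral:
  assumes "energy_curve p c J"
  shows "((\<lambda>t. geodesic_curvature_norm A G c t powr p * speed A G c t) has_integral J) {0..1}"
proof -
  obtain N g where N: "finite N" "{0, 1} \<subseteq> N" and g: "(g has_integral J) {0..1}"
    and ed: "\<And>t. t \<in> {0..1} - N \<Longrightarrow> c t \<in> S \<and> (\<forall>ch\<in>A. c t \<in> fst ch \<longrightarrow> energy_density_at (G ch) p (snd ch \<circ> c) t (g t))"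
    using assms unfolding energy_curve_def by blast
  show ?thesis
  proof (rule has_integral_spike_finite[OF N(1) _ g])
    fix t assume t: "t \<in> {0..1} - N"
    then have "t \<in> {0<..<1}" using N(2) by (auto simp: order.order_iff_strict)
    with ed[OF t] chart_at_atlas show "geodesic_curvature_norm A G c t powr p * speed A G c t = g t"
      by (intro integrand_eq_energy_density[where ch = "chart_at A (c t)"]) auto
  qed
qed

lemma energy_curve_join:
  assumes "energy_curve p c1 J1" "energy_curve p c2 J2"
  shows "energy_curve p (c1 +++ c2) (J1 + J2)"
proof -
  obtain N1 g1 where N1: "finite N1" "{0, 1} \<subseteq> N1" and g1: "(g1 has_integral J1) {0..1}"
    and ed1: "\<And>t. t \<in> {0..1} - N1 \<Longrightarrow> c1 t \<in> S \<and> (\<forall>ch\<in>A. c1 t \<in> fst ch \<longrightarrow> energy_density_at (G ch) p (snd ch \<circ> c1) t (g1 t))"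
    using assms(1) unfolding energy_curve_def by blast
  obtain N2 g2 where N2: "finite N2" "{0, 1} \<subseteq> N2" and g2: "(g2 has_integral J2) {0..1}"
    and ed2: "\<And>t. t \<in> {0..1} - N2 \<Longrightarrow> c2 t \<in> S \<and> (\<forall>ch\<in>A. c2 t \<in> fst ch \<longrightarrow> energy_density_at (G ch) p (snd ch \<circ> c2) t (g2 t))"
    using assms(2) unfolding energy_curve_def by blast
  let ?N = "(\<lambda>t. t / 2) ` N1 \<union> (\<lambda>t. (t + 1) / 2) ` N2"
  show ?thesis
    unfolding energy_curve_def
  proof (intro exI conjI ballI impI)
    show "finite ?N" "{0, 1} \<subseteq> ?N" using N1 N2 by force+
    show "((\<lambda>t. if t \<le> 1/2 then 2 * g1 (2 * t) else 2 * g2 (2 * t - 1)) has_integral J1 + J2) {0..1}"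
      by (rule has_integral_join[OF g1 g2])
    fix t assume t: "t \<in> {0..1} - ?N"
    have "t \<noteq> 1 / 2" using N1 t by force
    then consider "t < 1/2" | "t > 1/2" by linarith
    then have "(c1 +++ c2) t \<in> S \<and> (\<forall>ch\<in>A. (c1 +++ c2) t \<in> fst ch \<longrightarrow>
      energy_density_at (G ch) p (snd ch \<circ> (c1 +++ c2)) t (if t \<le> 1/2 then 2 * g1 (2 * t) else 2 * g2 (2 * t - 1)))"
    proof cases
      case 1
      have "2 * t \<notin> N1"
      proof
        assume "2 * t \<in> N1"
        then have "2 * t / 2 \<in> (\<lambda>t. t / 2) ` N1" by (rule imageI)
        then show False using t by simp
      qed
      then have t1: "2 * t \<in> {0..1} - N1" using t 1 by auto
      have "\<forall>\<^sub>F r in nhds t. r \<in> {..<1/2}" using 1 by (intro eventually_nhds_in_open) auto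
      then have ev: "\<forall>\<^sub>F r in nhds t. (snd ch \<circ> c1) (2 * r + 0) = (snd ch \<circ> (c1 +++ c2)) r" for ch :: "'a chart"
        by eventually_elim (auto simp: joinpaths_def)
      have "energy_density_at (G ch) p (snd ch \<circ> (c1 +++ c2)) t (2 * g1 (2 * t))" if "ch \<in> A" "c1 (2 * t) \<in> fst ch" for ch
        using energy_density_at_cong[OF energy_density_at_affine[of "G ch" p "snd ch \<circ> c1" 2 t 0 "g1 (2 * t)"] ev]
          ed1[OF t1] that by (simp add: o_def)
      then show ?thesis using ed1[OF t1] 1 by (auto simp: joinpaths_def)
    next
      case 2
      have "2 * t - 1 \<notin> N2"
      proof
        assume "2 * t - 1 \<in> N2"
        then have "(2 * t - 1 + 1) / 2 \<in> (\<lambda>t. (t + 1) / 2) ` N2" by (rule imageI)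
        then show False using t by simp
      qed
      then have t2: "2 * t - 1 \<in> {0..1} - N2" using t 2 by auto
      have "\<forall>\<^sub>F r in nhds t. r \<in> {1/2<..}" using 2 by (intro eventually_nhds_in_open) auto
      then have ev: "\<forall>\<^sub>F r in nhds t. (snd ch \<circ> c2) (2 * r + (-1)) = (snd ch \<circ> (c1 +++ c2)) r" for ch :: "'a chart"
        by eventually_elim (auto simp: joinpaths_def)
      have "energy_density_at (G ch) p (snd ch \<circ> (c1 +++ c2)) t (2 * g2 (2 * t - 1))" if "ch \<in> A" "c2 (2 * t - 1) \<in> fst ch" for ch
        using energy_density_at_cong[OF energy_density_at_affine[of "G ch" p "snd ch \<circ> c2" 2 t "-1" "g2 (2 * t - 1)"] ev]
          ed2[OF t2] that by (simp add: o_def)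
      then show ?thesis using ed2[OF t2] 2 by (auto simp: joinpaths_def)
    qed
    then show "(c1 +++ c2) t \<in> S"
      "\<And>ch. ch \<in> A \<Longrightarrow> (c1 +++ c2) t \<in> fst ch \<Longrightarrow>
        energy_density_at (G ch) p (snd ch \<circ> (c1 +++ c2)) t (if t \<le> 1/2 then 2 * g1 (2 * t) else 2 * g2 (2 * t - 1))"
      by blast+
  qed
qed

lemma energy_curve_geodesic:
  assumes geo: "unit_speed_geodesic S A G l \<sigma>" and m: "0 \<le> b" "0 \<le> m" "b + m \<le> l"
  shows "energy_curve p (\<lambda>t. \<sigma> (b + t * m)) 0"
  unfolding energy_curve_def
proof (intro exI conjI ballI impI)
  show "finite {0, 1::real}" "{0, 1::real} \<subseteq> {0, 1}" "((\<lambda>_. 0) has_integral (0::real)) {0..1::real}" by auto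
  fix t :: real assume t: "t \<in> {0..1} - {0, 1}"
  have tm: "0 \<le> t * m" "t * m \<le> m" using t m by (auto simp: mult_left_le_one_le)
  then have bt: "b + t * m \<in> {0..l}" using m by auto
  have cont: "continuous_on {0..l} \<sigma>" and img: "\<sigma> ` {0..l} \<subseteq> S" using geo by (auto simp: unit_speed_geodesic_def)
  show "\<sigma> (b + t * m) \<in> S" using img bt by blast
  fix ch assume ch: "ch \<in> A" and in_ch: "\<sigma> (b + t * m) \<in> fst ch"
  show "energy_density_at (G ch) p (snd ch \<circ> (\<lambda>t. \<sigma> (b + t * m))) t 0"
  \<comment> \<open>An arc no longer than its two neighbours is used up by the trims at both ends;
    its kept part is then a single point.\<close>
  proof (cases "m = 0")
    case True
    then show ?thesis using energy_density_at_const[of "G ch" p "snd ch (\<sigma> b)" t] by (simp add: o_def)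
  next
    case False
    then have m0: "m > 0" using m by simp
    let ?s = "m * t + b"
    have "0 < m * t" "m * t < m" using t m0 by auto
    then have s: "?s \<in> {0<..<l}" using m by auto
    obtain v where v: "\<And>t. t \<in> {0..l} \<Longrightarrow> \<sigma> t \<in> fst ch \<Longrightarrow> ((snd ch \<circ> \<sigma>) has_vector_derivative v t) (at t within {0..l})"
      "\<And>t. t \<in> {0..l} \<Longrightarrow> \<sigma> t \<in> fst ch \<Longrightarrow>
         (v has_vector_derivative - christoffel_form (G ch) (snd ch (\<sigma> t)) (v t) (v t)) (at t within {0..l})"
      "\<And>t. t \<in> {0..l} \<Longrightarrow> \<sigma> t \<in> fst ch \<Longrightarrow> gram_norm (G ch (snd ch (\<sigma> t))) (v t) = 1"
      using unit_speed_geodesicE[OF geo ch] by metis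
    have within: "at r within {0..l} = at r" if "r \<in> {0<..<l}" for r
      using that by (intro at_within_interior) (auto simp: interior_atLeastAtMost_real)
    have ev0: "\<forall>\<^sub>F r in nhds ?s. r \<in> {0<..<l}" using s by (intro eventually_nhds_in_open) auto
    have in_s: "\<sigma> ?s \<in> fst ch" using in_ch by (simp add: algebra_simps)
    have "(\<sigma> \<longlongrightarrow> \<sigma> ?s) (at ?s within {0..l})" using cont s unfolding continuous_on_def by auto
    then have "(\<sigma> \<longlongrightarrow> \<sigma> ?s) (at ?s)" by (simp only: within[OF s])
    moreover have "\<forall>\<^sub>F r in nhds ?s. \<sigma> r \<in> S" using ev0 by eventually_elim (use img in auto)
    ultimately have "\<forall>\<^sub>F r in at ?s. \<sigma> r \<in> fst ch"
      using in_s ch by (intro eventually_in_chart) (auto simp: eventually_nhds_conv_at)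
    then have "\<forall>\<^sub>F r in nhds ?s. \<sigma> r \<in> fst ch" using in_s by (simp add: eventually_nhds_conv_at)
    with ev0 have "\<forall>\<^sub>F r in nhds ?s. ((snd ch \<circ> \<sigma>) has_vector_derivative v r) (at r) \<and>
        gram_norm (G ch ((snd ch \<circ> \<sigma>) r)) (v r) = 1"
    proof eventually_elim
      case (elim r)
      then show ?case using v(1)[of r] v(3)[of r] within[of r] by auto
    qed
    moreover have "(v has_vector_derivative - christoffel_form (G ch) ((snd ch \<circ> \<sigma>) ?s) (v ?s) (v ?s)) (at ?s)"
      using v(2)[of ?s] within[OF s] s in_s by auto
    ultimately have "energy_density_at (G ch) p (snd ch \<circ> \<sigma>) ?s 0" by (rule energy_density_at_geodesic)
    from energy_density_at_affine[OF this m0] show ?thesis by (simp add: o_def add.commute mult.commute)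
  qed
qed

end

context isothermal
begin

section \<open>Energy of one rounded corner\<close>

text \<open>Diameter \<open>\<delta>1\<close> itself is not among those for which charts are given.
  Lengths below the radius leave room, however, so any two points of the disk lie in a common
  smaller disk on which \<open>\<phi> q\<close> is a chart.\<close>

lemma phi_inj: assumes q: "q \<in> S" shows "inj_on (\<phi> q) (disk q \<delta>1)"
proof (rule inj_onI)
  have small: "\<exists>d. 0 < d \<and> d < \<delta>1 \<and> x \<in> disk q d" if "x \<in> disk q \<delta>1" for x
  proof -
    obtain c g I where c: "C1_curve c g" "(g has_integral I) {0..1}" "I < \<delta>1 / 2" "pathstart c = q" "pathfinish c = x"
      using metric_diskE[OF \<open>x \<in> disk q \<delta>1\<close>] .
    \<comment> \<open>The midpoint between twice the length, cut off at zero to keep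
      \<open>d\<close> positive, and \<open>\<delta>1\<close>.\<close>
    define d where "d = max (2 * I) 0 / 2 + \<delta>1 / 2"
    have "0 < d" "d < \<delta>1" "I < d / 2" using c(3) delta1 by (auto simp: d_def max_def)
    then show ?thesis using metric_diskI[OF c(1,2), of "d / 2"] c by auto
  qed
  fix x y assume x: "x \<in> disk q \<delta>1" and y: "y \<in> disk q \<delta>1" and eq: "\<phi> q x = \<phi> q y"
  obtain d where d: "0 < d" "d < \<delta>1" "x \<in> disk q d" using small[OF x] by blast
  obtain d' where d': "0 < d'" "d' < \<delta>1" "y \<in> disk q d'" using small[OF y] by blast
  have m: "0 < max d d'" "max d d' < \<delta>1" using d d' by auto
  have "x \<in> disk q (max d d')" "y \<in> disk q (max d d')"
    using d d' disk_mono[of d "max d d'" q] disk_mono[of d' "max d d'" q] by auto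
  then show "x = y" using chart_inj[OF iso_atlas[OF q m]] eq by (auto dest: inj_onD)
qed

lemma
  assumes q: "q \<in> S" and d: "0 < d" "d < \<delta>1" and p: "1 \<le> p"
    and corner: "corner r1 r2 w1 w2 Q ell1 ell2"
    and img: "\<And>s. s \<in> {0..rounding_length r1 r2} \<Longrightarrow> rounding r1 r2 s \<in> \<phi> q ` disk q d"
  defines "f \<equiv> \<lambda>s. exp ((1 - p) * lam q (rounding r1 r2 s)) *
     \<bar>plane_curvature (rounding_length r1 r2) (rounding r1 r2) s +
      conormal_deriv (rounding_length r1 r2) (rounding r1 r2) (lam q) s\<bar> powr p"
  shows corner_integrable: "f integrable_on {0..rounding_length r1 r2}"
    and corner_energy_curve: "energy_curve p
      (\<lambda>t. inv_into (disk q \<delta>1) (\<phi> q) (rounding r1 r2 (rounding_length r1 r2 * t)))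
      (integral {0..rounding_length r1 r2} f)"
proof -
  interpret corner r1 r2 w1 w2 Q ell1 ell2 by (rule corner)
  let ?c = "rounding r1 r2"
  \<comment> \<open>The integrand with the curvature frozen to a constant \<open>k\<close>. It is
    continuous on the whole interval and agrees with \<open>f\<close> inside each piece, where the
    curvature is constant.\<close>
  define F where "F k s = exp ((1 - p) * lam q (?c s)) * \<bar>k + grad (lam q) (?c s) \<bullet> (- rot (T s))\<bar> powr p" for k s
  have fF: "f s = F (\<kappa> s) s" if "s \<in> {0..len}" "s \<noteq> p1" "s \<noteq> p2" for s
    using that by (simp add: f_def F_def plane_curvature_eq conormal_deriv_eq)
  have c_cont: "continuous_on X ?c" for X
    using rounding_derivative by (meson continuous_at_imp_continuous_on has_vector_derivative_continuous)
  have sub: "?c ` {0..len} \<subseteq> \<phi> q ` disk q d" using img by blast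
  have lam_cont: "continuous_on (\<phi> q ` disk q d) (lam q)"
    using lam_has_derivative[OF q d] by (meson continuous_at_imp_continuous_on has_derivative_continuous)
  have rotT: "continuous_on {0..len} (\<lambda>s. rot (T s))"
  proof -
    have "linear rot" by (rule linearI) (simp_all add: rot_linear)
    then show ?thesis by (rule linear_continuous_on_compose[OF T_continuous])
  qed
  have F_cont: "continuous_on {0..len} (F k)" for k
    unfolding F_def
    using p by (intro continuous_on_mult continuous_on_exp continuous_on_powr' continuous_on_const
        continuous_on_compose2[OF lam_cont c_cont sub] continuous_on_rabs continuous_on_add continuous_on_inner
        continuous_on_compose2[OF grad_lam_continuous[OF q d] c_cont sub] continuous_on_minus rotT) auto
  have F_int: "F k integrable_on {x..y}" if "0 \<le> x" "y \<le> len" for k x y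
    by (rule integrable_continuous_real[OF continuous_on_subset[OF F_cont]]) (use that in auto)
  have piece: "f integrable_on {x..y}"
    if "0 \<le> x" "y \<le> len" "\<And>s. s \<in> {x<..<y} \<Longrightarrow> s \<noteq> p1 \<and> s \<noteq> p2 \<and> \<kappa> s = k" for x y k
  proof (rule integrable_spike_finite[OF _ _ F_int[OF that(1,2), of k]])
    show "finite {x, y}" by simp
    fix s assume s: "s \<in> {x..y} - {x, y}"
    then have "s \<in> {x<..<y}" by auto
    with that(3)[OF this] show "f s = F k s" using that(1,2) by (subst fF) auto
  qed
  have pieces: "f integrable_on {0..p1}" "f integrable_on {p1..p2}" "f integrable_on {p2..len}"
    using p_order p2_le_length
    by (intro piece[of _ _ 0] piece[of _ _ "\<tau> / R"]; auto simp: \<kappa>_def)+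
  have "f integrable_on {0..p2}"
    using p_order by (intro Henstock_Kurzweil_Integration.integrable_combine[OF _ _ pieces(1,2)]) auto
  then show int: "f integrable_on {0..len}"
    using p_order p2_le_length
    by (intro Henstock_Kurzweil_Integration.integrable_combine[OF _ _ _ pieces(3)]) auto
  let ?x = "\<lambda>t. inv_into (disk q \<delta>1) (\<phi> q) (?c (len * t))"
  have lt: "len * t \<in> {0..len}" if "t \<in> {0..1}" for t
    using that len_pos by (auto simp: mult_left_le)
  \<comment> \<open>The path inverts \<open>\<phi> q\<close> on the large disk, whereas the
    isothermal chart is used on the small one; injectivity on the large disk makes the two inverses
    agree.\<close>
  have inv_eq: "inv_into (disk q \<delta>1) (\<phi> q) z = inv_into (disk q d) (\<phi> q) z" if z: "z \<in> \<phi> q ` disk q d" for z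
  proof (rule inv_into_f_eq[OF phi_inj[OF q]])
    show "inv_into (disk q d) (\<phi> q) z \<in> disk q \<delta>1"
      using inv_into_into[OF z] disk_mono[of d \<delta>1 q] d by auto
    show "\<phi> q (inv_into (disk q d) (\<phi> q) z) = z" using z by (rule f_inv_into_f)
  qed
  have x_disk: "?x t \<in> disk q d" and phi_x: "\<phi> q (?x t) = ?c (len * t)" if "t \<in> {0..1}" for t
    using img[OF lt[OF that]] by (simp_all add: inv_eq inv_into_into f_inv_into_f)
  note ch = iso_atlas[OF q d]
  have "continuous_on {0..1} (\<lambda>t. inv_into (disk q d) (\<phi> q) (?c (len * t)))"
    by (rule continuous_on_compose2[OF chart_inv_continuous[OF ch, simplified]])
      (use img lt in \<open>auto intro!: continuous_on_compose2[OF c_cont] continuous_intros\<close>)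
  then have path: "path ?x"
    unfolding path_def by (rule continuous_on_cong[THEN iffD1, rotated -1]) (use img lt in \<open>auto simp: inv_eq\<close>)
  have pS: "path_image ?x \<subseteq> S" using x_disk chart_subset[OF ch] by (auto simp: path_image_def)
  show "energy_curve p ?x (integral {0..len} f)"
    unfolding energy_curve_def
  proof (intro exI conjI ballI impI)
    \<comment> \<open>Besides the endpoints, the rescaled parameters of the two joints.\<close>
    let ?N = "{0, 1, p1 / len, p2 / len}"
    show "finite ?N" "{0, 1} \<subseteq> ?N" by auto
    show "((\<lambda>t. len * f (len * t)) has_integral integral {0..len} f) {0..1}"
      using has_integral_mult_right[OF has_integral_affinity'[OF integrable_integral[OF int, unfolded cbox_interval[symmetric]], of len 0], of len]
        len_pos by (simp add: mult.assoc[symmetric])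
    fix t assume t: "t \<in> {0..1} - ?N"
    then have t01: "t \<in> {0..1}" and t1: "t \<in> {0<..<1}" by auto
    show "?x t \<in> S" using x_disk[OF t01] chart_subset[OF ch] by auto
    fix ch' assume ch': "ch' \<in> A" "?x t \<in> fst ch'"
    have s: "len * t \<in> {0..len}" "len * t \<noteq> p1" "len * t \<noteq> p2"
      using lt[OF t01] t len_pos by (auto simp: eq_divide_eq mult.commute)
    obtain D where D: "(G (iso q d) has_derivative D) (at (?c (len * t)))"
      using metric_C1[OF ch] img[OF s(1)] by (metis fst_conv snd_conv)
    have "energy_density_at (G (iso q d)) p ?c (len * t)
      (exp ((1 - p) * lam q (?c (len * t))) * \<bar>\<kappa> (len * t) + grad (lam q) (?c (len * t)) \<bullet> (- rot (T (len * t)))\<bar> powr p)"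
      by (rule conformal_energy_density[where x = ?c and lam = "lam q" and T = T,
            OF iso_open[OF q d] img[OF s(1)] iso_metric[OF q d] D _ T_derivative[OF s(2,3)]])
        (use rounding_derivative norm_T in auto)
    then have "energy_density_at (G (iso q d)) p ?c (len * t + 0) (f (len * t))"
      using fF[OF s] by (simp add: F_def)
    from energy_density_at_affine[OF this len_pos]
    have "energy_density_at (G (iso q d)) p (\<lambda>r. ?c (len * r + 0)) t (len * f (len * t))" .
    moreover have "\<forall>\<^sub>F r in nhds t. r \<in> {0<..<1::real}" using t1 by (intro eventually_nhds_in_open) auto
    then have "\<forall>\<^sub>F r in nhds t. ?c (len * r + 0) = (snd (iso q d) \<circ> ?x) r"
      by eventually_elim (simp add: phi_x)
    ultimately have "energy_density_at (G (iso q d)) p (snd (iso q d) \<circ> ?x) t (len * f (len * t))"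
      by (rule energy_density_at_cong)
    moreover have "\<forall>\<^sub>F r in nhds t. ?x r \<in> fst (iso q d) \<inter> fst ch'"
      using path_eventually_in_chart[OF path pS ch t1] path_eventually_in_chart[OF path pS ch'(1) t1 ch'(2)] x_disk[OF t01]
      by (simp add: eventually_conj_iff)
    ultimately show "energy_density_at (G ch') p (snd ch' \<circ> ?x) t (len * f (len * t))"
      by (intro energy_density_at_chart[OF ch ch'(1)])
  qed
qed

section \<open>The corner formed by two geodesic arcs\<close>

text \<open>Normalizing a velocity at most doubles its error, to \<open>2 * K * a\<^sup>2\<close>.
  Measured from the normalized ray, the endpoint is then off by
  \<open>K * a ^ 3 + a * (2 * K * a\<^sup>2) = 3 * K * a ^ 3\<close>. These are the
  \<open>e1\<close> and \<open>e2\<close> of \<open>perturbed_corner\<close>.\<close>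

lemma vertex_corner:
  fixes L :: "nat \<Rightarrow> real" and \<gamma> :: "nat \<Rightarrow> real \<Rightarrow> 'a"
  defines "K \<equiv> 36 * C0"
  assumes poly: "polygonal S A G k L \<gamma>" and i: "i \<in> {1..<k}"
    and \<theta>: "turning_angle A G L \<gamma> i \<in> {\<eta>..pi - \<eta>}" and \<eta>: "0 < \<eta>" "\<eta> < pi / 2"
    and c: "c = (1 + cos \<eta>) / 2" and s0: "s0 = sqrt (1 - c\<^sup>2)"
    and a: "a = edge_length L i / 2"
    and small: "a \<le> 1" "3 * a < \<delta>1" "3 * C0 * a\<^sup>2 \<le> 1/2" "4 * K * a\<^sup>2 \<le> (1 - cos \<eta>) / 2" "6 * K * a\<^sup>2 \<le> s0 / 4"
  obtains w1 w2 Q ell1 ell2 where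
    "corner (incoming_ray \<phi> L \<gamma> i) (outgoing_ray \<phi> L \<gamma> i) w1 w2 Q ell1 ell2"
    "\<bar>ell1 - a\<bar> \<le> 6 * K * a ^ 3 / s0" "\<bar>ell2 - a\<bar> \<le> 6 * K * a ^ 3 / s0"
    "\<bar>rounding_angle (incoming_ray \<phi> L \<gamma> i) (outgoing_ray \<phi> L \<gamma> i) - turning_angle A G L \<gamma> i\<bar> \<le> 4 * K * a\<^sup>2 / s0"
    "\<bar>tan (rounding_angle (incoming_ray \<phi> L \<gamma> i) (outgoing_ray \<phi> L \<gamma> i) / 2) - tan (turning_angle A G L \<gamma> i / 2)\<bar>
       \<le> 4 * K * a\<^sup>2 / (s0 * (1 - c))"
    "norm (fst (incoming_ray \<phi> L \<gamma> i)) \<le> a + 3 * K * a ^ 3"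
proof -
  let ?q = "vertex L \<gamma> i"
  have L: "0 < L i" "0 < L (Suc i)" and geo: "unit_speed_geodesic S A G (L i) (\<gamma> i)"
    "unit_speed_geodesic S A G (L (Suc i)) (\<gamma> (Suc i))" and join: "\<gamma> (Suc i) 0 = ?q"
    using poly i by (auto simp: polygonal_def vertex_def)
  have a0: "0 < a" and aL: "a \<le> L i" "a \<le> L (Suc i)" using L by (auto simp: a edge_length_def min_def)
  have q: "?q \<in> S" using geo(1) L by (auto simp: unit_speed_geodesic_def vertex_def)
  have K: "0 < K" using C0 by (simp add: K_def)
  let ?\<sigma>1 = "\<lambda>t. \<gamma> i (L i - t)" and ?\<sigma>2 = "\<gamma> (Suc i)"
  have g1: "unit_speed_geodesic S A G a ?\<sigma>1" by (rule geodesic_restrict[OF geodesic_reverse[OF geo(1)] aL(1)])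
  have g2: "unit_speed_geodesic S A G a ?\<sigma>2" by (rule geodesic_restrict[OF geo(2) aL(2)])
  obtain u1 v1 where 1: "((\<phi> ?q \<circ> ?\<sigma>1) has_vector_derivative u1) (at 0 within {0..a})"
    "((\<phi> ?q \<circ> ?\<sigma>1) has_vector_derivative v1) (at a within {0..a})"
    "norm u1 = 1" "v1 \<noteq> 0" "norm (v1 - u1) \<le> K * a\<^sup>2" "norm (\<phi> ?q (?\<sigma>1 a) - a *\<^sub>R u1) \<le> K * a ^ 3"
    using geodesic_estimates[OF q a0 small(2,3) g1] unfolding K_def by (auto simp: vertex_def)
  obtain u2 v2 where 2: "((\<phi> ?q \<circ> ?\<sigma>2) has_vector_derivative u2) (at 0 within {0..a})"
    "((\<phi> ?q \<circ> ?\<sigma>2) has_vector_derivative v2) (at a within {0..a})"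
    "norm u2 = 1" "v2 \<noteq> 0" "norm (v2 - u2) \<le> K * a\<^sup>2" "norm (\<phi> ?q (?\<sigma>2 a) - a *\<^sub>R u2) \<le> K * a ^ 3"
    using geodesic_estimates[OF q a0 small(2,3) g2 join] unfolding K_def by auto
  have r1: "incoming_ray \<phi> L \<gamma> i = (\<phi> ?q (?\<sigma>1 a), v1)"
    using vector_derivative_within_cbox[of 0 a a, simplified, OF a0 1(2)] a0 by (simp add: incoming_ray_def Let_def a[symmetric] o_def)
  have r2: "outgoing_ray \<phi> L \<gamma> i = (\<phi> ?q (?\<sigma>2 a), v2)"
    using vector_derivative_within_cbox[of 0 a a, simplified, OF a0 2(2)] a0 by (simp add: outgoing_ray_def Let_def a[symmetric] o_def)
  have d: "0 < 3 * a" using a0 by simp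
  have ta: "turning_angle A G L \<gamma> i = arccos (- (u1 \<bullet> u2))"
    by (rule turning_angle_eq[OF d small(2) refl join L geo a0 aL 1(1,3) 2(1,3)])
  have sgn_close: "norm (sgn v - u) \<le> 2 * K * a\<^sup>2" if v: "v \<noteq> 0" "norm u = 1" "norm (v - u) \<le> K * a\<^sup>2" for u v :: "real^2"
  proof -
    \<comment> \<open>Normalization moves \<open>v\<close> by the difference of its norm from
      \<open>1\<close>, which is at most its distance to the unit vector \<open>u\<close>.\<close>
    have "sgn v - v = (1 - norm v) *\<^sub>R sgn v"
      using v(1) by (simp add: sgn_div_norm algebra_simps)
    then have "norm (sgn v - v) = \<bar>1 - norm v\<bar>" using v(1) by (simp add: norm_sgn)
    also have "\<dots> \<le> norm (v - u)" using norm_triangle_ineq3[of v u] v(2) by linarith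
    finally have "norm (sgn v - v) \<le> K * a\<^sup>2" using v(3) by linarith
    then show ?thesis using norm_triangle_ineq[of "sgn v - v" "v - u"] v(3) by simp
  qed
  have pt_close: "norm (x - a *\<^sub>R sgn v) \<le> 3 * K * a ^ 3"
    if "norm (x - a *\<^sub>R u) \<le> K * a ^ 3" "norm (sgn v - u) \<le> 2 * K * a\<^sup>2" for x u v :: "real^2"
  proof -
    have "norm (x - a *\<^sub>R sgn v) = norm ((x - a *\<^sub>R u) - a *\<^sub>R (sgn v - u))" by (simp add: algebra_simps)
    also have "\<dots> \<le> K * a ^ 3 + a * (2 * K * a\<^sup>2)"
      by (rule order_trans[OF norm_triangle_ineq4]) (use that a0 in \<open>auto intro!: add_mono mult_left_mono\<close>)
    finally show ?thesis by (simp add: power2_eq_square power3_eq_cube)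
  qed
  note n = sgn_close[OF 1(4,3,5)] sgn_close[OF 2(4,3,5)]
  note P = pt_close[OF 1(6) n(1)] pt_close[OF 2(6) n(2)]
  have s0p: "0 < s0"
  proof -
    have "0 < cos \<eta>" "cos \<eta> < 1" using \<eta> cos_gt_zero_pi[of \<eta>] cos_monotone_0_pi[of 0 \<eta>] by auto
    then have "c\<^sup>2 < 1" by (simp add: c abs_square_less_1)
    then show ?thesis by (simp add: s0)
  qed
  have "6 * K * a\<^sup>2 < s0" using small(5) s0p by linarith
  then have "a * (6 * K * a\<^sup>2) < a * s0" using a0 by (intro mult_strict_left_mono)
  then have lt: "2 * (3 * K * a ^ 3) / s0 < a" using s0p by (simp add: field_simps power2_eq_square power3_eq_cube)
  have sm: "2 * (2 * K * a\<^sup>2) \<le> (1 - cos \<eta>) / 2" using small(4) by simp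
  obtain Q ell1 ell2 where cor:
    "corner (incoming_ray \<phi> L \<gamma> i) (outgoing_ray \<phi> L \<gamma> i) (- sgn v1) (- sgn v2) Q ell1 ell2"
    "\<bar>ell1 - a\<bar> \<le> 2 * (3 * K * a ^ 3) / s0" "\<bar>ell2 - a\<bar> \<le> 2 * (3 * K * a ^ 3) / s0"
    "\<bar>rounding_angle (incoming_ray \<phi> L \<gamma> i) (outgoing_ray \<phi> L \<gamma> i) - turning_angle A G L \<gamma> i\<bar> \<le> 2 * (2 * K * a\<^sup>2) / s0"
    "\<bar>tan (rounding_angle (incoming_ray \<phi> L \<gamma> i) (outgoing_ray \<phi> L \<gamma> i) / 2) - tan (turning_angle A G L \<gamma> i / 2)\<bar>
       \<le> 2 * (2 * K * a\<^sup>2) / (s0 * (1 - c))"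
    by (rule perturbed_corner[of "incoming_ray \<phi> L \<gamma> i" "outgoing_ray \<phi> L \<gamma> i" u1 u2 "turning_angle A G L \<gamma> i" \<eta> c s0
          "2 * K * a\<^sup>2" a "3 * K * a ^ 3"])
      (use 1(3,4) 2(3,4) ta \<theta> \<eta> c s0 n P sm lt in \<open>simp_all add: r1 r2\<close>)
  have "norm (\<phi> ?q (?\<sigma>1 a)) \<le> norm (a *\<^sub>R sgn v1) + norm (\<phi> ?q (?\<sigma>1 a) - a *\<^sub>R sgn v1)"
    by (metis add.commute diff_add_cancel norm_triangle_ineq)
  also have "\<dots> \<le> a + 3 * K * a ^ 3" using P(1) a0 1(4) by (simp add: norm_sgn)
  finally have "norm (fst (incoming_ray \<phi> L \<gamma> i)) \<le> a + 3 * K * a ^ 3" by (simp add: r1)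
  with that[OF cor(1)] cor(2-5) show thesis by simp
qed

section \<open>Assembling kept arcs and corners\<close>

text \<open>Each trim is at most half of either adjacent arc, so the two trims of an arc never
  overlap.\<close>

lemma trim_bounds:
  assumes poly: "polygonal S A G k L \<gamma>" and j: "j \<in> {1..k}"
  shows "0 \<le> trim k L j" "0 \<le> trim k L (j - 1)" "trim k L j + trim k L (j - 1) \<le> L j"
proof -
  have L: "0 < L i" if "i \<in> {1..k}" for i using poly that by (auto simp: polygonal_def)
  have "0 \<le> trim k L i \<and> (i \<in> {1..<k} \<longrightarrow> trim k L i \<le> L i / 2 \<and> trim k L i \<le> L (Suc i) / 2)" for i
    using L[of i] L[of "Suc i"] by (auto simp: trim_def edge_length_def)
  note t = this[of j] this[of "j - 1"]
  then show "0 \<le> trim k L j" "0 \<le> trim k L (j - 1)" by auto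
  have "trim k L j \<le> L j / 2" using t(1) L[OF j] by (cases "j \<in> {1..<k}") (auto simp: trim_def)
  moreover have "trim k L (j - 1) \<le> L j / 2"
    using t(2) L[OF j] j by (cases "j - 1 \<in> {1..<k}") (auto simp: trim_def)
  ultimately show "trim k L j + trim k L (j - 1) \<le> L j" by linarith
qed

lemma kept_arc_energy_curve:
  assumes poly: "polygonal S A G k L \<gamma>" and j: "j \<in> {1..k}"
  shows "energy_curve p (kept_arc k L \<gamma> j) 0"
proof -
  have geo: "unit_speed_geodesic S A G (L j) (\<gamma> j)" using poly j by (auto simp: polygonal_def)
  have "energy_curve p (\<lambda>t. \<gamma> j (trim k L (j - 1) + t * (L j - trim k L j - trim k L (j - 1)))) 0"
    using trim_bounds[OF poly j] by (intro energy_curve_geodesic[OF geo]) auto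
  then show ?thesis by (simp add: kept_arc_def[abs_def])
qed

lemma rounded_upto_energy_curve:
  assumes poly: "polygonal S A G k L \<gamma>"
    and corners: "\<And>i. i \<in> {1..<k} \<Longrightarrow> energy_curve p (corner_path U \<phi> L \<gamma> i) (J i)"
  shows "n < k \<Longrightarrow> energy_curve p (rounded_upto U \<phi> k L \<gamma> n) (\<Sum>i=1..n. J i)"
proof (induction n)
  case 0
  then show ?case using kept_arc_energy_curve[OF poly, of 1] by simp
next
  case (Suc n)
  have "energy_curve p (rounded_upto U \<phi> k L \<gamma> (Suc n)) ((\<Sum>i=1..n. J i) + (J (Suc n) + 0))"
    using Suc by (simp only: rounded_upto.simps, intro energy_curve_join corners kept_arc_energy_curve[OF poly]) auto
  then show ?case by simp
qed

section \<open>Expansions at a vertex\<close>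

text \<open>\<open>turning_sine \<eta>\<close> is a lower bound for the sine of the angle between the perturbed rays. The
  numerical constants are multiples of the factor \<open>36 * C0\<close> in \<open>geodesic_estimates\<close>.\<close>

definition turning_sine :: "real \<Rightarrow> real" where
  "turning_sine \<eta> = sqrt (1 - ((1 + cos \<eta>) / 2)\<^sup>2)"

text \<open>The summands bound the relative error of the angle, the error of twice the tangent
  length and the error of twice the tangent of the half angle. Their sum provides one error function
  for all expansions.\<close>

definition error_const :: "real \<Rightarrow> real" where
  "error_const \<eta> = 144 * C0 / (turning_sine \<eta> * \<eta>) + 432 * C0 / turning_sine \<eta> +
     288 * C0 / (turning_sine \<eta> * (1 - (1 + cos \<eta>) / 2))"

text \<open>In order, the entries allow higher powers to be absorbed into lower ones, admit the
  diameter \<open>8 * (1 + \<epsilon>) * \<delta>\<close>, bound the speed of geodesics by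
  \<open>2\<close>, keep the perturbed rays transversal and keep the tangent lengths close to
  \<open>\<delta> / 2\<close>.\<close>

definition mesh_bound :: "real \<Rightarrow> real" where
  "mesh_bound \<eta> = Min {1, \<delta>1 / (8 * (1 + \<epsilon>)), 1 / (6 * C0), (1 - cos \<eta>) / (288 * C0), turning_sine \<eta> / (864 * C0)}"

lemma cos_turning: assumes "0 < \<eta>" "\<eta> < pi / 2" shows "0 < cos \<eta>" "cos \<eta> < 1"
  using assms cos_gt_zero_pi[of \<eta>] cos_monotone_0_pi[of 0 \<eta>] by auto

lemma turning_sine_range: assumes "0 < \<eta>" "\<eta> < pi / 2" shows "0 < turning_sine \<eta>" "turning_sine \<eta> \<le> 1"
proof -
  have "((1 + cos \<eta>) / 2)\<^sup>2 < 1" using cos_turning[OF assms] by (simp add: abs_square_less_1)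
  then show "0 < turning_sine \<eta>" "turning_sine \<eta> \<le> 1" by (auto simp: turning_sine_def)
qed

lemma mesh_bound_pos: assumes "0 < \<eta>" "\<eta> < pi / 2" shows "0 < mesh_bound \<eta>"
  unfolding mesh_bound_def
  using delta1 eps C0 cos_turning[OF assms] turning_sine_range[OF assms] by (subst Min_gr_iff) auto

text \<open>All conclusions concern the same interpreted corner. With
  \<open>a = \<delta> / 2\<close>, its angle errors are of order \<open>a\<^sup>2\<close>; its
  length errors are of order \<open>a ^ 3\<close>, which \<open>a \<le> 1\<close> reduces to the
  same order.\<close>

lemma vertex_expansion:
  fixes L :: "nat \<Rightarrow> real" and \<gamma> :: "nat \<Rightarrow> real \<Rightarrow> 'a"
  defines "R \<equiv> corner_radius \<phi> L \<gamma>" and "l \<equiv> corner_length \<phi> L \<gamma>"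
    and "c \<equiv> corner_curve \<phi> L \<gamma>" and "\<theta> \<equiv> turning_angle A G L \<gamma>"
  assumes poly: "polygonal S A G k L \<gamma>" and i: "i \<in> {1..<k}"
    and \<theta>: "\<theta> i \<in> {\<eta>..pi - \<eta>}" and \<eta>: "0 < \<eta>" "\<eta> < pi / 2"
    and \<delta>: "\<delta> = edge_length L i" and mesh: "\<delta> < mesh_bound \<eta>"
    and U: "U = (\<lambda>q. metric_disk S A G q (\<delta>1 / 2))" and p: "1 \<le> p"
    and f: "f = (\<lambda>s. exp ((1 - p) * lam (vertex L \<gamma> i) (c i s)) *
                 \<bar>plane_curvature (l i) (c i) s + conormal_deriv (l i) (c i) (lam (vertex L \<gamma> i)) s\<bar> powr p)"
  shows vertex_integrable: "f integrable_on {0..l i}"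
    and vertex_energy: "energy_curve p (corner_path U \<phi> L \<gamma> i) (integral {0..l i} f)"
    and vertex_total_curvature: "\<exists>e. \<bar>e\<bar> \<le> error_const \<eta> * \<delta>\<^sup>2 \<and>
      ((\<lambda>s. \<bar>plane_curvature (l i) (c i) s\<bar> powr p) has_integral R i powr (1 - p) * \<theta> i * (1 + e)) {0..l i}"
    and vertex_radius: "\<exists>e e'. \<bar>e\<bar> \<le> error_const \<eta> * \<delta>\<^sup>2 \<and> \<bar>e'\<bar> \<le> error_const \<eta> * \<delta>\<^sup>2 \<and>
      R i = (\<delta> + e) / (2 * tan (\<theta> i / 2) + e')"
    and vertex_arc_length: "\<exists>e e'. \<bar>e\<bar> \<le> error_const \<eta> * \<delta>\<^sup>2 \<and> \<bar>e'\<bar> \<le> error_const \<eta> * \<delta>\<^sup>2 \<and>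
      R i * \<theta> i * (1 + e) \<le> \<delta> + e'"
    and vertex_conormal: "\<forall>s\<in>{0..l i}. \<bar>conormal_deriv (l i) (c i) (lam (vertex L \<gamma> i)) s\<bar> \<le> C0 * (8 * (1 + \<epsilon>)) * \<delta>"
proof -
  define K where "K = 36 * C0"
  define b where "b = (1 + cos \<eta>) / 2"
  define s0 where "s0 = turning_sine \<eta>"
  define a where "a = \<delta> / 2"
  let ?r1 = "incoming_ray \<phi> L \<gamma> i" and ?r2 = "outgoing_ray \<phi> L \<gamma> i" and ?q = "vertex L \<gamma> i"
  have K: "K > 0" using C0 by (simp add: K_def)
  have b: "0 < b" "b < 1" using cos_turning[OF \<eta>] by (auto simp: b_def)
  have s0: "0 < s0" "s0 \<le> 1" using turning_sine_range[OF \<eta>] by (auto simp: s0_def)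
  have s0_eq: "s0 = sqrt (1 - b\<^sup>2)" by (simp add: s0_def turning_sine_def b_def)
  have L: "0 < L i" "0 < L (Suc i)" and geo: "unit_speed_geodesic S A G (L i) (\<gamma> i)"
    using poly i by (auto simp: polygonal_def)
  have q: "?q \<in> S" using geo L by (auto simp: unit_speed_geodesic_def vertex_def)
  have \<delta>0: "0 < \<delta>" using L by (simp add: \<delta> edge_length_def)
  have le: "\<delta> < 1" "\<delta> < \<delta>1 / (8 * (1 + \<epsilon>))" "\<delta> < 1 / (6 * C0)" "\<delta> < (1 - cos \<eta>) / (8 * K)" "\<delta> < s0 / (24 * K)"
    using mesh unfolding mesh_bound_def by (auto simp: K_def s0_def)
  have a: "0 < a" "a \<le> 1" "a \<le> \<delta>" "a = edge_length L i / 2" using \<delta>0 le(1) by (auto simp: a_def \<delta>)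
  have sq: "a\<^sup>2 \<le> \<delta>" "a ^ 3 \<le> a\<^sup>2" "a\<^sup>2 \<le> \<delta>\<^sup>2"
  proof -
    have "a * a \<le> 1 * a" using a by (intro mult_right_mono) auto
    then show "a\<^sup>2 \<le> \<delta>" unfolding power2_eq_square using a(3) by linarith
    show "a ^ 3 \<le> a\<^sup>2" using a by (simp add: power_decreasing)
    show "a\<^sup>2 \<le> \<delta>\<^sup>2" using a by (intro power_mono) auto
  qed
  \<comment> \<open>The rounded corner stays within \<open>4 * \<delta>\<close> of the origin, and
    \<open>iso_image_ball\<close> asks for
    \<open>(1 + \<epsilon>) * (4 * \<delta>) \<le> d / 2\<close>.\<close>
  define d where "d = 8 * (1 + \<epsilon>) * \<delta>"
  have d: "0 < d" using \<delta>0 eps by (simp add: d_def)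
  have "d < \<delta>1" using eps le(2) by (simp add: d_def field_simps)
  note d = d this
  have mono: "X * a\<^sup>2 \<le> X * \<delta>" if "0 \<le> X" for X using sq(1) that by (rule mult_left_mono)
  have small: "3 * a < \<delta>1" "3 * C0 * a\<^sup>2 \<le> 1/2" "4 * K * a\<^sup>2 \<le> (1 - cos \<eta>) / 2" "6 * K * a\<^sup>2 \<le> s0 / 4"
  proof -
    have "8 * \<delta> \<le> d" using \<delta>0 eps by (simp add: d_def algebra_simps)
    then show "3 * a < \<delta>1" using d \<delta>0 unfolding a_def by linarith
    have "3 * C0 * \<delta> \<le> 1/2" "4 * K * \<delta> \<le> (1 - cos \<eta>) / 2" "6 * K * \<delta> \<le> s0 / 4"
      using le(3-5) C0 K by (simp_all add: field_simps)
    then show "3 * C0 * a\<^sup>2 \<le> 1/2" "4 * K * a\<^sup>2 \<le> (1 - cos \<eta>) / 2" "6 * K * a\<^sup>2 \<le> s0 / 4"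
      using mono[of "3 * C0"] mono[of "4 * K"] mono[of "6 * K"] C0 K by linarith+
  qed
  obtain w1 w2 Q ell1 ell2 where cor: "corner ?r1 ?r2 w1 w2 Q ell1 ell2"
    and ell: "\<bar>ell1 - a\<bar> \<le> 6 * K * a ^ 3 / s0" "\<bar>ell2 - a\<bar> \<le> 6 * K * a ^ 3 / s0"
    and ang: "\<bar>rounding_angle ?r1 ?r2 - \<theta> i\<bar> \<le> 4 * K * a\<^sup>2 / s0"
    and tn: "\<bar>tan (rounding_angle ?r1 ?r2 / 2) - tan (\<theta> i / 2)\<bar> \<le> 4 * K * a\<^sup>2 / (s0 * (1 - b))"
    and A1: "norm (fst ?r1) \<le> a + 3 * K * a ^ 3"
    using vertex_corner[OF poly i \<theta>[unfolded \<theta>_def] \<eta> b_def s0_eq a(4,2) small(1,2) small(3,4)[unfolded K_def]]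
    unfolding K_def \<theta>_def by metis
  interpret corner ?r1 ?r2 w1 w2 Q ell1 ell2 by (rule cor)
  have defs: "R i = rounding_radius ?r1 ?r2" "l i = len" "c i = rounding ?r1 ?r2"
    by (simp_all add: R_def l_def c_def corner_radius_def corner_length_def corner_curve_def)
  define N where "N = error_const \<eta>"
  have N_eq: "N = 4 * K / (s0 * \<eta>) + 12 * K / s0 + 8 * K / (s0 * (1 - b))"
    by (simp add: N_def error_const_def K_def s0_def b_def)
  have parts: "0 \<le> 4 * K / (s0 * \<eta>)" "0 \<le> 12 * K / s0" "0 \<le> 8 * K / (s0 * (1 - b))"
    using K s0 \<eta> b by auto
  have error: "X * a\<^sup>2 \<le> N * \<delta>\<^sup>2" if "X \<le> N" "0 \<le> X" for X
    using that sq(3) by (intro mult_mono) auto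
  have ell_a: "6 * K * a ^ 3 / s0 \<le> a / 4"
  proof -
    have "a * (6 * K * a\<^sup>2) \<le> a * (s0 / 4)" using small(4) a(1) by (intro mult_left_mono) auto
    then show ?thesis using s0 by (simp add: field_simps power2_eq_square power3_eq_cube)
  qed
  have m_a: "\<bar>m - a\<bar> \<le> 6 * K * a ^ 3 / s0" using ell by (simp add: min_def)
  have K3: "3 * K * a ^ 3 \<le> a / 8"
  proof -
    have "6 * K * a ^ 3 \<le> a / 4 * s0" using ell_a s0 by (simp add: pos_divide_le_eq)
    also have "\<dots> \<le> a / 4 * 1" using s0 a(1) by (intro mult_left_mono) auto
    finally show ?thesis by simp
  qed
  have img: "rounding ?r1 ?r2 s \<in> \<phi> ?q ` disk ?q d" if s: "s \<in> {0..len}" for s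
  proof (rule iso_image_ball[OF q d])
    have "norm (rounding ?r1 ?r2 s) \<le> norm (fst ?r1) + len" by (rule rounding_norm_le[OF s])
    also have "\<dots> \<le> (a + a / 8) + (\<bar>ell1 - ell2\<bar> + 2 * m)" using A1 K3 len_le by linarith
    \<comment> \<open>Both tangent lengths differ from \<open>a\<close> by at most
      \<open>a / 4\<close>, so the sum is a little over \<open>4 * a\<close>, well below
      \<open>8 * a = 4 * \<delta>\<close>.\<close>
    also have "\<dots> < 4 * \<delta>" using ell ell_a m_a a(1) unfolding a_def by linarith
    finally have "(1 + \<epsilon>) * norm (rounding ?r1 ?r2 s) < (1 + \<epsilon>) * (4 * \<delta>)"
      using eps by (intro mult_strict_left_mono) auto
    also have "(1 + \<epsilon>) * (4 * \<delta>) = d / 2" by (simp add: d_def)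
    finally show "(1 + \<epsilon>) * norm (rounding ?r1 ?r2 s) < d / 2" .
  qed
  show "f integrable_on {0..l i}"
    unfolding f defs by (rule corner_integrable[OF q d p cor img])
  show "energy_curve p (corner_path U \<phi> L \<gamma> i) (integral {0..l i} f)"
    using corner_energy_curve[OF q d p cor img]
    unfolding f defs by (simp add: corner_path_def[abs_def] Let_def U corner_curve_def corner_length_def)
  have \<theta>0: "0 < \<theta> i" "\<eta> \<le> \<theta> i" using \<theta> \<eta> by auto
  \<comment> \<open>Chosen so that \<open>\<theta> i * (1 + ?e)\<close> is exactly the rounding
    angle. The integral formula is then an identity, and the same error serves in the arc length
    estimate.\<close>
  let ?e = "rounding_angle ?r1 ?r2 / \<theta> i - 1"
  have e: "\<bar>?e\<bar> \<le> N * \<delta>\<^sup>2"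
  proof -
    have "\<bar>?e\<bar> = \<bar>rounding_angle ?r1 ?r2 - \<theta> i\<bar> / \<theta> i" using \<theta>0 by (simp add: diff_divide_distrib[symmetric] divide_simps)
    also have "\<dots> \<le> (4 * K * a\<^sup>2 / s0) / \<eta>" using ang \<theta>0 \<eta> by (intro frac_le) auto
    also have "\<dots> = 4 * K / (s0 * \<eta>) * a\<^sup>2" by simp
    also have "\<dots> \<le> N * \<delta>\<^sup>2" using parts by (intro error) (auto simp: N_eq)
    finally show ?thesis .
  qed
  have ra: "\<theta> i * (1 + ?e) = rounding_angle ?r1 ?r2" using \<theta>0 by (simp add: field_simps)
  have "((\<lambda>s. \<bar>plane_curvature (l i) (c i) s\<bar> powr p) has_integral R i powr (1 - p) * \<theta> i * (1 + ?e)) {0..l i}"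
    using curvature_integral[of p] unfolding defs mult.assoc ra .
  with e show "\<exists>e. \<bar>e\<bar> \<le> error_const \<eta> * \<delta>\<^sup>2 \<and>
      ((\<lambda>s. \<bar>plane_curvature (l i) (c i) s\<bar> powr p) has_integral R i powr (1 - p) * \<theta> i * (1 + e)) {0..l i}"
    unfolding N_def by blast
  \<comment> \<open>With these differences the expansion of the radius is
    \<open>m / tan (\<theta> / 2)\<close> with numerator and denominator doubled, where this
    \<open>\<theta>\<close> is the rounding angle.\<close>
  let ?e1 = "2 * m - \<delta>" and ?e2 = "2 * tan (rounding_angle ?r1 ?r2 / 2) - 2 * tan (\<theta> i / 2)"
  have e1: "\<bar>?e1\<bar> \<le> N * \<delta>\<^sup>2"
  proof -
    have "?e1 = 2 * (m - a)" by (simp add: a_def)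
    then have "\<bar>?e1\<bar> = 2 * \<bar>m - a\<bar>" by (simp only: abs_mult)
    also have "\<dots> \<le> 12 * K / s0 * a ^ 3" using m_a by simp
    also have "\<dots> \<le> 12 * K / s0 * a\<^sup>2" using sq(2) parts(2) by (intro mult_left_mono) auto
    also have "\<dots> \<le> N * \<delta>\<^sup>2" using parts by (intro error) (auto simp: N_eq)
    finally show ?thesis .
  qed
  have e2: "\<bar>?e2\<bar> \<le> N * \<delta>\<^sup>2"
  proof -
    have "\<bar>?e2\<bar> \<le> 8 * K / (s0 * (1 - b)) * a\<^sup>2" using tn by simp
    also have "\<dots> \<le> N * \<delta>\<^sup>2" using parts by (intro error) (auto simp: N_eq)
    finally show ?thesis .
  qed
  have "R i = (\<delta> + ?e1) / (2 * tan (\<theta> i / 2) + ?e2)" unfolding defs R_eq by simp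
  with e1 e2 show "\<exists>e e'. \<bar>e\<bar> \<le> error_const \<eta> * \<delta>\<^sup>2 \<and> \<bar>e'\<bar> \<le> error_const \<eta> * \<delta>\<^sup>2 \<and>
      R i = (\<delta> + e) / (2 * tan (\<theta> i / 2) + e')"
    unfolding N_def by blast
  \<comment> \<open>After substitution of both errors this is \<open>arc_length_le\<close>, as
    \<open>\<delta> + ?e1 = 2 * m\<close>.\<close>
  have "R i * \<theta> i * (1 + ?e) \<le> \<delta> + ?e1"
    using arc_length_le unfolding mult.assoc ra defs by simp
  with e e1 show "\<exists>e e'. \<bar>e\<bar> \<le> error_const \<eta> * \<delta>\<^sup>2 \<and> \<bar>e'\<bar> \<le> error_const \<eta> * \<delta>\<^sup>2 \<and>
      R i * \<theta> i * (1 + e) \<le> \<delta> + e'"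
    unfolding N_def by blast
  show "\<forall>s\<in>{0..l i}. \<bar>conormal_deriv (l i) (c i) (lam ?q) s\<bar> \<le> C0 * (8 * (1 + \<epsilon>)) * \<delta>"
  proof
    fix s assume "s \<in> {0..l i}"
    then have s: "s \<in> {0..len}" by (simp add: defs)
    have "\<bar>conormal_deriv (l i) (c i) (lam ?q) s\<bar> \<le> norm (grad (lam ?q) (rounding ?r1 ?r2 s)) * norm (- rot (T s))"
      unfolding defs conormal_deriv_eq[OF s] by (rule Cauchy_Schwarz_ineq2)
    also have "\<dots> \<le> C0 * d" using grad_lam_le[OF q d img[OF s]] by (simp add: norm_T)
    finally show "\<bar>conormal_deriv (l i) (c i) (lam ?q) s\<bar> \<le> C0 * (8 * (1 + \<epsilon>)) * \<delta>" by (simp add: d_def mult.assoc)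
  qed
qed

lemma edge_length_less_mesh:
  assumes "polygonal S A G k L \<gamma> \<and> mesh k L < M \<and> B" "i \<in> {1..<k}"
  shows "edge_length L i < M"
proof -
  have "L i \<le> mesh k L" unfolding mesh_def using assms(2) by (intro Max_ge) auto
  then show ?thesis using assms(1) by (auto simp: edge_length_def)
qed

lemma error_smallo: "(\<lambda>\<delta>. M * \<delta>\<^sup>2) \<in> o[at_right 0](\<lambda>\<delta>. \<delta>)" for M :: real
proof (rule smalloI_tendsto)
  have "((\<lambda>\<delta>. M * \<delta>) \<longlongrightarrow> M * 0) (at_right 0)" by (intro tendsto_intros)
  moreover have "\<forall>\<^sub>F \<delta> in at_right 0. M * \<delta>\<^sup>2 / \<delta> = M * \<delta>"
    by (simp add: eventually_at_filter power2_eq_square)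
  ultimately show "((\<lambda>\<delta>. M * \<delta>\<^sup>2 / \<delta>) \<longlongrightarrow> 0) (at_right 0)"
    by (simp add: tendsto_cong)
  show "\<forall>\<^sub>F \<delta>::real in at_right 0. \<delta> \<noteq> 0" by (simp add: eventually_at_filter)
qed

end

text \<open>\<open>C\<close> is chosen before \<open>\<eta>\<close> because the conormal estimate
  depends only on the size of the corner; the mesh bound and the error function may degenerate as
  the angles approach \<open>0\<close> or \<open>pi\<close>. One \<open>\<omega>\<close> for all
  polygonals makes the Landau symbols uniform.\<close>

theorem proposition3p3:
  fixes S :: "'a::t2_space set" and A :: "'a chart set"
    and G :: "'a chart \<Rightarrow> real^2 \<Rightarrow> real^2^2"
    and \<phi> :: "'a \<Rightarrow> 'a \<Rightarrow> real^2" and lam :: "'a \<Rightarrow> real^2 \<Rightarrow> real"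
    and p \<epsilon> \<delta>1 C0 :: real
  assumes "riemannian_surface S A G" and "compact S" and "orientable_surface S A"
    and "0 < \<epsilon>" and "0 < \<delta>1" and "0 < C0"
    and "normalized_isothermal_charts S A G \<epsilon> \<delta>1 C0 \<phi> lam"
    and "1 \<le> p"
  defines "U \<equiv> \<lambda>q. metric_disk S A G q (\<delta>1 / 2)"
  shows "\<exists>C>0. \<forall>\<eta>\<in>{0<..<pi/2}. \<exists>\<mu>>0. \<exists>\<omega>. \<omega> \<in> o[at_right 0](\<lambda>\<delta>. \<delta>) \<and>
    (\<forall>k L \<gamma>. polygonal S A G k L \<gamma> \<and> mesh k L < \<mu> \<and>
       (\<forall>i\<in>{1..<k}. turning_angle A G L \<gamma> i \<in> {\<eta>..pi - \<eta>}) \<longrightarrow>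
     (let c = rounded_polygonal U \<phi> k L \<gamma>;
          f = (\<lambda>i s. exp ((1 - p) * lam (vertex L \<gamma> i) (corner_curve \<phi> L \<gamma> i s)) *
                 \<bar>plane_curvature (corner_length \<phi> L \<gamma> i) (corner_curve \<phi> L \<gamma> i) s +
                  conormal_deriv (corner_length \<phi> L \<gamma> i) (corner_curve \<phi> L \<gamma> i)
                    (lam (vertex L \<gamma> i)) s\<bar> powr p) in
       (\<forall>i\<in>{1..<k}. f i integrable_on {0..corner_length \<phi> L \<gamma> i}) \<and>
       ((\<lambda>t. geodesic_curvature_norm A G c t powr p * speed A G c t) has_integral
          (\<Sum>i=1..<k. integral {0..corner_length \<phi> L \<gamma> i} (f i))) {0..1}) \<and>
     (\<forall>i\<in>{1..<k}.
       let \<delta> = edge_length L i; \<theta> = turning_angle A G L \<gamma> i;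
           R = corner_radius \<phi> L \<gamma> i; l = corner_length \<phi> L \<gamma> i;
           c = corner_curve \<phi> L \<gamma> i in
       (\<exists>e. \<bar>e\<bar> \<le> \<omega> \<delta> \<and>
          ((\<lambda>s. \<bar>plane_curvature l c s\<bar> powr p) has_integral R powr (1 - p) * \<theta> * (1 + e)) {0..l}) \<and>
       (\<exists>e e'. \<bar>e\<bar> \<le> \<omega> \<delta> \<and> \<bar>e'\<bar> \<le> \<omega> \<delta> \<and> R = (\<delta> + e) / (2 * tan (\<theta> / 2) + e')) \<and>
       (\<exists>e e'. \<bar>e\<bar> \<le> \<omega> \<delta> \<and> \<bar>e'\<bar> \<le> \<omega> \<delta> \<and> R * \<theta> * (1 + e) \<le> \<delta> + e') \<and>
       (\<forall>s\<in>{0..l}. \<bar>conormal_deriv l c (lam (vertex L \<gamma> i)) s\<bar> \<le> C * \<delta>)))"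
proof -
  interpret isothermal S A G \<phi> lam \<epsilon> \<delta>1 C0
    by unfold_locales (use assms in auto)
  show ?thesis
  \<comment> \<open>The gradient constant times the ratio of the chart diameter to the edge
    length.\<close>
  proof (rule exI[of _ "C0 * (8 * (1 + \<epsilon>))"], intro conjI ballI, goal_cases)
    case 1
    then show ?case using C0 eps by simp
  next
    case (2 \<eta>)
    then have \<eta>: "0 < \<eta>" "\<eta> < pi / 2" by auto
    show ?case
    proof (rule exI[of _ "mesh_bound \<eta>"], rule conjI, goal_cases)
      case 1
      show ?case by (rule mesh_bound_pos[OF \<eta>])
    next
      case 2
      show ?case
      proof (rule exI[of _ "\<lambda>\<delta>. error_const \<eta> * \<delta>\<^sup>2"], intro conjI allI impI, goal_cases)
        case 1
        show ?case by (rule error_smallo)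
      next
        case (2 k L \<gamma>)
        then have poly: "polygonal S A G k L \<gamma>" and angle: "\<And>i. i \<in> {1..<k} \<Longrightarrow> turning_angle A G L \<gamma> i \<in> {\<eta>..pi - \<eta>}"
          and mesh: "\<And>i. i \<in> {1..<k} \<Longrightarrow> edge_length L i < mesh_bound \<eta>"
          using edge_length_less_mesh by blast+
        note expansion = vertex_expansion[OF poly _ angle \<eta> refl mesh U_def[THEN meta_eq_to_obj_eq] assms(8) refl]
        \<comment> \<open>\<open>k\<close> arcs have \<open>k - 1\<close> interior vertices; for
          \<open>k = 1\<close> there is no corner and the sum is empty.\<close>
        have k: "k - 1 < k" "{1..k - 1} = {1..<k}" using poly by (auto simp: polygonal_def)
        show ?case
          unfolding Let_def rounded_polygonal_def
          by (intro conjI ballI expansion(1)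
              energy_curve_integral[OF rounded_upto_energy_curve[OF poly expansion(2) k(1)], unfolded k(2)])
      next
        case (3 k L \<gamma>)
        then have poly: "polygonal S A G k L \<gamma>" and angle: "\<And>i. i \<in> {1..<k} \<Longrightarrow> turning_angle A G L \<gamma> i \<in> {\<eta>..pi - \<eta>}"
          and mesh: "\<And>i. i \<in> {1..<k} \<Longrightarrow> edge_length L i < mesh_bound \<eta>"
          using edge_length_less_mesh by blast+
        note expansion = vertex_expansion[OF poly _ angle \<eta> refl mesh U_def[THEN meta_eq_to_obj_eq] assms(8) refl]
        show ?case
          unfolding Let_def by (intro ballI conjI expansion(3-6))
      qed
    qed
  qed
qed

end
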